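(* There exists a constant $C>0$ such that for every $\mu>0$ $$\|\Pi_{\mu,\sqrt{\mathcal L_M}}\|_{\mathscr L(L^2(M),L^4(M))}=\|\Pi_{\mu,\sqrt{\mathcal L_M}}\|_{\mathscr L(L^{4/3}(M),L^2(M))}\le C\,\mu,$$ where $M$ is the standard three-dimensional Heisenberg nilmanifold, $\mathcal L_M$ its canonical sub-Laplacian and $\Pi_{\mu,\sqrt{\mathcal L_M}}$ the spectral projector of $\sqrt{\mathcal L_M}$ at $\mu$.
   Context: The Heisenberg group $\mathbb H_1$ is $\mathbb R^3$ with the group law $(a,b,c)(a',b',c')=(a+a',b+b',c+c'+ab')$. Let $\Gamma=\mathbb Z^3\subset\mathbb H_1$ (a discrete subgroup) and $M=\Gamma\backslash\mathbb H_1=\{\dot x=\Gamma x : x\in\mathbb H_1\}$, a compact smooth manifold. Functions on $M$ are identified with functions $f$ on $\mathbb H_1$ that satisfy $f(\gamma x)=f(x)$ for all $\gamma\in\Gamma$. $M$ carries the measure $d\dot x$ that coincides with Lebesgue measure $da\,db\,dc$ on the fundamental domain $[0,1)^3$ (so $M$ has volume $1$), and $L^p(M)$ is taken with respect to this measure. The left-invariant vector fields $A=\partial_a$, $B=\partial_b+a\partial_c$ on $\mathbb H_1$ descend to vector fields $A_M,B_M$ on $M$. The canonical sub-Laplacian is $\mathcal L_M=-(A_M^2+B_M^2)$; it is non-negative and essentially self-adjoint on $C^\infty(M)\subset L^2(M)$, and $\mathcal L_M$ also denotes its self-adjoint extension. Its spectrum is discrete, consisting of eigenvalues of finite multiplicity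 with smooth eigenfunctions. $\Pi_{\mu,\sqrt{\mathcal L_M}}$ is the orthogonal projection of $L^2(M)$ onto the eigenspace $\ker(\mathcal L_M-\mu^2)$ (it is $0$ if $\mu$ is not an eigenvalue of $\sqrt{\mathcal L_M}$). Since this eigenspace is finite dimensional and consists of smooth functions, the projection also acts on $L^{4/3}(M)$ via $f\mapsto\sum_j\left(\int_M f\overline{e_j}\,d\dot x\right)e_j$ for an orthonormal basis $(e_j)$ of the eigenspace. $\|\cdot\|_{\mathscr L(X,Y)}$ is the operator norm from $X$ to $Y$. *)

theory Defs
  imports "HOL-Analysis.Analysis"
begin

section \<open>The Heisenberg nilmanifold\<close>

type_synonym heis = "real \<times> real \<times> real"

fun heis_mult :: "heis \<Rightarrow> heis \<Rightarrow> heis" where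
  "heis_mult (a, b, c) (a', b', c') = (a + a', b + b', c + c' + a * b')"

definition heis_lattice :: "heis set" where
  "heis_lattice = \<int> \<times> \<int> \<times> \<int>"

text \<open>
  A function on \<open>M\<close>, the quotient of the Heisenberg group by \<open>heis_lattice\<close>, is a function on the
  group invariant under left translation by the lattice.  The measure of \<open>M\<close> is Lebesgue measure
  on the fundamental domain; elements of \<open>L\<^sup>p(M)\<close> are represented by everywhere defined Borel
  functions, and two of them are identified only where \<open>AE\<close>, norms or integrals say so.
\<close>

definition nil_invariant :: "(heis \<Rightarrow> complex) \<Rightarrow> bool" where
  "nil_invariant f \<longleftrightarrow> (\<forall>\<gamma>\<in>heis_lattice. \<forall>x. f (heis_mult \<gamma> x) = f x)"

definition nilM :: "heis measure" where
  "nilM = restrict_space lborel ({0..<1} \<times> {0..<1} \<times> {0..<1})"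

definition nil_norm :: "real \<Rightarrow> (heis \<Rightarrow> complex) \<Rightarrow> ennreal" where
  "nil_norm p f =
     (let I = \<integral>\<^sup>+x. ennreal (cmod (f x) powr p) \<partial>nilM
      in if I = \<infinity> then \<infinity> else ennreal (enn2real I powr (1 / p)))"

definition nil_Lp :: "real \<Rightarrow> (heis \<Rightarrow> complex) set" where
  "nil_Lp p = {f. nil_invariant f \<and> f \<in> borel_measurable borel \<and> nil_norm p f < \<infinity>}"

definition nil_inner :: "(heis \<Rightarrow> complex) \<Rightarrow> (heis \<Rightarrow> complex) \<Rightarrow> complex" where
  "nil_inner f g = (LINT x|nilM. f x * cnj (g x))"

definition nil_opnorm ::
    "real \<Rightarrow> real \<Rightarrow> ((heis \<Rightarrow> complex) \<Rightarrow> (heis \<Rightarrow> complex)) \<Rightarrow> ennreal" where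
  "nil_opnorm p q T = (SUP f\<in>{f \<in> nil_Lp p. nil_norm p f \<le> 1}. nil_norm q (T f))"


section \<open>The sub-Laplacian\<close>

fun Ck :: "nat \<Rightarrow> (heis \<Rightarrow> complex) \<Rightarrow> bool" where
  "Ck 0 f \<longleftrightarrow> continuous_on UNIV f"
| "Ck (Suc k) f \<longleftrightarrow>
     (\<forall>x. f differentiable (at x)) \<and> (\<forall>v. Ck k (\<lambda>x. frechet_derivative f (at x) v))"

definition nil_smooth :: "(heis \<Rightarrow> complex) set" where
  "nil_smooth = {f. nil_invariant f \<and> (\<forall>k. Ck k f)}"

text \<open>
  The left-invariant fields \<open>\<partial>\<^sub>a\<close> and \<open>\<partial>\<^sub>b + a \<partial>\<^sub>c\<close>, acting as directional derivatives.
\<close>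

definition field_A :: "(heis \<Rightarrow> complex) \<Rightarrow> heis \<Rightarrow> complex" where
  "field_A f x = frechet_derivative f (at x) (1, 0, 0)"

definition field_B :: "(heis \<Rightarrow> complex) \<Rightarrow> heis \<Rightarrow> complex" where
  "field_B f x = frechet_derivative f (at x) (0, 1, fst x)"

definition sublap :: "(heis \<Rightarrow> complex) \<Rightarrow> heis \<Rightarrow> complex" where
  "sublap f x = - (field_A (field_A f) x + field_B (field_B f) x)"

text \<open>
  As \<open>sublap\<close> on \<open>nil_smooth\<close> is essentially self-adjoint, its self-adjoint extension is its
  closure: \<open>sublap_ext f g\<close> says that \<open>f\<close> is in the domain of the closure and is mapped to \<open>g\<close>,
  i.e. that \<open>(f, g)\<close> is in the closure of the graph in \<open>L\<^sup>2(M) \<times> L\<^sup>2(M)\<close>.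
\<close>

definition sublap_ext :: "(heis \<Rightarrow> complex) \<Rightarrow> (heis \<Rightarrow> complex) \<Rightarrow> bool" where
  "sublap_ext f g \<longleftrightarrow> f \<in> nil_Lp 2 \<and> g \<in> nil_Lp 2 \<and>
     (\<exists>\<phi>. (\<forall>n::nat. \<phi> n \<in> nil_smooth) \<and>
        (\<lambda>n. nil_norm 2 (\<lambda>x. \<phi> n x - f x)) \<longlonglongrightarrow> 0 \<and>
        (\<lambda>n. nil_norm 2 (\<lambda>x. sublap (\<phi> n) x - g x)) \<longlonglongrightarrow> 0)"


section \<open>Spectral projectors of the square root of the sub-Laplacian\<close>

definition eigenspace :: "real \<Rightarrow> (heis \<Rightarrow> complex) set" where
  "eigenspace \<mu> = {f. sublap_ext f (\<lambda>x. of_real (\<mu>\<^sup>2) * f x)}"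

text \<open>The orthogonal projection of \<open>L\<^sup>2(M)\<close> onto the eigenspace (unique up to null sets).\<close>

definition spec_proj :: "real \<Rightarrow> (heis \<Rightarrow> complex) \<Rightarrow> heis \<Rightarrow> complex" where
  "spec_proj \<mu> f =
     (SOME g. g \<in> eigenspace \<mu> \<and> (\<forall>h\<in>eigenspace \<mu>. nil_inner (\<lambda>x. f x - g x) h = 0))"

definition is_eigenbasis :: "real \<Rightarrow> (heis \<Rightarrow> complex) set \<Rightarrow> bool" where
  "is_eigenbasis \<mu> E \<longleftrightarrow> finite E \<and> E \<subseteq> eigenspace \<mu> \<and>
     (\<forall>e\<in>E. \<forall>e'\<in>E. nil_inner e e' = (if e = e' then 1 else 0)) \<and>
     (\<forall>f\<in>eigenspace \<mu>. \<exists>c. AE x in nilM. f x = (\<Sum>e\<in>E. c e * e x))"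

text \<open>
  The action of the projector on \<open>L\<^bsup>4/3\<^esup>(M)\<close>.  The eigenspace has a finite orthonormal basis,
  and the result does not depend (up to null sets) on the one chosen.
\<close>

definition spec_proj_ext :: "real \<Rightarrow> (heis \<Rightarrow> complex) \<Rightarrow> heis \<Rightarrow> complex" where
  "spec_proj_ext \<mu> f =
     (\<lambda>x. \<Sum>e\<in>(SOME E. is_eigenbasis \<mu> E). nil_inner f e * e x)"

end

theory Submission
  imports Defs
begin

text \<open>
  Everything follows from one pointwise bound: an eigenfunction \<open>f\<close> with \<open>L f = \<mu>\<^sup>2 f\<close>, \<open>\<mu> > 0\<close>,
  satisfies \<open>\<bar>f\<bar> \<le> K \<mu>\<^sup>2 \<parallel>f\<parallel>\<^sub>2\<close> almost everywhere.  It gives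
  \<open>\<parallel>f\<parallel>\<^sub>4 \<le> \<parallel>f\<parallel>\<^sub>\<infinity>\<^bsup>1/2\<^esup> \<parallel>f\<parallel>\<^sub>2\<^bsup>1/2\<^esup> \<le> K\<^bsup>1/2\<^esup> \<mu> \<parallel>f\<parallel>\<^sub>2\<close> and bounds the dimension of the eigenspace by
  \<open>K\<^sup>2 \<mu>\<^sup>4\<close>; the equality of the two operator norms is then Hoelder duality.

  No spectral decomposition is used.  With \<open>C = [A, B] = \<partial>\<^sub>c\<close>, integration by parts bounds
  \<open>\<parallel>A f\<parallel>\<close>, \<open>\<parallel>B f\<parallel>\<close> by \<open>\<mu>\<close>, and \<open>\<parallel>C f\<parallel>\<close>, \<open>\<parallel>A B f\<parallel>\<close> by \<open>\<mu>\<^sup>2\<close>, up to constants, and the same holds for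
  the eigenfunction \<open>C f\<close>.  A one-dimensional Sobolev inequality applied successively along \<open>C\<close>, \<open>B\<close>
  and \<open>A\<close>, at scales adapted to \<open>\<mu>\<close>, turns these bounds into the pointwise one, with
  \<open>(1 + \<mu>)\<^sup>2\<close> in place of \<open>\<mu>\<^sup>2\<close>; a Poincare inequality excludes eigenvalues with small \<open>\<mu> > 0\<close>.
  Elements of the domain of the closure are only limits of smooth functions, so \<open>C f\<close> makes sense only
  after averaging along the centre, which commutes with \<open>L\<close>; all estimates are made on the smooth
  approximants and passed to the limit.
\<close>

text \<open>The bound for \<open>field_C f\<close> is self-referential. Since C = [A, B], the square
  of ||C f|| equals <A f, B C f> - <B f, A C f>; the energy bounds for f and for the eigenfunction C
  f make this at most 2 \<mu>^2 ||f|| ||C f||, and one factor ||C f|| cancels. The cancellation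
  needs C f to be an approximate eigenfunction of finite norm beforehand. Averaging over a central
  segment of length h supplies this with a bound 2 / h; the cancellation then removes h from the
  result, so h can be taken as small as the comparison with f requires. The pointwise estimate
  differentiates along C once, and bounding A B of the outcome costs one more C, so C C f must be
  available too and two averages are composed.

  No regularity theorem for eigenfunctions is proved: bounds hold almost everywhere, which is all
  that the norms see. The dimension bound matters because \<open>spec_proj_ext\<close> picks its
  basis by choice and is meaningful only once a finite eigenbasis is known to exist; the projection
  picked in \<open>spec_proj\<close> rests on the same fact.\<close>

declare split_paired_All [simp del] split_paired_Ex [simp del]

section \<open>Smooth functions\<close>

abbreviation dd :: "(heis \<Rightarrow> complex) \<Rightarrow> heis \<Rightarrow> heis \<Rightarrow> complex" where
  "dd f v \<equiv> \<lambda>x. frechet_derivative f (at x) v"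

lemma Ck_continuous: "Ck k f \<Longrightarrow> continuous_on UNIV f"
proof (cases k)
  case (Suc j)
  assume "Ck k f"
  then have "f differentiable (at x)" for x using Suc by simp
  then show ?thesis
    by (simp add: continuous_at_imp_continuous_on differentiable_imp_continuous_within)
qed simp

lemma Ck_Suc_D: "Ck (Suc k) f \<Longrightarrow> Ck k f"
proof (induction k arbitrary: f)
  case 0
  then show ?case using Ck_continuous[OF 0] by simp
next
  case (Suc k)
  then show ?case by auto
qed

lemma has_derivative_dd:
  "f differentiable (at x) \<Longrightarrow> (f has_derivative (\<lambda>v. dd f v x)) (at x)"
  by (simp add: frechet_derivative_works)

lemma dd_eq: "(f has_derivative D) (at x) \<Longrightarrow> dd f v x = D v"
  using frechet_derivative_at by metis

lemma Ck_SucI: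
  assumes "\<And>x. (f has_derivative D x) (at x)" "\<And>v. Ck k (\<lambda>x. D x v)"
  shows "Ck (Suc k) f"
proof -
  have "dd f v = (\<lambda>x. D x v)" for v using dd_eq[OF assms(1)] by (rule ext)
  moreover have "f differentiable (at x)" for x using assms(1) unfolding differentiable_def by fast
  ultimately show ?thesis using assms(2) by simp
qed

lemma Ck_const: "Ck k (\<lambda>x. c)"
proof (induction k arbitrary: c)
  case (Suc k)
  have "dd (\<lambda>x. c) v = (\<lambda>x. 0)" for v
    by (simp add: frechet_derivative_const)
  then show ?case using Suc by simp
qed simp

lemma Ck_bounded_linear:
  assumes l: "bounded_linear l"
  shows "Ck k f \<Longrightarrow> Ck k (\<lambda>x. l (f x))"
proof (induction k arbitrary: f)
  case 0
  then show ?case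
    using linear_continuous_on_compose[OF _ bounded_linear.linear[OF l]] by simp
next
  case (Suc k)
  have d: "((\<lambda>x. l (f x)) has_derivative (\<lambda>v. l (dd f v x))) (at x)" for x
    using Suc.prems by (intro bounded_linear.has_derivative[OF l] has_derivative_dd) simp
  show ?case using Suc by (intro Ck_SucI[OF d]) simp
qed

lemma Ck_add: "Ck k f \<Longrightarrow> Ck k g \<Longrightarrow> Ck k (\<lambda>x. f x + g x)"
proof (induction k arbitrary: f g)
  case 0
  then show ?case by (auto intro: continuous_intros)
next
  case (Suc k)
  have d: "((\<lambda>x. f x + g x) has_derivative (\<lambda>v. dd f v x + dd g v x)) (at x)" for x
    using Suc.prems by (intro has_derivative_add has_derivative_dd) simp_all
  show ?case using Suc by (intro Ck_SucI[OF d]) simp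
qed

lemma Ck_mult: "Ck k f \<Longrightarrow> Ck k g \<Longrightarrow> Ck k (\<lambda>x. f x * g x)"
proof (induction k arbitrary: f g)
  case 0
  then show ?case by (auto intro: continuous_intros)
next
  case (Suc k)
  have d: "((\<lambda>x. f x * g x) has_derivative (\<lambda>v. f x * dd g v x + dd f v x * g x)) (at x)" for x
    using Suc.prems by (intro has_derivative_mult has_derivative_dd) simp_all
  have "Ck k f" "Ck k g" using Suc.prems Ck_Suc_D by blast+
  then show ?case using Suc by (intro Ck_SucI[OF d] Ck_add Suc.IH) auto
qed

lemma Ck_linear:
  assumes l: "bounded_linear (l :: heis \<Rightarrow> complex)"
  shows "Ck k l"
proof (cases k)
  case 0
  then show ?thesis using l by (simp add: linear_continuous_on)
next
  case (Suc j)
  show ?thesis unfolding Suc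
    by (intro Ck_SucI[OF bounded_linear_imp_has_derivative[OF l]] Ck_const)
qed

definition "smooth f \<longleftrightarrow> (\<forall>k. Ck k f)"

lemma smooth_diff: "smooth f \<Longrightarrow> f differentiable (at x)"
  unfolding smooth_def by (metis Ck.simps(2))

lemma smooth_dd [simp]: "smooth f \<Longrightarrow> smooth (dd f v)"
  unfolding smooth_def by (metis Ck.simps(2))

lemma smooth_has_derivative: "smooth f \<Longrightarrow> (f has_derivative (\<lambda>v. dd f v x)) (at x)"
  by (intro has_derivative_dd smooth_diff)

lemma smooth_continuous: "smooth f \<Longrightarrow> continuous_on S f"
  unfolding smooth_def using Ck_continuous continuous_on_subset by blast

lemma smooth_continuous_compose:
  assumes "smooth f" "continuous_on S g"
  shows "continuous_on S (\<lambda>x. f (g x))"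
  using smooth_continuous[OF assms(1), of UNIV] assms(2)
  by (rule continuous_on_compose2) auto

lemma smooth_section_continuous [simp]:
  assumes "smooth f"
  shows "continuous_on S (\<lambda>a. f (a, b, c))" "continuous_on S (\<lambda>b. f (a, b, c))"
    "continuous_on S (\<lambda>c. f (a, b, c))" "continuous_on S (\<lambda>c. f (a, b, c + s))"
    "continuous_on S (\<lambda>c. f (a, b, c - s))" "continuous_on S (\<lambda>b. f (a, b, c + r * b))"
  by (intro smooth_continuous_compose[OF assms] continuous_intros)+

lemma smooth_const [simp]: "smooth (\<lambda>x. c)"
  and smooth_add [simp]: "smooth f \<Longrightarrow> smooth g \<Longrightarrow> smooth (\<lambda>x. f x + g x)"
  and smooth_mult [simp]: "smooth f \<Longrightarrow> smooth g \<Longrightarrow> smooth (\<lambda>x. f x * g x)"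
  and smooth_bounded_linear: "bounded_linear l \<Longrightarrow> smooth f \<Longrightarrow> smooth (\<lambda>x. l (f x))"
  and smooth_linear: "bounded_linear m \<Longrightarrow> smooth m"
  by (simp_all add: smooth_def Ck_const Ck_add Ck_mult Ck_bounded_linear Ck_linear)

lemma smooth_uminus [simp]: "smooth f \<Longrightarrow> smooth (\<lambda>x. - f x)"
  by (rule smooth_bounded_linear[OF bounded_linear_minus[OF bounded_linear_ident]])

lemma smooth_diff_fun [simp]: "smooth f \<Longrightarrow> smooth g \<Longrightarrow> smooth (\<lambda>x. f x - g x)"
  using smooth_add[of f "\<lambda>x. - g x"] by simp

lemma smooth_cnj [simp]: "smooth f \<Longrightarrow> smooth (\<lambda>x. cnj (f x))"
  by (rule smooth_bounded_linear[OF bounded_linear_cnj])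

lemma smooth_fst [simp]: "smooth (\<lambda>x. complex_of_real (fst x))"
  by (intro smooth_linear bounded_linear_compose[OF bounded_linear_of_real] bounded_linear_fst)

text \<open>\<open>Ck\<close> peels off one derivative at a time, so a class of differentiable
  functions closed under directional derivatives suffices. For averages along the centre the class
  is that of all averages of smooth functions.\<close>

lemma smooth_coinduct:
  assumes "P f"
    and *: "\<And>g. P g \<Longrightarrow> (\<forall>x. g differentiable (at x)) \<and> (\<forall>v. P (dd g v))"
  shows "smooth f"
proof -
  have "Ck k g" if "P g" for k g
    using that
  proof (induction k arbitrary: g)
    case 0
    then show ?case
      using * by (simp add: continuous_at_imp_continuous_on differentiable_imp_continuous_within)
  next
    case (Suc k)
    then show ?case using * by auto
  qed
  then show ?thesis using assms by (auto simp: smooth_def)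
qed

lemma dd_linear: "smooth f \<Longrightarrow> linear (\<lambda>v. dd f v x)"
  using smooth_has_derivative has_derivative_linear by blast

lemma dd_add_dir: "smooth f \<Longrightarrow> dd f (v + w) x = dd f v x + dd f w x"
  using dd_linear linear_add by blast

lemma dd_scaleR_dir: "smooth f \<Longrightarrow> dd f (r *\<^sub>R v) x = r *\<^sub>R dd f v x"
  by (rule linear_scale[OF dd_linear])

lemma dd_add: "smooth f \<Longrightarrow> smooth g \<Longrightarrow> dd (\<lambda>x. f x + g x) v x = dd f v x + dd g v x"
  by (intro dd_eq has_derivative_add smooth_has_derivative)

lemma dd_mult:
  "smooth f \<Longrightarrow> smooth g \<Longrightarrow> dd (\<lambda>x. f x * g x) v x = f x * dd g v x + dd f v x * g x"
  by (rule dd_eq[OF has_derivative_mult[OF smooth_has_derivative smooth_has_derivative]])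

lemma dd_cnj: "smooth f \<Longrightarrow> dd (\<lambda>x. cnj (f x)) v x = cnj (dd f v x)"
  by (rule dd_eq[OF bounded_linear.has_derivative[OF bounded_linear_cnj smooth_has_derivative]])

lemma dd_cmult: "smooth f \<Longrightarrow> dd (\<lambda>x. c * f x) v x = c * dd f v x"
  by (simp add: dd_mult frechet_derivative_const)

lemma dd_fst: "dd (\<lambda>x. complex_of_real (fst x)) v x = of_real (fst v)"
  by (intro dd_eq bounded_linear_imp_has_derivative bounded_linear_compose[OF bounded_linear_of_real] bounded_linear_fst)

lemma smooth_line_derivative:
  assumes "smooth f"
  shows "((\<lambda>t. f (x + t *\<^sub>R v)) has_vector_derivative dd f v (x + t *\<^sub>R v)) (at t within S)"
proof -
  have "((\<lambda>t. f (x + t *\<^sub>R v)) has_derivative (\<lambda>s. dd f (s *\<^sub>R v) (x + t *\<^sub>R v))) (at t within S)"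
    by (rule has_derivative_compose[where g=f, OF _ smooth_has_derivative[OF assms]])
       (auto intro!: derivative_eq_intros)
  then show ?thesis
    by (simp add: has_vector_derivative_def dd_scaleR_dir[OF assms])
qed

text \<open>Symmetry of second derivatives by differentiation under the integral sign: the increment
  of f along v is the integral of \<open>dd f v\<close>; differentiating first across, along w, and
  then in the upper limit s gives both orders.\<close>

lemma dd_commute:
  assumes f: "smooth f"
  shows "dd (dd f v) w x = dd (dd f w) v x"
proof -
  let ?p = "\<lambda>s t. x + s *\<^sub>R v + t *\<^sub>R w"
  have p: "?p s t = (x + t *\<^sub>R w) + s *\<^sub>R v" for s t by (simp add: algebra_simps)
  have ftc: "((\<lambda>\<sigma>. dd f v (?p \<sigma> t)) has_integral f (?p s t) - f (?p 0 t)) {0..s}" if "0 \<le> s" for s t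
    by (rule fundamental_theorem_of_calculus[OF that]) (simp add: p smooth_line_derivative[OF f])
  have key: "dd f w (?p s 0) - dd f w x = integral {0..s} (\<lambda>\<sigma>. dd (dd f v) w (?p \<sigma> 0))"
    if "0 \<le> s" for s
  proof -
    have "((\<lambda>t. integral (cbox 0 s) (\<lambda>\<sigma>. dd f v (?p \<sigma> t))) has_vector_derivative
       integral (cbox 0 s) (\<lambda>\<sigma>. dd (dd f v) w (?p \<sigma> 0))) (at 0 within UNIV)"
    proof (rule leibniz_rule_vector_derivative[where U=UNIV])
      show "continuous_on (UNIV \<times> cbox 0 s) (\<lambda>(t, \<sigma>). dd (dd f v) w (?p \<sigma> t))"
        by (auto simp: split_beta intro!: continuous_intros smooth_continuous_compose[OF smooth_dd[OF smooth_dd[OF f]]])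
      show "(\<lambda>\<sigma>. dd f v (?p \<sigma> t)) integrable_on cbox 0 s" for t
        using ftc[OF that] by (auto simp: integrable_on_def)
    qed (use f in \<open>auto intro: smooth_line_derivative[where f="dd f v"]\<close>)
    moreover have "integral (cbox 0 s) (\<lambda>\<sigma>. dd f v (?p \<sigma> t)) = f (?p s t) - f (?p 0 t)" for t
      using ftc[OF that] by (auto simp: integral_unique)
    ultimately have a: "((\<lambda>t. f (?p s t) - f (?p 0 t)) has_vector_derivative
       integral {0..s} (\<lambda>\<sigma>. dd (dd f v) w (?p \<sigma> 0))) (at 0)"
      by simp
    have b: "((\<lambda>t. f (?p s t) - f (?p 0 t)) has_vector_derivative
       dd f w (?p s 0) - dd f w (?p 0 0)) (at 0)"
      by (intro has_vector_derivative_diff smooth_line_derivative f)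
    show ?thesis using vector_derivative_unique_at[OF a b] by simp
  qed
  \<comment> \<open>The formula \<open>key\<close> is known for nonnegative s only, so the
    derivative at 0 is one-sided; uniqueness still holds within {0..1}.\<close>
  have "((\<lambda>s. integral {0..s} (\<lambda>\<sigma>. dd (dd f v) w (?p \<sigma> 0))) has_vector_derivative
       dd (dd f v) w (?p 0 0)) (at 0 within {0..1})"
    by (rule integral_has_vector_derivative) (auto intro!: continuous_intros smooth_continuous_compose[OF smooth_dd[OF smooth_dd[OF f]]])
  then have "((\<lambda>s. dd f w (?p s 0) - dd f w x) has_vector_derivative
       dd (dd f v) w (?p 0 0)) (at 0 within {0..1})"
    by (rule has_vector_derivative_transform[rotated 2]) (use key in auto)
  moreover have "((\<lambda>s. dd f w (?p s 0) - dd f w x) has_vector_derivative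
       dd (dd f w) v (?p 0 0)) (at 0 within {0..1})"
    using has_vector_derivative_diff[OF smooth_line_derivative[OF smooth_dd[OF f, of w], of x v 0 "{0..1}"] has_vector_derivative_const[of "dd f w x"]]
    by simp
  ultimately have "dd (dd f v) w (?p 0 0) = dd (dd f w) v (?p 0 0)"
    by (intro vector_derivative_unique_within[rotated]) (auto simp: at_within_Icc_at_right trivial_limit_at_right_real)
  then show ?thesis by simp
qed

section \<open>The algebra of invariant smooth functions\<close>

definition field_C :: "(heis \<Rightarrow> complex) \<Rightarrow> heis \<Rightarrow> complex" where
  "field_C f x = frechet_derivative f (at x) (0, 0, 1)"

text \<open>The direction of \<open>field_B\<close> varies with the point. Splitting it into
  constant directions makes \<open>field_B f\<close> an expression to which the closure rules for
  \<open>smooth\<close> apply.\<close>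

lemma field_B_eq: "smooth f \<Longrightarrow> field_B f x = dd f (0,1,0) x + of_real (fst x) * field_C f x"
proof -
  assume f: "smooth f"
  have "(0, 1, fst x) = (0,1,0) + fst x *\<^sub>R ((0,0,1)::heis)" by simp
  then show ?thesis
    unfolding field_B_def field_C_def
    by (metis dd_add_dir[OF f] dd_scaleR_dir[OF f] scaleR_conv_of_real)
qed

lemma smooth_A [simp]: "smooth f \<Longrightarrow> smooth (field_A f)"
  and smooth_C [simp]: "smooth f \<Longrightarrow> smooth (field_C f)"
  unfolding field_A_def field_C_def by simp_all

lemma smooth_B [simp]:
  assumes f: "smooth f" shows "smooth (field_B f)"
proof -
  have "field_B f = (\<lambda>x. dd f (0,1,0) x + of_real (fst x) * field_C f x)"
    using field_B_eq[OF f] by auto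
  then show ?thesis using f by simp
qed

lemma nil_smooth_iff: "f \<in> nil_smooth \<longleftrightarrow> nil_invariant f \<and> smooth f"
  by (simp add: nil_smooth_def smooth_def)

lemma nil_smooth_smooth [simp]: "f \<in> nil_smooth \<Longrightarrow> smooth f"
  by (simp add: nil_smooth_iff)

text \<open>Chain rule for a left translation, whose linear part sends (u, v, w) to (u, v, w + p v).
  It carries the direction (0, 1, a) of \<open>field_B\<close> at x to its direction at the
  translated point, and it fixes those of \<open>field_A\<close> and \<open>field_C\<close>.\<close>

lemma dd_invariant:
  assumes "nil_invariant f" "smooth f" "(p, q, r) \<in> heis_lattice"
  shows "dd f (u, v, w + p * v) (heis_mult (p, q, r) x) = dd f (u, v, w) x"
proof -
  let ?g = "heis_mult (p, q, r)" and ?l = "\<lambda>v::heis. (fst v, fst (snd v), snd (snd v) + p * fst (snd v))"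
  have g: "?g = (\<lambda>y. (p, q, r) + ?l y)"
    by (auto simp: fun_eq_iff)
  have "(?g has_derivative ?l) (at x)"
    unfolding g by (auto intro!: derivative_eq_intros)
  from has_derivative_compose[OF this smooth_has_derivative[OF assms(2)]]
  have "((\<lambda>y. f (?g y)) has_derivative (\<lambda>v. dd f (?l v) (?g x))) (at x)" .
  moreover have "(\<lambda>y. f (?g y)) = f"
    using assms by (auto simp: nil_invariant_def)
  ultimately have "(f has_derivative (\<lambda>v. dd f (?l v) (?g x))) (at x)" by simp
  from dd_eq[OF this, of "(u, v, w)"] show ?thesis by simp
qed

lemma nil_smooth_fields:
  assumes "f \<in> nil_smooth"
  shows nil_smooth_A [simp]: "field_A f \<in> nil_smooth"
    and nil_smooth_B [simp]: "field_B f \<in> nil_smooth"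
    and nil_smooth_C [simp]: "field_C f \<in> nil_smooth"
proof -
  have f: "nil_invariant f" "smooth f" using assms by (auto simp: nil_smooth_iff)
  have "field_A f (heis_mult \<gamma> x) = field_A f x" "field_C f (heis_mult \<gamma> x) = field_C f x"
    "field_B f (heis_mult \<gamma> x) = field_B f x" if "\<gamma> \<in> heis_lattice" for \<gamma> x
  proof -
    obtain p q r where \<gamma>: "\<gamma> = (p, q, r)" by (metis prod_cases3)
    have fx: "fst (heis_mult (p, q, r) x) = fst x + p" by (cases x) auto
    note d = dd_invariant[OF f that[unfolded \<gamma>]]
    show "field_A f (heis_mult \<gamma> x) = field_A f x"
      using d[of x "1" "0" "0"] by (simp add: field_A_def \<gamma>)
    show "field_C f (heis_mult \<gamma> x) = field_C f x"
      using d[of x "0" "0" "1"] by (simp add: field_C_def \<gamma>)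
    show "field_B f (heis_mult \<gamma> x) = field_B f x"
      using d[of x "0" "1" "fst x"] by (simp add: field_B_def \<gamma> fx)
  qed
  then show "field_A f \<in> nil_smooth" "field_B f \<in> nil_smooth" "field_C f \<in> nil_smooth"
    using f by (auto simp: nil_smooth_iff nil_invariant_def)
qed

lemma nil_smooth_add [simp]: "f \<in> nil_smooth \<Longrightarrow> g \<in> nil_smooth \<Longrightarrow> (\<lambda>x. f x + g x) \<in> nil_smooth"
  and nil_smooth_diff [simp]: "f \<in> nil_smooth \<Longrightarrow> g \<in> nil_smooth \<Longrightarrow> (\<lambda>x. f x - g x) \<in> nil_smooth"
  and nil_smooth_mult [simp]: "f \<in> nil_smooth \<Longrightarrow> g \<in> nil_smooth \<Longrightarrow> (\<lambda>x. f x * g x) \<in> nil_smooth"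
  and nil_smooth_cnj [simp]: "f \<in> nil_smooth \<Longrightarrow> (\<lambda>x. cnj (f x)) \<in> nil_smooth"
  and nil_smooth_uminus [simp]: "f \<in> nil_smooth \<Longrightarrow> (\<lambda>x. - f x) \<in> nil_smooth"
  and nil_smooth_const [simp]: "(\<lambda>x. c) \<in> nil_smooth"
  by (auto simp: nil_smooth_iff nil_invariant_def)

lemma field_linear:
  assumes "smooth f" "smooth g"
  shows field_A_add: "field_A (\<lambda>x. f x + g x) x = field_A f x + field_A g x"
    and field_B_add: "field_B (\<lambda>x. f x + g x) x = field_B f x + field_B g x"
    and field_C_add: "field_C (\<lambda>x. f x + g x) x = field_C f x + field_C g x"
    and field_A_cmult: "field_A (\<lambda>x. c * f x) x = c * field_A f x"
    and field_B_cmult: "field_B (\<lambda>x. c * f x) x = c * field_B f x"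
    and field_C_cmult: "field_C (\<lambda>x. c * f x) x = c * field_C f x"
  using assms by (simp_all add: field_A_def field_B_def field_C_def dd_add dd_cmult)

lemma field_mult_cnj:
  assumes "smooth f" "smooth g"
  shows "field_A (\<lambda>x. f x * cnj (g x)) x = field_A f x * cnj (g x) + f x * cnj (field_A g x)"
    and "field_B (\<lambda>x. f x * cnj (g x)) x = field_B f x * cnj (g x) + f x * cnj (field_B g x)"
    and "field_C (\<lambda>x. f x * cnj (g x)) x = field_C f x * cnj (g x) + f x * cnj (field_C g x)"
  using assms by (simp_all add: field_A_def field_B_def field_C_def dd_mult dd_cnj)

lemma field_fst_mult:
  assumes "smooth g"
  shows "field_C (\<lambda>x. of_real (fst x) * g x) x = of_real (fst x) * field_C g x"
    and "field_A (\<lambda>x. of_real (fst x) * g x) x = of_real (fst x) * field_A g x + g x"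
  using assms by (simp_all add: field_C_def field_A_def dd_mult dd_fst)

lemma field_CA: "smooth f \<Longrightarrow> field_C (field_A f) = field_A (field_C f)"
  unfolding field_A_def field_C_def using dd_commute by auto

lemma field_CB:
  assumes f: "smooth f" shows "field_C (field_B f) = field_B (field_C f)"
proof
  fix x
  have B: "field_B f = (\<lambda>x. dd f (0,1,0) x + of_real (fst x) * field_C f x)"
    using field_B_eq[OF f] by auto
  have "field_C (field_B f) x = dd (dd f (0,1,0)) (0,0,1) x + of_real (fst x) * field_C (field_C f) x"
    unfolding B using f by (simp add: field_C_add field_fst_mult) (simp add: field_C_def[abs_def])
  also have "\<dots> = field_B (field_C f) x"
    using f by (simp add: field_B_eq dd_commute[OF f, of "(0,1,0)"]) (simp add: field_C_def[abs_def])
  finally show "field_C (field_B f) x = field_B (field_C f) x" .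
qed

text \<open>The term \<open>field_C f\<close> arises from differentiating the coefficient a of B =
  d/db + a d/dc; everything else commutes.\<close>

lemma field_AB:
  assumes f: "smooth f" shows "field_A (field_B f) = (\<lambda>x. field_B (field_A f) x + field_C f x)"
proof
  fix x
  have B: "field_B f = (\<lambda>x. dd f (0,1,0) x + of_real (fst x) * field_C f x)"
    using field_B_eq[OF f] by auto
  have "field_A (field_B f) x = dd (dd f (0,1,0)) (1,0,0) x
      + (of_real (fst x) * field_A (field_C f) x + field_C f x)"
    unfolding B using f by (simp add: field_A_add field_fst_mult) (simp add: field_A_def[abs_def])
  also have "\<dots> = field_B (field_A f) x + field_C f x"
    using f by (simp add: field_B_eq field_CA dd_commute[OF f, of "(0,1,0)"]) (simp add: field_A_def[abs_def])
  finally show "field_A (field_B f) x = field_B (field_A f) x + field_C f x" .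
qed

lemma nil_smooth_sublap [simp]: "f \<in> nil_smooth \<Longrightarrow> sublap f \<in> nil_smooth"
  unfolding sublap_def[abs_def] by simp

lemma sublap_add: "smooth f \<Longrightarrow> smooth g \<Longrightarrow> sublap (\<lambda>x. f x + g x) x = sublap f x + sublap g x"
  and sublap_cmult: "smooth f \<Longrightarrow> sublap (\<lambda>x. c * f x) x = c * sublap f x"
proof -
  assume f: "smooth f"
  have "field_A (\<lambda>x. c * f x) = (\<lambda>x. c * field_A f x)" "field_B (\<lambda>x. c * f x) = (\<lambda>x. c * field_B f x)"
    using f by (auto simp: field_linear)
  then show "sublap (\<lambda>x. c * f x) x = c * sublap f x"
    using f by (simp add: sublap_def field_linear algebra_simps)
  assume g: "smooth g"
  have "field_A (\<lambda>x. f x + g x) = (\<lambda>x. field_A f x + field_A g x)" "field_B (\<lambda>x. f x + g x) = (\<lambda>x. field_B f x + field_B g x)"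
    using f g by (auto simp: field_linear)
  then show "sublap (\<lambda>x. f x + g x) x = sublap f x + sublap g x"
    using f g by (simp add: sublap_def field_linear algebra_simps)
qed

lemma sublap_C: "smooth f \<Longrightarrow> sublap (field_C f) = field_C (sublap f)"
proof
  fix x assume f: "smooth f"
  have *: "sublap f = (\<lambda>x. (-1) * (field_A (field_A f) x + field_B (field_B f) x))"
    by (simp add: sublap_def[abs_def])
  have "field_C (sublap f) x = (-1) * (field_C (field_A (field_A f)) x + field_C (field_B (field_B f)) x)"
    unfolding * using f by (subst field_C_cmult) (simp_all add: field_C_add)
  then show "sublap (field_C f) x = field_C (sublap f) x"
    using f by (simp add: sublap_def field_CA field_CB)
qed

section \<open>Integration over the unit cube\<close>

definition unitM :: "real measure" where "unitM = restrict_space lborel {0..<1}"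

lemma space_unitM [simp]: "space unitM = {0..<1}"
  by (simp add: unitM_def space_restrict_space)

lemma finite_measure_unitM: "finite_measure unitM"
  by (auto simp: unitM_def intro!: finite_measureI simp: emeasure_restrict_space space_restrict_space)

interpretation unitM: finite_measure unitM by (rule finite_measure_unitM)

lemma emeasure_unitM [simp]: "emeasure unitM {0..<1} = 1"
  by (simp add: unitM_def emeasure_restrict_space)

lemma sets_unitM_space [simp]: "{0..<1} \<in> sets unitM"
  using sets.top[of unitM] by simp

lemma measure_unitM [simp]: "measure unitM {0..<1} = 1"
  by (simp add: measure_def)

text \<open>\<open>nilM\<close> is a restriction of Lebesgue measure, whereas iterated integrals
  need a product. As the factors are sigma-finite, it is enough to compare the sigma-algebras and
  the measures of rectangles.\<close>

lemma restrict_space_pair: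
  assumes "sigma_finite_measure M" "sigma_finite_measure N" and A: "A \<in> sets M" and B: "B \<in> sets N"
  shows "restrict_space M A \<Otimes>\<^sub>M restrict_space N B = restrict_space (M \<Otimes>\<^sub>M N) (A \<times> B)"
proof (rule pair_measure_eqI)
  interpret N: sigma_finite_measure N by fact
  show "sigma_finite_measure (restrict_space M A)" "sigma_finite_measure (restrict_space N B)"
    using assms by (auto intro: sigma_finite_measure_restrict_space)
  have sub: "A \<subseteq> space M" "B \<subseteq> space N" using A B by (auto dest: sets.sets_into_space)
  show "sets (restrict_space M A \<Otimes>\<^sub>M restrict_space N B) = sets (restrict_space (M \<Otimes>\<^sub>M N) (A \<times> B))"
  proof
    show "sets (restrict_space M A \<Otimes>\<^sub>M restrict_space N B) \<subseteq> sets (restrict_space (M \<Otimes>\<^sub>M N) (A \<times> B))"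
      unfolding sets_pair_measure
      using sub A B
      by (intro sets.sigma_sets_subset') (auto simp: sets_restrict_space_iff space_restrict_space space_pair_measure
          intro!: sets.sigma_sets_subset' pair_measureI)
    have m: "(\<lambda>x. x) \<in> measurable (restrict_space M A \<Otimes>\<^sub>M restrict_space N B) (M \<Otimes>\<^sub>M N)"
      by (rule measurable_pair) (auto simp: comp_def intro!: measurable_compose[OF measurable_fst] measurable_compose[OF measurable_snd] measurable_restrict_space1)
    show "sets (restrict_space (M \<Otimes>\<^sub>M N) (A \<times> B)) \<subseteq> sets (restrict_space M A \<Otimes>\<^sub>M restrict_space N B)"
    proof
      fix X assume "X \<in> sets (restrict_space (M \<Otimes>\<^sub>M N) (A \<times> B))"
      then obtain Y where Y: "Y \<in> sets (M \<Otimes>\<^sub>M N)" "X = (A \<times> B) \<inter> Y"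
        by (auto simp: sets_restrict_space)
      have "Y \<inter> space (restrict_space M A \<Otimes>\<^sub>M restrict_space N B) \<in> sets (restrict_space M A \<Otimes>\<^sub>M restrict_space N B)"
        using measurable_sets[OF m Y(1)] by simp
      then show "X \<in> sets (restrict_space M A \<Otimes>\<^sub>M restrict_space N B)"
        using sub Y by (simp add: space_pair_measure space_restrict_space Int_commute Int_absorb2)
    qed
  qed
  fix X Y assume "X \<in> sets (restrict_space M A)" "Y \<in> sets (restrict_space N B)"
  then have X: "X \<in> sets M" "X \<subseteq> A" and Y: "Y \<in> sets N" "Y \<subseteq> B"
    using A B by (auto simp: sets_restrict_space_iff)
  then show "emeasure (restrict_space M A) X * emeasure (restrict_space N B) Y =
      emeasure (restrict_space (M \<Otimes>\<^sub>M N) (A \<times> B)) (X \<times> Y)"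
    using A B sub by (subst (1 2 3) emeasure_restrict_space)
      (auto simp: N.emeasure_pair_measure_Times space_pair_measure intro!: pair_measureI)
qed

lemma nilM_eq: "nilM = unitM \<Otimes>\<^sub>M (unitM \<Otimes>\<^sub>M unitM)"
proof -
  have "unitM \<Otimes>\<^sub>M unitM = restrict_space lborel ({0..<1} \<times> {0..<1})"
    unfolding unitM_def
    by (subst restrict_space_pair) (simp_all add: lborel_prod lborel.sigma_finite_measure_axioms)
  then show ?thesis
    unfolding nilM_def unitM_def
    by (simp, subst restrict_space_pair)
      (simp_all add: lborel_prod lborel.sigma_finite_measure_axioms borel_Times)
qed

interpretation U2: pair_sigma_finite unitM unitM ..

lemma finite_measure_unitM2: "finite_measure (unitM \<Otimes>\<^sub>M unitM)"
  by (rule finite_measureI) (simp add: space_pair_measure unitM.emeasure_pair_measure_Times)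

interpretation unitM2: finite_measure "unitM \<Otimes>\<^sub>M unitM" by (rule finite_measure_unitM2)

interpretation U3: pair_sigma_finite unitM "unitM \<Otimes>\<^sub>M unitM" ..

definition "cube = {0..<1::real} \<times> {0..<1::real} \<times> {0..<1::real}"

lemma space_nilM: "space nilM = cube"
  by (simp add: nilM_def space_restrict_space cube_def)

lemma emeasure_nilM: "emeasure nilM cube = 1"
  by (simp add: nilM_eq cube_def U2.P.emeasure_pair_measure_Times unitM.emeasure_pair_measure_Times)

interpretation nilM: finite_measure nilM
  by (rule finite_measureI) (simp add: space_nilM emeasure_nilM)

lemma measure_nilM [simp]: "measure nilM (space nilM) = 1"
  by (simp add: measure_def space_nilM emeasure_nilM)

lemma sets_unitM_borel: "f \<in> borel_measurable borel \<Longrightarrow> f \<in> borel_measurable unitM"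
  unfolding unitM_def by (intro measurable_restrict_space1) simp

lemma nilM_borel: "f \<in> borel_measurable borel \<Longrightarrow> f \<in> borel_measurable nilM"
  unfolding nilM_def by (intro measurable_restrict_space1) simp

lemma continuous_nilM_measurable:
  fixes g :: "heis \<Rightarrow> 'a::topological_space"
  shows "continuous_on UNIV g \<Longrightarrow> g \<in> borel_measurable nilM"
  by (intro nilM_borel borel_measurable_continuous_onI)

lemma nn_integral_nilM:
  "F \<in> borel_measurable nilM \<Longrightarrow>
    (\<integral>\<^sup>+x. F x \<partial>nilM) = (\<integral>\<^sup>+a. \<integral>\<^sup>+b. \<integral>\<^sup>+c. F (a, b, c) \<partial>unitM \<partial>unitM \<partial>unitM)"
  unfolding nilM_eq
  by (subst U2.P.nn_integral_fst[symmetric], assumption, intro nn_integral_cong, subst unitM.nn_integral_fst[symmetric])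
     (auto simp: comp_def)

lemma compact_cube: "compact (cbox 0 1 \<times> cbox 0 1 \<times> cbox 0 (1::real) :: heis set)"
  by (intro compact_Times compact_cbox)

lemma cube_bounded:
  fixes g :: "heis \<Rightarrow> 'a::real_normed_vector"
  assumes "continuous_on UNIV g"
  obtains B where "0 \<le> B" "\<And>x. x \<in> cube \<Longrightarrow> norm (g x) \<le> B"
proof -
  have "compact (g ` (cbox 0 1 \<times> cbox 0 1 \<times> cbox 0 1))"
    using assms compact_cube by (intro compact_continuous_image) (auto intro: continuous_on_subset)
  then obtain B where B: "\<forall>y\<in>g ` (cbox 0 1 \<times> cbox 0 1 \<times> cbox 0 1). norm y \<le> B"
    using compact_imp_bounded bounded_iff by metis
  show ?thesis
  proof (rule that[of "max 0 B"])
    fix x assume "x \<in> cube"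
    then have "norm (g x) \<le> B" using B by (intro bspec[OF B] imageI) (auto simp: cube_def)
    then show "norm (g x) \<le> max 0 B" by simp
  qed simp
qed

lemma continuous_nilM_integrable:
  fixes g :: "heis \<Rightarrow> 'a::{banach, second_countable_topology}"
  assumes "continuous_on UNIV g"
  shows "integrable nilM g"
proof -
  obtain B where "\<And>x. x \<in> cube \<Longrightarrow> norm (g x) \<le> B" using cube_bounded[OF assms] by metis
  then show ?thesis
    by (intro nilM.integrable_const_bound[where B=B] continuous_nilM_measurable assms AE_I2)
       (simp add: space_nilM)
qed

text \<open>Each order puts innermost the variable in which the fundamental theorem of calculus will
  be used: c for \<open>field_C\<close>, b for the constant-coefficient part of
  \<open>field_B\<close>, a for \<open>field_A\<close>.\<close>

lemma integral_nilM:
  fixes g :: "heis \<Rightarrow> 'a::{banach, second_countable_topology}"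
  assumes g: "continuous_on UNIV g"
  shows integral_nilM_abc: "(LINT x|nilM. g x) = (LINT a|unitM. LINT b|unitM. LINT c|unitM. g (a, b, c))"
    and integral_nilM_acb: "(LINT x|nilM. g x) = (LINT a|unitM. LINT c|unitM. LINT b|unitM. g (a, b, c))"
    and integral_nilM_bca: "(LINT x|nilM. g x) = (LINT b|unitM. LINT c|unitM. LINT a|unitM. g (a, b, c))"
proof -
  have int: "integrable (unitM \<Otimes>\<^sub>M unitM \<Otimes>\<^sub>M unitM) g"
    using continuous_nilM_integrable[OF g] by (simp add: nilM_eq)
  obtain B where B: "\<And>x. x \<in> cube \<Longrightarrow> norm (g x) \<le> B" using cube_bounded[OF g] by metis
  have int2: "integrable (unitM \<Otimes>\<^sub>M unitM) (\<lambda>p. g (a, p))" if "a \<in> {0..<1}" for a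
    using that
    by (intro unitM2.integrable_const_bound[where B=B] AE_I2)
       (auto simp: space_pair_measure cube_def B intro!: measurable_compose[OF _ borel_measurable_integrable[OF int]] measurable_Pair)
  have abc: "(LINT x|nilM. g x) = (LINT a|unitM. LINT p|(unitM \<Otimes>\<^sub>M unitM). g (a, p))"
    using U3.integral_fst'[OF int] by (simp add: nilM_eq)
  also have "\<dots> = (LINT a|unitM. LINT b|unitM. LINT c|unitM. g (a, b, c))"
    using U2.integral_fst'[OF int2] by (intro Bochner_Integration.integral_cong) auto
  finally show abc: "(LINT x|nilM. g x) = (LINT a|unitM. LINT b|unitM. LINT c|unitM. g (a, b, c))" .
  also have "\<dots> = (LINT a|unitM. LINT c|unitM. LINT b|unitM. g (a, b, c))"
  proof (rule Bochner_Integration.integral_cong[OF refl])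
    fix a assume "a \<in> space unitM"
    then show "(LINT b|unitM. LINT c|unitM. g (a, b, c)) = (LINT c|unitM. LINT b|unitM. g (a, b, c))"
      using int2 by (intro U2.Fubini_integral[symmetric]) (simp add: split_beta')
  qed
  finally show "(LINT x|nilM. g x) = (LINT a|unitM. LINT c|unitM. LINT b|unitM. g (a, b, c))" .
  have "(LINT x|nilM. g x) = (LINT p|(unitM \<Otimes>\<^sub>M unitM). LINT a|unitM. g (a, p))"
    using U3.integral_snd[of "\<lambda>a p. g (a, p)"] int by (simp add: nilM_eq split_beta')
  also have "\<dots> = (LINT b|unitM. LINT c|unitM. LINT a|unitM. g (a, b, c))"
  proof -
    have "integrable (unitM \<Otimes>\<^sub>M unitM) (\<lambda>p. LINT a|unitM. g (a, p))"
      using U3.integrable_snd[of "\<lambda>a p. g (a, p)"] int by (simp add: split_beta')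
    from U2.integral_fst'[OF this] show ?thesis by simp
  qed
  finally show "(LINT x|nilM. g x) = (LINT b|unitM. LINT c|unitM. LINT a|unitM. g (a, b, c))" .
qed

section \<open>Calculus in one variable on the unit interval\<close>

lemma unitM_integral:
  fixes g :: "real \<Rightarrow> 'a::euclidean_space"
  assumes g: "continuous_on {0..1} g"
  shows unitM_integrable: "integrable unitM g"
    and unitM_integral_eq: "(LINT x|unitM. g x) = integral {0..1} g"
proof -
  have i: "set_integrable lborel {0..1} g"
    using borel_integrable_atLeastAtMost'[OF g] .
  then have i2: "set_integrable lborel {0..<1} g"
    by (rule set_integrable_subset) auto
  then show "integrable unitM g"
    by (simp add: unitM_def integrable_restrict_space set_integrable_def)
  have "(LINT x|unitM. g x) = (LINT x:{0..<1}|lborel. g x)"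
    by (simp add: unitM_def integral_restrict_space set_lebesgue_integral_def)
  also have "\<dots> = (LINT x:{0..1}|lborel. g x)"
    unfolding set_lebesgue_integral_def
    using i i2 AE_lborel_singleton[of "1::real"]
    by (intro integral_cong_AE)
       (auto simp: set_integrable_def indicator_def elim!: eventually_mono)
  also have "\<dots> = integral {0..1} g"
    using set_borel_integral_eq_integral(2)[OF i] .
  finally show "(LINT x|unitM. g x) = integral {0..1} g" .
qed

lemma unitM_FTC:
  fixes g :: "real \<Rightarrow> 'a::euclidean_space"
  assumes "\<And>x. x \<in> {0..1} \<Longrightarrow> (g has_vector_derivative g' x) (at x within {0..1})" "continuous_on {0..1} g'"
  shows "(LINT x|unitM. g' x) = g 1 - g 0"
  using unitM_integral_eq[OF assms(2)] fundamental_theorem_of_calculus[OF _ assms(1)]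
  by (simp add: integral_unique)

text \<open>With an antiderivative H the shifted integral is H (s + 1) - H s, whose derivative in s
  vanishes by periodicity.\<close>

lemma unitM_periodic_shift:
  fixes h :: "real \<Rightarrow> 'a::euclidean_space"
  assumes h: "continuous_on UNIV h" and per: "\<And>x. h (x + 1) = h x"
  shows "(LINT x|unitM. h (x + s)) = (LINT x|unitM. h x)"
proof -
  have hc: "continuous_on S h" for S using h continuous_on_subset by blast
  \<comment> \<open>A range containing r, r + 1 and x + r for all r between -|s| and |s| and x in
    [0, 1], so that one antiderivative serves throughout.\<close>
  let ?l = "- \<bar>s\<bar> - 1" and ?u = "\<bar>s\<bar> + 2"
  obtain H where H: "\<And>x. x \<in> {?l..?u} \<Longrightarrow> (H has_vector_derivative h x) (at x within {?l..?u})"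
    using antiderivative_continuous[OF hc[of "{?l..?u}"]] by metis
  have int: "(LINT x|unitM. h (x + r)) = H (r + 1) - H r" if "\<bar>r\<bar> \<le> \<bar>s\<bar>" for r
  proof -
    have "(LINT x|unitM. h (x + r)) = H (1 + r) - H (0 + r)"
    proof (rule unitM_FTC[where g="\<lambda>x. H (x + r)"])
      fix x :: real assume x: "x \<in> {0..1}"
      have "((H \<circ> (\<lambda>x. x + r)) has_vector_derivative (1 *\<^sub>R h (x + r))) (at x within {0..1})"
      proof (rule vector_diff_chain_within)
        show "((\<lambda>x. x + r) has_vector_derivative 1) (at x within {0..1})"
          by (auto intro!: derivative_eq_intros simp: has_vector_derivative_def)
        have "(\<lambda>x. x + r) ` {0..1} \<subseteq> {?l..?u}" using that by auto
        moreover have "x + r \<in> {?l..?u}" using that x by auto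
        ultimately show "(H has_vector_derivative h (x + r)) (at (x + r) within (\<lambda>x. x + r) ` {0..1})"
          using H has_vector_derivative_within_subset by blast
      qed
      then show "((\<lambda>x. H (x + r)) has_vector_derivative h (x + r)) (at x within {0..1})"
        by (simp add: comp_def)
    qed (auto intro!: continuous_on_compose2[OF h] continuous_intros)
    then show ?thesis by (simp add: add.commute)
  qed
  have "(LINT x|unitM. h (x + s)) - (LINT x|unitM. h x) = 0"
  proof -
    define K where "K = (\<lambda>r. H (r + 1) - H r)"
    have K: "(K has_vector_derivative 0) (at r within {-\<bar>s\<bar>..\<bar>s\<bar>})" if r: "r \<in> {-\<bar>s\<bar>..\<bar>s\<bar>}" for r
    proof -
      have "((H \<circ> (\<lambda>x. x + 1)) has_vector_derivative (1 *\<^sub>R h (r + 1))) (at r within {-\<bar>s\<bar>..\<bar>s\<bar>})"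
      proof (rule vector_diff_chain_within)
        show "((\<lambda>x. x + 1) has_vector_derivative 1) (at r within {-\<bar>s\<bar>..\<bar>s\<bar>})"
          by (auto intro!: derivative_eq_intros simp: has_vector_derivative_def)
        have "(\<lambda>x. x + 1) ` {-\<bar>s\<bar>..\<bar>s\<bar>} \<subseteq> {?l..?u}" by auto
        moreover have "r + 1 \<in> {?l..?u}" using r by auto
        ultimately show "(H has_vector_derivative h (r + 1)) (at (r + 1) within (\<lambda>x. x + 1) ` {-\<bar>s\<bar>..\<bar>s\<bar>})"
          using H has_vector_derivative_within_subset by blast
      qed
      moreover have "(H has_vector_derivative h r) (at r within {-\<bar>s\<bar>..\<bar>s\<bar>})"
        using r by (intro has_vector_derivative_within_subset[OF H]) auto
      ultimately have "(K has_vector_derivative (h (r + 1) - h r)) (at r within {-\<bar>s\<bar>..\<bar>s\<bar>})"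
        unfolding K_def by (intro has_vector_derivative_diff) (simp_all add: comp_def)
      then show ?thesis by (simp add: per)
    qed
    obtain k where k: "\<And>r. r \<in> {-\<bar>s\<bar>..\<bar>s\<bar>} \<Longrightarrow> K r = k"
      using has_vector_derivative_zero_constant[OF _ K] by (metis convex_real_interval(5))
    have "K s = K 0" using k[of s] k[of 0] abs_ge_self[of s] abs_ge_minus_self[of s] by simp
    then show ?thesis using int[of s] int[of 0] by (simp add: K_def)
  qed
  then show ?thesis by simp
qed

lemma norm_diff_le_unitM:
  fixes g :: "real \<Rightarrow> 'a::euclidean_space"
  assumes d: "\<And>x. x \<in> {0..1} \<Longrightarrow> (g has_vector_derivative g' x) (at x within {0..1})"
    and g': "continuous_on {0..1} g'" and "x \<in> {0..1}" "y \<in> {0..1}"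
  shows "norm (g x - g y) \<le> (LINT z|unitM. norm (g' z))"
proof -
  have *: "norm (g v - g u) \<le> integral {0..1} (\<lambda>z. norm (g' z))" if "0 \<le> u" "u \<le> v" "v \<le> 1" for u v
  proof -
    have sub: "{u..v} \<subseteq> {0..1}" using that by auto
    have "(g' has_integral g v - g u) {u..v}"
      using that by (intro fundamental_theorem_of_calculus has_vector_derivative_within_subset[OF d sub]) auto
    then have "norm (g v - g u) = norm (integral {u..v} g')" by (simp add: integral_unique)
    also have "\<dots> \<le> integral {u..v} (\<lambda>z. norm (g' z))"
      using continuous_on_subset[OF g' sub]
      by (intro integral_norm_bound_integral integrable_continuous_interval continuous_intros) auto
    also have "\<dots> \<le> integral {0..1} (\<lambda>z. norm (g' z))"
      using continuous_on_subset[OF g' sub] g' sub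
      by (intro integral_subset_le integrable_continuous_interval continuous_intros) auto
    finally show ?thesis .
  qed
  have "(LINT z|unitM. norm (g' z)) = integral {0..1} (\<lambda>z. norm (g' z))"
    by (intro unitM_integral_eq continuous_intros g')
  then show ?thesis
    using *[of x y] *[of y x] assms(3,4) by (cases "x \<le> y") (auto simp: norm_minus_commute)
qed

text \<open>Nonnegativity of the variance; \<open>unitM\<close> has total mass 1.\<close>

lemma unitM_Jensen:
  fixes h :: "real \<Rightarrow> real"
  assumes "continuous_on {0..1} h"
  shows "(LINT x|unitM. h x)\<^sup>2 \<le> (LINT x|unitM. (h x)\<^sup>2)"
proof -
  define m where "m = (LINT x|unitM. h x)"
  have i: "integrable unitM h" "integrable unitM (\<lambda>x. (h x)\<^sup>2)"
    using assms by (auto intro!: unitM_integrable continuous_intros)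
  have "0 \<le> (LINT x|unitM. (h x - m)\<^sup>2)" by simp
  also have "\<dots> = (LINT x|unitM. (h x)\<^sup>2 - 2 * m * h x + m\<^sup>2)"
    by (simp add: power2_eq_square algebra_simps)
  also have "\<dots> = (LINT x|unitM. (h x)\<^sup>2) - 2 * m * m + m\<^sup>2"
    using i by (simp add: m_def)
  finally show ?thesis by (simp add: m_def power2_eq_square)
qed

section \<open>Square-integrable functions\<close>

text \<open>Refers to the values on the cube only, so that it also covers functions that are not
  invariant, such as \<open>dd f (0, 1, 0)\<close> or \<open>field_C f\<close> multiplied by the
  coordinate a.\<close>

definition sqint :: "(heis \<Rightarrow> complex) \<Rightarrow> bool" where
  "sqint f \<longleftrightarrow> f \<in> borel_measurable nilM \<and> integrable nilM (\<lambda>x. (cmod (f x))\<^sup>2)"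

definition l2 :: "(heis \<Rightarrow> complex) \<Rightarrow> real" where
  "l2 f = sqrt (LINT x|nilM. (cmod (f x))\<^sup>2)"

lemma l2_nonneg [simp]: "0 \<le> l2 f"
  by (simp add: l2_def)

lemma l2_square: "(l2 f)\<^sup>2 = (LINT x|nilM. (cmod (f x))\<^sup>2)"
  by (simp add: l2_def)

lemma sqint_measurable: "sqint f \<Longrightarrow> f \<in> borel_measurable nilM"
  by (simp add: sqint_def)

lemma sqint_continuous: "continuous_on UNIV f \<Longrightarrow> sqint f"
  unfolding sqint_def
  by (intro conjI continuous_nilM_measurable continuous_nilM_integrable continuous_intros)

lemma sqint_nil_smooth [simp]: "f \<in> nil_smooth \<Longrightarrow> sqint f"
  by (intro sqint_continuous smooth_continuous nil_smooth_smooth)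

lemma sqint_add [intro]:
  assumes "sqint f" "sqint g" shows "sqint (\<lambda>x. f x + g x)"
proof -
  have [measurable]: "f \<in> borel_measurable nilM" "g \<in> borel_measurable nilM"
    using assms sqint_measurable by auto
  have "integrable nilM (\<lambda>x. (cmod (f x + g x))\<^sup>2)"
  proof (rule Bochner_Integration.integrable_bound)
    show "integrable nilM (\<lambda>x. 2 * (cmod (f x))\<^sup>2 + 2 * (cmod (g x))\<^sup>2)"
      using assms by (simp add: sqint_def)
    have "(cmod (f x + g x))\<^sup>2 \<le> 2 * (cmod (f x))\<^sup>2 + 2 * (cmod (g x))\<^sup>2" for x
    proof -
      have "(cmod (f x + g x))\<^sup>2 \<le> (cmod (f x) + cmod (g x))\<^sup>2"
        by (intro power_mono norm_triangle_ineq) simp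
      also have "\<dots> \<le> 2 * (cmod (f x))\<^sup>2 + 2 * (cmod (g x))\<^sup>2"
        using sum_squares_bound[of "cmod (f x)" "cmod (g x)"] by (simp add: power2_sum)
      finally show ?thesis .
    qed
    then show "AE x in nilM. norm ((cmod (f x + g x))\<^sup>2) \<le> norm (2 * (cmod (f x))\<^sup>2 + 2 * (cmod (g x))\<^sup>2)"
      by (simp add: abs_of_nonneg)
  qed measurable
  then show ?thesis by (simp add: sqint_def)
qed

lemma sqint_cmult [intro]: "sqint f \<Longrightarrow> sqint (\<lambda>x. c * f x)"
  by (auto simp: sqint_def norm_mult power_mult_distrib)

lemma sqint_diff [intro]: "sqint f \<Longrightarrow> sqint g \<Longrightarrow> sqint (\<lambda>x. f x - g x)"
  using sqint_add[of f "\<lambda>x. (-1) * g x"] sqint_cmult[of g "-1"] by simp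

lemma sqint_sum [intro]: "(\<And>i. i \<in> I \<Longrightarrow> sqint (f i)) \<Longrightarrow> sqint (\<lambda>x. \<Sum>i\<in>I. f i x)"
proof (induction I rule: infinite_finite_induct)
  case (insert i I)
  then show ?case using sqint_add by simp
qed (auto intro: sqint_continuous)

lemma measurable_cnj [measurable (raw)]:
  assumes "h \<in> borel_measurable M"
  shows "(\<lambda>x. cnj (h x)) \<in> borel_measurable M"
  using assms by (rule measurable_compose) (intro borel_measurable_continuous_onI continuous_intros)

lemma sqint_mult_cnj:
  assumes "sqint f" "sqint g"
  shows "integrable nilM (\<lambda>x. f x * cnj (g x))"
proof (rule Bochner_Integration.integrable_bound)
  show "integrable nilM (\<lambda>x. (cmod (f x))\<^sup>2 + (cmod (g x))\<^sup>2)"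
    using assms by (simp add: sqint_def)
  have [measurable]: "f \<in> borel_measurable nilM" "g \<in> borel_measurable nilM"
    using assms sqint_measurable by auto
  show "(\<lambda>x. f x * cnj (g x)) \<in> borel_measurable nilM" by measurable
  have "cmod (f x) * cmod (g x) \<le> (cmod (f x))\<^sup>2 + (cmod (g x))\<^sup>2" for x
  proof -
    have "0 \<le> cmod (f x) * cmod (g x)" by simp
    then show ?thesis using sum_squares_bound[of "cmod (f x)" "cmod (g x)"] by linarith
  qed
  then show "AE x in nilM. norm (f x * cnj (g x)) \<le> norm ((cmod (f x))\<^sup>2 + (cmod (g x))\<^sup>2)"
    by (simp add: norm_mult abs_of_nonneg)
qed

lemma sqint_integrable: "sqint f \<Longrightarrow> integrable nilM f"
  using sqint_mult_cnj[of f "\<lambda>x. 1"] sqint_continuous[of "\<lambda>x. 1"] by simp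

lemma sqint_integrable_norm_mult:
  assumes "sqint f" "sqint g"
  shows "integrable nilM (\<lambda>x. cmod (f x) * cmod (g x))"
  using integrable_norm[OF sqint_mult_cnj[OF assms]] by (simp add: norm_mult)

lemma Cauchy_Schwarz_norm:
  assumes "sqint f" "sqint g"
  shows "(LINT x|nilM. cmod (f x) * cmod (g x)) \<le> l2 f * l2 g"
proof -
  have [measurable]: "f \<in> borel_measurable nilM" "g \<in> borel_measurable nilM"
    using assms sqint_measurable by auto
  have "(\<integral>\<^sup>+x. ennreal (cmod (f x)) * ennreal (cmod (g x)) \<partial>nilM)\<^sup>2
      \<le> (\<integral>\<^sup>+x. ennreal (cmod (f x)) ^ 2 \<partial>nilM) * (\<integral>\<^sup>+x. ennreal (cmod (g x)) ^ 2 \<partial>nilM)"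
    by (rule Cauchy_Schwarz_nn_integral) measurable
  moreover have "(\<integral>\<^sup>+x. ennreal (cmod (h x)) ^ 2 \<partial>nilM) = ennreal ((l2 h)\<^sup>2)" if "sqint h" for h
    using that unfolding l2_square sqint_def by (simp add: ennreal_power nn_integral_eq_integral)
  moreover have "(\<integral>\<^sup>+x. ennreal (cmod (f x)) * ennreal (cmod (g x)) \<partial>nilM) = ennreal (LINT x|nilM. cmod (f x) * cmod (g x))"
    using sqint_integrable_norm_mult[OF assms] by (simp add: ennreal_mult[symmetric] nn_integral_eq_integral)
  ultimately have "ennreal ((LINT x|nilM. cmod (f x) * cmod (g x))\<^sup>2) \<le> ennreal ((l2 f)\<^sup>2 * (l2 g)\<^sup>2)"
    using assms by (simp add: ennreal_power ennreal_mult)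
  then have "(LINT x|nilM. cmod (f x) * cmod (g x))\<^sup>2 \<le> (l2 f * l2 g)\<^sup>2"
    by (simp add: power_mult_distrib)
  then show ?thesis by (rule power2_le_imp_le) simp
qed

lemma nil_inner_le:
  assumes "sqint f" "sqint g"
  shows "cmod (nil_inner f g) \<le> l2 f * l2 g"
proof -
  have "cmod (nil_inner f g) \<le> (LINT x|nilM. cmod (f x * cnj (g x)))"
    unfolding nil_inner_def by (rule integral_norm_bound)
  also have "\<dots> = (LINT x|nilM. cmod (f x) * cmod (g x))" by (simp add: norm_mult)
  finally show ?thesis using Cauchy_Schwarz_norm[OF assms] by simp
qed

lemma nil_inner_self: "nil_inner f f = of_real ((l2 f)\<^sup>2)"
  unfolding nil_inner_def l2_square integral_complex_of_real[symmetric]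
  by (simp add: complex_norm_square[symmetric])

lemma nil_inner_add_left:
  "sqint f \<Longrightarrow> sqint g \<Longrightarrow> sqint h \<Longrightarrow> nil_inner (\<lambda>x. f x + g x) h = nil_inner f h + nil_inner g h"
  using Bochner_Integration.integral_add[OF sqint_mult_cnj sqint_mult_cnj]
  by (simp add: nil_inner_def distrib_right)

lemma nil_inner_diff_left:
  "sqint f \<Longrightarrow> sqint g \<Longrightarrow> sqint h \<Longrightarrow> nil_inner (\<lambda>x. f x - g x) h = nil_inner f h - nil_inner g h"
  using Bochner_Integration.integral_diff[OF sqint_mult_cnj sqint_mult_cnj]
  by (simp add: nil_inner_def left_diff_distrib)

lemma nil_inner_cmult_left: "nil_inner (\<lambda>x. c * f x) h = c * nil_inner f h"
  by (simp add: nil_inner_def mult.assoc)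

lemma nil_inner_cnj: "cnj (nil_inner f g) = nil_inner g f"
  unfolding nil_inner_def by (subst Bochner_Integration.integral_cnj[symmetric]) (simp add: mult.commute)

lemma nil_inner_cong_AE:
  assumes "AE x in nilM. f x = f' x" "AE x in nilM. g x = g' x"
    "f \<in> borel_measurable nilM" "f' \<in> borel_measurable nilM"
    "g \<in> borel_measurable nilM" "g' \<in> borel_measurable nilM"
  shows "nil_inner f g = nil_inner f' g'"
proof -
  show ?thesis
    unfolding nil_inner_def
    using assms(1,2) by (intro integral_cong_AE borel_measurable_times assms measurable_cnj) auto
qed

lemma l2_triangle:
  assumes "sqint f" "sqint g"
  shows "l2 (\<lambda>x. f x + g x) \<le> l2 f + l2 g"
proof (rule power2_le_imp_le)
  have "(l2 (\<lambda>x. f x + g x))\<^sup>2 \<le> (LINT x|nilM. (cmod (f x))\<^sup>2 + 2 * (cmod (f x) * cmod (g x)) + (cmod (g x))\<^sup>2)"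
    unfolding l2_square
  proof (rule integral_mono)
    show "(cmod (f x + g x))\<^sup>2 \<le> (cmod (f x))\<^sup>2 + 2 * (cmod (f x) * cmod (g x)) + (cmod (g x))\<^sup>2" for x
      using power_mono[OF norm_triangle_ineq[of "f x" "g x"], of 2] by (simp add: power2_sum)
  qed (use assms sqint_add[OF assms] sqint_integrable_norm_mult[OF assms] in \<open>auto simp: sqint_def\<close>)
  also have "\<dots> = (l2 f)\<^sup>2 + 2 * (LINT x|nilM. cmod (f x) * cmod (g x)) + (l2 g)\<^sup>2"
    using assms sqint_integrable_norm_mult[OF assms] by (simp add: sqint_def l2_square)
  also have "\<dots> \<le> (l2 f + l2 g)\<^sup>2"
    using Cauchy_Schwarz_norm[OF assms] by (simp add: power2_sum)
  finally show "(l2 (\<lambda>x. f x + g x))\<^sup>2 \<le> (l2 f + l2 g)\<^sup>2" .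
qed simp

lemma l2_cmult: "l2 (\<lambda>x. c * f x) = cmod c * l2 f"
  by (simp add: l2_def norm_mult power_mult_distrib real_sqrt_mult)

lemma l2_diff_commute: "l2 (\<lambda>x. f x - g x) = l2 (\<lambda>x. g x - f x)"
  by (simp add: l2_def norm_minus_commute)

lemma l2_triangle_diff:
  assumes "sqint f" "sqint g" "sqint h"
  shows "l2 (\<lambda>x. f x - h x) \<le> l2 (\<lambda>x. f x - g x) + l2 (\<lambda>x. g x - h x)"
  using l2_triangle[of "\<lambda>x. f x - g x" "\<lambda>x. g x - h x"] assms by (simp add: sqint_diff)

lemma l2_reverse_triangle:
  assumes "sqint f" "sqint g"
  shows "\<bar>l2 f - l2 g\<bar> \<le> l2 (\<lambda>x. f x - g x)"
  using l2_triangle[of "\<lambda>x. f x - g x" g] l2_triangle[of "\<lambda>x. g x - f x" f] assms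
  by (simp add: sqint_diff l2_diff_commute[of g f] abs_le_iff)

lemma l2_zero_iff: "sqint f \<Longrightarrow> l2 f = 0 \<longleftrightarrow> (AE x in nilM. f x = 0)"
  unfolding l2_def sqint_def by (simp add: integral_nonneg_eq_0_iff_AE)

lemma l2_le_bound:
  assumes "sqint f" "\<And>x. x \<in> cube \<Longrightarrow> cmod (f x) \<le> B" "0 \<le> B"
  shows "l2 f \<le> B"
proof (rule power2_le_imp_le)
  have "(LINT x|nilM. (cmod (f x))\<^sup>2) \<le> (LINT x|nilM. B\<^sup>2)"
    using assms by (intro integral_mono) (auto simp: sqint_def space_nilM intro!: power_mono)
  then show "(l2 f)\<^sup>2 \<le> B\<^sup>2" by (simp add: l2_square)
qed fact

section \<open>Integration by parts and energy identities\<close>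

text \<open>Translation by the generator in the direction a shears c by b. This twist is why
  periodicity in c has to enter the integrals over a.\<close>

lemma nil_smooth_unit_shift:
  assumes "f \<in> nil_smooth"
  shows "f (a, b, c + 1) = f (a, b, c)" "f (a, b + 1, c) = f (a, b, c)" "f (a + 1, b, c + b) = f (a, b, c)"
proof -
  have f: "f (heis_mult \<gamma> x) = f x" if "\<gamma> \<in> heis_lattice" for \<gamma> x
    using assms that by (auto simp: nil_smooth_iff nil_invariant_def)
  show "f (a, b, c + 1) = f (a, b, c)" "f (a, b + 1, c) = f (a, b, c)" "f (a + 1, b, c + b) = f (a, b, c)"
    using f[of "(0,0,1)" "(a,b,c)"] f[of "(0,1,0)" "(a,b,c)"] f[of "(1,0,0)" "(a,b,c)"]
    by (simp_all add: heis_lattice_def add.commute)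
qed

text \<open>The last part follows an integral curve of B: at fixed a it is a straight line with
  direction (0, 1, a), along which \<open>field_B\<close> is an ordinary derivative.\<close>

lemma smooth_partial:
  assumes "smooth f"
  shows smooth_partial_a: "((\<lambda>a. f (a, b, c)) has_vector_derivative field_A f (a, b, c)) (at a within S)"
    and smooth_partial_b: "((\<lambda>b. f (a, b, c)) has_vector_derivative dd f (0, 1, 0) (a, b, c)) (at b within S)"
    and smooth_partial_c: "((\<lambda>c. f (a, b, c)) has_vector_derivative field_C f (a, b, c)) (at c within S)"
    and smooth_line_B: "((\<lambda>b. f (a, b, c + a * b)) has_vector_derivative field_B f (a, b, c + a * b)) (at b within S)"
  using smooth_line_derivative[OF assms, of "(0, b, c)" "(1, 0, 0)" a S]
    smooth_line_derivative[OF assms, of "(a, 0, c)" "(0, 1, 0)" b S]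
    smooth_line_derivative[OF assms, of "(a, b, 0)" "(0, 0, 1)" c S]
    smooth_line_derivative[OF assms, of "(a, 0, c)" "(0, 1, a)" b S]
  by (simp_all add: field_A_def field_B_def field_C_def mult.commute)

text \<open>C and d/db integrate to zero by periodicity in c and in b. For A the boundary values at
  a = 1 and a = 0 differ by the shear from c to c - b, and their integrals over c agree because f is
  periodic in c.\<close>

lemma integral_field_zero:
  assumes f: "f \<in> nil_smooth"
  shows integral_A_zero: "(LINT x|nilM. field_A f x) = 0"
    and integral_B_zero: "(LINT x|nilM. field_B f x) = 0"
    and integral_C_zero: "(LINT x|nilM. field_C f x) = 0"
proof -
  have s: "smooth f" using f by simp
  note shift = nil_smooth_unit_shift[OF f]
  have C0: "(LINT c|unitM. field_C f (a, b, c)) = 0" for a b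
    using unitM_FTC[where g="\<lambda>c. f (a, b, c)" and g'="\<lambda>c. field_C f (a, b, c)"] shift(1)[of a b 0] s
    by (simp add: smooth_partial)
  show "(LINT x|nilM. field_C f x) = 0"
    using s by (simp add: integral_nilM_abc smooth_continuous C0)
  have b0: "(LINT b|unitM. dd f (0,1,0) (a, b, c)) = 0" for a c
    using unitM_FTC[where g="\<lambda>b. f (a, b, c)" and g'="\<lambda>b. dd f (0,1,0) (a, b, c)"] shift(2)[of a 0 c] s
      smooth_section_continuous(2)[OF smooth_dd[OF s]]
    by (simp add: smooth_partial)
  have "(LINT x|nilM. field_B f x) = (LINT x|nilM. dd f (0,1,0) x) + (LINT x|nilM. of_real (fst x) * field_C f x)"
    using s by (simp add: field_B_eq continuous_nilM_integrable smooth_continuous)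
  also have "\<dots> = 0"
  proof -
    have "(LINT x|nilM. dd f (0,1,0) x) = 0"
      using s by (subst integral_nilM_acb) (simp_all add: smooth_continuous b0)
    moreover have "(LINT x|nilM. of_real (fst x) * field_C f x) = 0"
      using s by (subst integral_nilM_abc) (simp_all add: smooth_continuous C0)
    ultimately show ?thesis by simp
  qed
  finally show "(LINT x|nilM. field_B f x) = 0" .
  have A: "(LINT a|unitM. field_A f (a, b, c)) = f (0, b, c - b) - f (0, b, c)" for b c
  proof -
    have "(LINT a|unitM. field_A f (a, b, c)) = f (1, b, c) - f (0, b, c)"
      using s by (intro unitM_FTC[where g="\<lambda>a. f (a, b, c)"]) (simp_all add: smooth_partial)
    then show ?thesis using shift(3)[of 0 b "c - b"] by simp
  qed
  have "(LINT c|unitM. f (0, b, c - b) - f (0, b, c)) = 0" for b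
  proof -
    have "(LINT c|unitM. f (0, b, c + (-b))) = (LINT c|unitM. f (0, b, c))"
      using s by (intro unitM_periodic_shift shift) simp
    moreover have "integrable unitM (\<lambda>c. f (0, b, c - b))" "integrable unitM (\<lambda>c. f (0, b, c))"
      using s by (auto intro!: unitM_integrable)
    ultimately show ?thesis by simp
  qed
  then show "(LINT x|nilM. field_A f x) = 0"
    using s by (simp add: integral_nilM_bca smooth_continuous A)
qed

lemma integration_by_parts:
  assumes f: "f \<in> nil_smooth" and g: "g \<in> nil_smooth"
  shows inner_A: "nil_inner (field_A f) g = - nil_inner f (field_A g)"
    and inner_B: "nil_inner (field_B f) g = - nil_inner f (field_B g)"
    and inner_C: "nil_inner (field_C f) g = - nil_inner f (field_C g)"
proof -
  have p: "(\<lambda>x. f x * cnj (g x)) \<in> nil_smooth" using f g by simp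
  have "nil_inner (D f) g + nil_inner f (D g) = 0"
    if "(LINT x|nilM. D (\<lambda>x. f x * cnj (g x)) x) = 0" "D f \<in> nil_smooth" "D g \<in> nil_smooth"
      "\<And>x. D (\<lambda>x. f x * cnj (g x)) x = D f x * cnj (g x) + f x * cnj (D g x)" for D
    using that f g sqint_mult_cnj[of "D f" g] sqint_mult_cnj[of f "D g"] by (simp add: nil_inner_def)
  then have *: "nil_inner (field_A f) g + nil_inner f (field_A g) = 0"
    "nil_inner (field_B f) g + nil_inner f (field_B g) = 0"
    "nil_inner (field_C f) g + nil_inner f (field_C g) = 0"
    using integral_field_zero[OF p] f g by (simp_all add: field_mult_cnj)
  show "nil_inner (field_A f) g = - nil_inner f (field_A g)"
    "nil_inner (field_B f) g = - nil_inner f (field_B g)"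
    "nil_inner (field_C f) g = - nil_inner f (field_C g)"
    using * by (simp_all add: eq_neg_iff_add_eq_0)
qed

lemma inner_sublap:
  assumes f: "f \<in> nil_smooth" and g: "g \<in> nil_smooth"
  shows "nil_inner (sublap f) g = nil_inner (field_A f) (field_A g) + nil_inner (field_B f) (field_B g)"
proof -
  have "sublap f = (\<lambda>x. (-1) * (field_A (field_A f) x + field_B (field_B f) x))"
    by (simp add: sublap_def[abs_def])
  then have "nil_inner (sublap f) g = - (nil_inner (field_A (field_A f)) g + nil_inner (field_B (field_B f)) g)"
    using f g by (simp only: nil_inner_cmult_left) (simp add: nil_inner_add_left)
  then show ?thesis using f g by (simp add: inner_A inner_B)
qed

lemma energy:
  assumes f: "f \<in> nil_smooth"
  shows "(l2 (field_A f))\<^sup>2 + (l2 (field_B f))\<^sup>2 \<le> l2 (sublap f) * l2 f"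
proof -
  have "of_real ((l2 (field_A f))\<^sup>2 + (l2 (field_B f))\<^sup>2) = nil_inner (sublap f) f"
    using inner_sublap[OF f f] by (simp add: nil_inner_self)
  then have "cmod (of_real ((l2 (field_A f))\<^sup>2 + (l2 (field_B f))\<^sup>2)) = cmod (nil_inner (sublap f) f)"
    by simp
  also have "\<dots> \<le> l2 (sublap f) * l2 f" using f by (intro nil_inner_le) simp_all
  finally show ?thesis by (simp only: norm_of_real)
qed

text \<open>One of the two factors C f is written as a commutator and the outer fields are moved
  onto the other. The right side is linear in first derivatives of C f, so that for an eigenfunction
  one factor ||C f|| will cancel.\<close>

lemma energy_C:
  assumes f: "f \<in> nil_smooth"
  shows "(l2 (field_C f))\<^sup>2 \<le> l2 (field_A f) * l2 (field_B (field_C f)) + l2 (field_B f) * l2 (field_A (field_C f))"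
proof -
  have C: "field_C f = (\<lambda>x. field_A (field_B f) x - field_B (field_A f) x)"
    using field_AB[of f] f by auto
  have "of_real ((l2 (field_C f))\<^sup>2) = nil_inner (field_C f) (field_C f)"
    by (simp add: nil_inner_self)
  also have "\<dots> = nil_inner (field_A (field_B f)) (field_C f) - nil_inner (field_B (field_A f)) (field_C f)"
    by (subst (1) C, subst nil_inner_diff_left) (use f in simp_all)
  also have "\<dots> = nil_inner (field_A f) (field_B (field_C f)) - nil_inner (field_B f) (field_A (field_C f))"
    using f by (simp add: inner_A inner_B)
  finally have "cmod (of_real ((l2 (field_C f))\<^sup>2)) = cmod (nil_inner (field_A f) (field_B (field_C f)) - nil_inner (field_B f) (field_A (field_C f)))"
    by simp
  also have "\<dots> \<le> cmod (nil_inner (field_A f) (field_B (field_C f))) + cmod (nil_inner (field_B f) (field_A (field_C f)))"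
    by (rule norm_triangle_ineq4)
  also have "\<dots> \<le> l2 (field_A f) * l2 (field_B (field_C f)) + l2 (field_B f) * l2 (field_A (field_C f))"
    using f by (intro add_mono nil_inner_le) simp_all
  finally show ?thesis by (simp only: norm_of_real)
qed

text \<open>Apply the energy identity to \<open>B f\<close> and use \<open>[L, B] = -2 A C\<close>.\<close>

lemma energy_AB:
  assumes f: "f \<in> nil_smooth"
  shows "(l2 (field_A (field_B f)))\<^sup>2 \<le> (l2 (sublap f))\<^sup>2 + 4 * (l2 (field_C f))\<^sup>2"
proof -
  let ?A = field_A and ?B = field_B and ?C = field_C
  have s: "smooth f" using f by simp
  have L: "sublap (?B f) x = ?B (sublap f) x - 2 * ?A (?C f) x" for x
  proof -
    have "?A (?A (?B f)) x = ?A (\<lambda>x. ?B (?A f) x + ?C f x) x"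
      using field_AB[OF s] by simp
    also have "\<dots> = ?A (?B (?A f)) x + ?A (?C f) x" using s by (simp add: field_A_add)
    also have "\<dots> = ?B (?A (?A f)) x + 2 * ?A (?C f) x" using s by (simp add: field_AB field_CA)
    finally have 1: "?A (?A (?B f)) x = ?B (?A (?A f)) x + 2 * ?A (?C f) x" .
    have "sublap f = (\<lambda>x. (-1) * (?A (?A f) x + ?B (?B f) x))"
      by (simp add: sublap_def[abs_def])
    then have "?B (sublap f) x = (-1) * (?B (?A (?A f)) x + ?B (?B (?B f)) x)"
      using s by (simp only: field_B_cmult smooth_add smooth_A smooth_B) (simp add: field_B_add)
    then show ?thesis by (simp add: sublap_def 1)
  qed
  have LB: "sublap (?B f) = (\<lambda>x. ?B (sublap f) x + (-2) * ?A (?C f) x)"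
    using L by auto
  have "of_real ((l2 (?A (?B f)))\<^sup>2 + (l2 (?B (?B f)))\<^sup>2) = nil_inner (sublap (?B f)) (?B f)"
    using inner_sublap[of "?B f" "?B f"] f by (simp add: nil_inner_self)
  also have "\<dots> = nil_inner (?B (sublap f)) (?B f) + (-2) * nil_inner (?A (?C f)) (?B f)"
    unfolding LB using f by (subst nil_inner_add_left) (auto simp only: nil_inner_cmult_left intro!: sqint_cmult sqint_nil_smooth nil_smooth_mult nil_smooth_const nil_smooth_fields nil_smooth_sublap)
  also have "\<dots> = 2 * nil_inner (?C f) (?A (?B f)) - nil_inner (sublap f) (?B (?B f))"
    using f by (simp add: inner_A inner_B)
  finally have "cmod (of_real ((l2 (?A (?B f)))\<^sup>2 + (l2 (?B (?B f)))\<^sup>2)) = cmod (2 * nil_inner (?C f) (?A (?B f)) - nil_inner (sublap f) (?B (?B f)))"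
    by simp
  also have "\<dots> \<le> 2 * cmod (nil_inner (?C f) (?A (?B f))) + cmod (nil_inner (sublap f) (?B (?B f)))"
    by (rule order_trans[OF norm_triangle_ineq4]) (simp add: norm_mult)
  also have "\<dots> \<le> 2 * (l2 (?C f) * l2 (?A (?B f))) + l2 (sublap f) * l2 (?B (?B f))"
    using f by (intro add_mono mult_left_mono nil_inner_le) simp_all
  finally have "(l2 (?A (?B f)))\<^sup>2 + (l2 (?B (?B f)))\<^sup>2 \<le> 2 * (l2 (?C f) * l2 (?A (?B f))) + l2 (sublap f) * l2 (?B (?B f))"
    by (simp only: norm_of_real)
  \<comment> \<open>Young's inequality on twice the previous bound, weighted so that one copy of the
    squares of ||A B f|| and ||B B f|| absorbs what it produces.\<close>
  moreover have "2 * (2 * (l2 (?C f) * l2 (?A (?B f)))) \<le> 4 * (l2 (?C f))\<^sup>2 + (l2 (?A (?B f)))\<^sup>2"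
    using zero_le_power2[of "2 * l2 (?C f) - l2 (?A (?B f))"] by (simp add: power2_diff power_mult_distrib)
  moreover have "2 * (l2 (sublap f) * l2 (?B (?B f))) \<le> (l2 (sublap f))\<^sup>2 + (l2 (?B (?B f)))\<^sup>2"
    using sum_squares_bound[of "l2 (sublap f)" "l2 (?B (?B f))"] by simp
  moreover have "0 \<le> (l2 (?B (?B f)))\<^sup>2" by simp
  ultimately show ?thesis by linarith
qed

section \<open>Sobolev and Poincare inequalities\<close>

lemma norm_square_diff_le:
  fixes g :: "real \<Rightarrow> complex"
  assumes d: "\<And>x. x \<in> {0..1} \<Longrightarrow> (g has_vector_derivative g' x) (at x within {0..1})"
    and g': "continuous_on {0..1} g'" and x: "x \<in> {0..1}" and y: "y \<in> {0..1}"
  shows "(cmod (g x - g y))\<^sup>2 \<le> (LINT z|unitM. (cmod (g' z))\<^sup>2)"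
proof -
  have "(cmod (g x - g y))\<^sup>2 \<le> (LINT z|unitM. cmod (g' z))\<^sup>2"
    by (intro power_mono norm_diff_le_unitM[OF d g' x y]) auto
  also have "\<dots> \<le> (LINT z|unitM. (cmod (g' z))\<^sup>2)"
    by (intro unitM_Jensen continuous_intros g')
  finally show ?thesis .
qed

text \<open>The derivative of |g|^2 is 2 <g, g'>. Hence |g(x)|^2 exceeds |g(y)|^2 by at most the
  integral of 2 |g| |g'|, which is split by Young's inequality with weight t and then averaged over
  y. The parameter t is an inverse length.\<close>

lemma sobolev_1d:
  fixes g :: "real \<Rightarrow> complex"
  assumes d: "\<And>x. x \<in> {0..1} \<Longrightarrow> (g has_vector_derivative g' x) (at x within {0..1})"
    and g': "continuous_on {0..1} g'" and t: "0 < t" and x: "x \<in> {0..1}"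
  shows "(cmod (g x))\<^sup>2 \<le> (1 + t) * (LINT z|unitM. (cmod (g z))\<^sup>2) + (LINT z|unitM. (cmod (g' z))\<^sup>2) / t"
proof -
  have g: "continuous_on {0..1} g"
    using d by (rule continuous_on_vector_derivative)
  have int: "integrable unitM (\<lambda>z. (cmod (g z))\<^sup>2)" "integrable unitM (\<lambda>z. (cmod (g' z))\<^sup>2)"
    "integrable unitM (\<lambda>z. norm (2 * (g z \<bullet> g' z)))"
    by (intro unitM_integrable continuous_intros g g')+
  define R where "R = t * (LINT z|unitM. (cmod (g z))\<^sup>2) + (LINT z|unitM. (cmod (g' z))\<^sup>2) / t"
  have R: "(LINT z|unitM. norm (2 * (g z \<bullet> g' z))) \<le> R"
  proof -
    have "(LINT z|unitM. norm (2 * (g z \<bullet> g' z))) \<le> (LINT z|unitM. t * (cmod (g z))\<^sup>2 + (cmod (g' z))\<^sup>2 / t)"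
    proof (intro integral_mono int Bochner_Integration.integrable_add integrable_mult_right integrable_divide)
      fix z
      have "\<bar>g z \<bullet> g' z\<bar> \<le> cmod (g z) * cmod (g' z)" by (rule Cauchy_Schwarz_ineq2)
      moreover have "2 * (cmod (g z) * cmod (g' z)) \<le> t * (cmod (g z))\<^sup>2 + (cmod (g' z))\<^sup>2 / t"
      proof -
        have "0 \<le> (t * cmod (g z) - cmod (g' z))\<^sup>2 / t" using t by simp
        also have "\<dots> = t * (cmod (g z))\<^sup>2 + (cmod (g' z))\<^sup>2 / t - 2 * (cmod (g z) * cmod (g' z))"
          using t by (simp add: power2_eq_square field_simps)
        finally show ?thesis by simp
      qed
      ultimately show "norm (2 * (g z \<bullet> g' z)) \<le> t * (cmod (g z))\<^sup>2 + (cmod (g' z))\<^sup>2 / t"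
        by simp
    qed
    then show ?thesis using int by (simp add: R_def)
  qed
  have k: "(cmod (g x))\<^sup>2 - (cmod (g y))\<^sup>2 \<le> R" if y: "y \<in> {0..1}" for y
  proof -
    have "norm (g x \<bullet> g x - g y \<bullet> g y) \<le> (LINT z|unitM. norm (2 * (g z \<bullet> g' z)))"
    proof (rule norm_diff_le_unitM[OF _ _ x y])
      show "((\<lambda>z. g z \<bullet> g z) has_vector_derivative 2 * (g z \<bullet> g' z)) (at z within {0..1})" if "z \<in> {0..1}" for z
        using bounded_bilinear.has_vector_derivative[OF bounded_bilinear_inner d[OF that] d[OF that]]
        by (simp add: inner_commute)
    qed (intro continuous_intros g g')
    then show ?thesis using R by (simp add: power2_norm_eq_inner abs_le_iff)
  qed
  have "(LINT y|unitM. (cmod (g x))\<^sup>2 - (cmod (g y))\<^sup>2) \<le> (LINT y|unitM. R)"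
    using k int by (intro integral_mono) auto
  then show ?thesis using int by (simp add: R_def algebra_simps)
qed

lemma nn_unitM_norm_square:
  fixes g :: "real \<Rightarrow> complex"
  assumes "continuous_on {0..1} g"
  shows "(\<integral>\<^sup>+z. ennreal ((cmod (g z))\<^sup>2) \<partial>unitM) = ennreal (LINT z|unitM. (cmod (g z))\<^sup>2)"
  using assms by (intro nn_integral_eq_integral unitM_integrable continuous_intros) auto

text \<open>In this form the inequality can be integrated over the remaining coordinates with
  measurability as the only side condition.\<close>

lemma sobolev_1d_ennreal:
  fixes g :: "real \<Rightarrow> complex"
  assumes d: "\<And>x. (g has_vector_derivative g' x) (at x within {0..1})"
    and g': "continuous_on {0..1} g'" and t: "0 < t" and x: "x \<in> {0..<1}"
  shows "ennreal ((cmod (g x))\<^sup>2) \<le> ennreal (1 + t) * (\<integral>\<^sup>+z. ennreal ((cmod (g z))\<^sup>2) \<partial>unitM)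
    + ennreal (1 / t) * (\<integral>\<^sup>+z. ennreal ((cmod (g' z))\<^sup>2) \<partial>unitM)"
proof -
  have "continuous_on {0..1} g"
    using d by (rule continuous_on_vector_derivative)
  then have "ennreal (1 + t) * (\<integral>\<^sup>+z. ennreal ((cmod (g z))\<^sup>2) \<partial>unitM)
    + ennreal (1 / t) * (\<integral>\<^sup>+z. ennreal ((cmod (g' z))\<^sup>2) \<partial>unitM) =
    ennreal ((1 + t) * (LINT z|unitM. (cmod (g z))\<^sup>2) + (LINT z|unitM. (cmod (g' z))\<^sup>2) / t)"
    using t g' by (simp add: nn_unitM_norm_square ennreal_mult'[symmetric] ennreal_plus[symmetric] del: ennreal_plus)
  then show ?thesis using sobolev_1d[OF d g' t, of x] x by (simp add: ennreal_leI)
qed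

section \<open>From lines to the cube\<close>

abbreviation nsq :: "(heis \<Rightarrow> complex) \<Rightarrow> heis \<Rightarrow> ennreal" where
  "nsq f x \<equiv> ennreal ((cmod (f x))\<^sup>2)"

lemma nn_integral_nsq:
  "sqint f \<Longrightarrow> (\<integral>\<^sup>+x. nsq f x \<partial>nilM) = ennreal ((l2 f)\<^sup>2)"
  unfolding l2_square sqint_def by (simp add: nn_integral_eq_integral)

lemma measurable_unitM2:
  fixes F :: "real \<times> real \<Rightarrow> 'a::topological_space"
  assumes "continuous_on UNIV F"
  shows "F \<in> borel_measurable (unitM \<Otimes>\<^sub>M unitM)"
proof -
  have "(\<lambda>x. x) \<in> measurable unitM (borel::real measure)"
    using sets_unitM_borel[of "\<lambda>x. x"] by simp
  then have "(\<lambda>x. x) \<in> measurable (unitM \<Otimes>\<^sub>M unitM) (borel \<Otimes>\<^sub>M (borel::real measure))"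
    by (intro measurable_pair) (auto simp: comp_def intro: measurable_compose[OF measurable_fst] measurable_compose[OF measurable_snd])
  moreover have "F \<in> borel_measurable (borel \<Otimes>\<^sub>M borel)"
    using borel_measurable_continuous_onI[OF assms] by (simp add: borel_prod)
  ultimately show ?thesis by (rule measurable_compose)
qed

lemma nn_unitM_swap:
  assumes "F \<in> borel_measurable (unitM \<Otimes>\<^sub>M unitM)"
  shows "(\<integral>\<^sup>+x. \<integral>\<^sup>+y. F (x, y) \<partial>unitM \<partial>unitM) = (\<integral>\<^sup>+y. \<integral>\<^sup>+x. F (x, y) \<partial>unitM \<partial>unitM)"
  using U2.nn_integral_snd[OF assms] U2.P.nn_integral_fst unitM.nn_integral_fst[OF assms] by simp

lemma nn_integral_nilM_bca:
  assumes "F \<in> borel_measurable nilM"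
  shows "(\<integral>\<^sup>+x. F x \<partial>nilM) = (\<integral>\<^sup>+b. \<integral>\<^sup>+c. \<integral>\<^sup>+a. F (a, b, c) \<partial>unitM \<partial>unitM \<partial>unitM)"
proof -
  note m = assms[unfolded nilM_eq]
  have "(\<integral>\<^sup>+x. F x \<partial>nilM) = (\<integral>\<^sup>+p. \<integral>\<^sup>+a. F (a, p) \<partial>unitM \<partial>(unitM \<Otimes>\<^sub>M unitM))"
    using U3.nn_integral_snd[OF m] by (simp add: nilM_eq)
  also have "\<dots> = (\<integral>\<^sup>+b. \<integral>\<^sup>+c. \<integral>\<^sup>+a. F (a, b, c) \<partial>unitM \<partial>unitM \<partial>unitM)"
    by (intro unitM.nn_integral_fst[symmetric] unitM.borel_measurable_nn_integral_fst[of "\<lambda>(p, a). F (a, p)", simplified] measurable_pair_swap[OF m])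
  finally show ?thesis .
qed

text \<open>Undoes the shear \<open>c + a * b\<close> of the integral curves of B and the
  translations inside \<open>avg\<close>.\<close>

lemma nn_shift:
  assumes f: "f \<in> nil_smooth"
  shows "(\<integral>\<^sup>+c. nsq f (a, b, c + s) \<partial>unitM) = (\<integral>\<^sup>+c. nsq f (a, b, c) \<partial>unitM)"
proof -
  have s: "smooth f" using f by simp
  have "(LINT c|unitM. (cmod (f (a, b, c + s)))\<^sup>2) = (LINT c|unitM. (cmod (f (a, b, c)))\<^sup>2)"
    by (rule unitM_periodic_shift)
       (auto intro!: continuous_intros smooth_continuous_compose[OF s] simp: nil_smooth_unit_shift[OF f])
  then show ?thesis using s by (simp add: nn_unitM_norm_square)
qed

context
  fixes t :: real
  assumes t: "0 < t"
begin

text \<open>\<open>sob1\<close> bounds the integral of |f|^2 over b and c at fixed a, and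
  \<open>sob2\<close> the integral over c at fixed a and b. Each passage to a fixed coordinate costs
  a factor 1 + t and one derivative with weight 1 / t.\<close>

definition "sob1 f = (1 + t) * (l2 f)\<^sup>2 + (l2 (field_A f))\<^sup>2 / t"
definition "sob2 f = (1 + t) * sob1 f + sob1 (field_B f) / t"

text \<open>The one-dimensional inequality in a, integrated over b and c. It lives on an interval,
  so the twisted gluing of the faces a = 0 and a = 1 never enters.\<close>

lemma sobolev_A:
  assumes f: "f \<in> nil_smooth" and a: "a \<in> {0..<1}"
  shows "(\<integral>\<^sup>+b. \<integral>\<^sup>+c. nsq f (a, b, c) \<partial>unitM \<partial>unitM) \<le> ennreal (sob1 f)"
proof -
  have s: "smooth f" using f by simp
  have sA: "smooth (field_A f)" using f by simp
  have m: "nsq h \<in> borel_measurable nilM" if "smooth h" for h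
    by (intro measurable_compose[OF continuous_nilM_measurable[OF smooth_continuous[OF that]]]) simp
  have m2: "(\<lambda>p. \<integral>\<^sup>+a. nsq h (a, p) \<partial>unitM) \<in> borel_measurable (unitM \<Otimes>\<^sub>M unitM)" if "smooth h" for h
    using m[OF that] unfolding nilM_eq
    by (intro unitM.borel_measurable_nn_integral_fst[of "\<lambda>(p, a). nsq h (a, p)", simplified] measurable_pair_swap)
  have "(\<integral>\<^sup>+b. \<integral>\<^sup>+c. nsq f (a, b, c) \<partial>unitM \<partial>unitM) = (\<integral>\<^sup>+p. nsq f (a, p) \<partial>(unitM \<Otimes>\<^sub>M unitM))"
    using s by (subst unitM.nn_integral_fst[symmetric]) (auto intro!: measurable_unitM2 continuous_intros smooth_continuous_compose[OF s])
  also have "\<dots> \<le> (\<integral>\<^sup>+p. ennreal (1 + t) * (\<integral>\<^sup>+z. nsq f (z, p) \<partial>unitM)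
       + ennreal (1 / t) * (\<integral>\<^sup>+z. nsq (field_A f) (z, p) \<partial>unitM) \<partial>(unitM \<Otimes>\<^sub>M unitM))"
  proof (rule nn_integral_mono)
    fix p :: "real \<times> real"
    obtain b c where p: "p = (b, c)" by fastforce
    show "nsq f (a, p) \<le> ennreal (1 + t) * (\<integral>\<^sup>+z. nsq f (z, p) \<partial>unitM) + ennreal (1 / t) * (\<integral>\<^sup>+z. nsq (field_A f) (z, p) \<partial>unitM)"
      unfolding p using t a s sA by (intro sobolev_1d_ennreal smooth_partial) simp_all
  qed
  also have "\<dots> = ennreal (1 + t) * (\<integral>\<^sup>+p. \<integral>\<^sup>+z. nsq f (z, p) \<partial>unitM \<partial>(unitM \<Otimes>\<^sub>M unitM))
       + ennreal (1 / t) * (\<integral>\<^sup>+p. \<integral>\<^sup>+z. nsq (field_A f) (z, p) \<partial>unitM \<partial>(unitM \<Otimes>\<^sub>M unitM))"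
    using m2[OF s] m2[OF sA] by (simp add: nn_integral_add nn_integral_cmult)
  also have "\<dots> = ennreal (1 + t) * (\<integral>\<^sup>+x. nsq f x \<partial>nilM) + ennreal (1 / t) * (\<integral>\<^sup>+x. nsq (field_A f) x \<partial>nilM)"
    using U3.nn_integral_snd[of "nsq f"] U3.nn_integral_snd[of "nsq (field_A f)"] m[OF s] m[OF sA] by (simp add: nilM_eq)
  also have "\<dots> = ennreal (sob1 f)"
    using f t by (simp add: nn_integral_nsq sob1_def ennreal_mult'[symmetric] ennreal_plus[symmetric] del: ennreal_plus)
  finally show ?thesis .
qed

text \<open>The one-dimensional inequality is applied along the integral curves of B, on which c
  moves with b. After integration over c the shear disappears by periodicity, and
  \<open>sobolev_A\<close> applies to f and to \<open>field_B f\<close>.\<close>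

lemma sobolev_B:
  assumes f: "f \<in> nil_smooth" and a: "a \<in> {0..<1}" and b: "b \<in> {0..<1}"
  shows "(\<integral>\<^sup>+c. nsq f (a, b, c) \<partial>unitM) \<le> ennreal (sob2 f)"
proof -
  have fB: "field_B f \<in> nil_smooth" using f by simp
  have *: "(\<integral>\<^sup>+c. \<integral>\<^sup>+z. nsq h (a, z, c + a * z) \<partial>unitM \<partial>unitM) \<le> ennreal (sob1 h)"
    "(\<lambda>c. \<integral>\<^sup>+z. nsq h (a, z, c + a * z) \<partial>unitM) \<in> borel_measurable unitM"
    if h: "h \<in> nil_smooth" for h
  proof -
    have s: "smooth h" using h by simp
    have m: "(\<lambda>(c, z). nsq h (a, z, c + a * z)) \<in> borel_measurable (unitM \<Otimes>\<^sub>M unitM)"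
      unfolding split_beta'
      by (intro measurable_compose[OF measurable_unitM2 measurable_ennreal] continuous_intros smooth_continuous_compose[OF s])
    have "(\<integral>\<^sup>+c. \<integral>\<^sup>+z. nsq h (a, z, c + a * z) \<partial>unitM \<partial>unitM) = (\<integral>\<^sup>+z. \<integral>\<^sup>+c. nsq h (a, z, c + a * z) \<partial>unitM \<partial>unitM)"
      using nn_unitM_swap[OF m] by simp
    also have "\<dots> \<le> ennreal (sob1 h)"
      using sobolev_A[OF h a] by (simp add: nn_shift[OF h])
    finally show "(\<integral>\<^sup>+c. \<integral>\<^sup>+z. nsq h (a, z, c + a * z) \<partial>unitM \<partial>unitM) \<le> ennreal (sob1 h)" .
    show "(\<lambda>c. \<integral>\<^sup>+z. nsq h (a, z, c + a * z) \<partial>unitM) \<in> borel_measurable unitM"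
      using unitM.borel_measurable_nn_integral_fst[OF m] by simp
  qed
  have "(\<integral>\<^sup>+c. nsq f (a, b, c) \<partial>unitM) = (\<integral>\<^sup>+c. nsq f (a, b, c + a * b) \<partial>unitM)"
    by (simp add: nn_shift[OF f])
  also have "\<dots> \<le> (\<integral>\<^sup>+c. ennreal (1 + t) * (\<integral>\<^sup>+z. nsq f (a, z, c + a * z) \<partial>unitM)
       + ennreal (1 / t) * (\<integral>\<^sup>+z. nsq (field_B f) (a, z, c + a * z) \<partial>unitM) \<partial>unitM)"
    using t b f fB
    by (intro nn_integral_mono sobolev_1d_ennreal smooth_line_B) simp_all
  also have "\<dots> = ennreal (1 + t) * (\<integral>\<^sup>+c. \<integral>\<^sup>+z. nsq f (a, z, c + a * z) \<partial>unitM \<partial>unitM)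
       + ennreal (1 / t) * (\<integral>\<^sup>+c. \<integral>\<^sup>+z. nsq (field_B f) (a, z, c + a * z) \<partial>unitM \<partial>unitM)"
    using *(2)[OF f] *(2)[OF fB] by (simp add: nn_integral_add nn_integral_cmult)
  also have "\<dots> \<le> ennreal (1 + t) * ennreal (sob1 f) + ennreal (1 / t) * ennreal (sob1 (field_B f))"
    by (intro add_mono mult_left_mono * f fB) auto
  also have "\<dots> = ennreal (sob2 f)"
    using t by (simp add: sob1_def sob2_def ennreal_mult'[symmetric] ennreal_plus[symmetric] del: ennreal_plus)
  finally show ?thesis .
qed

text \<open>The three one-dimensional steps follow the fields \<open>C\<close>, \<open>B\<close>, \<open>A\<close> at the scales
  \<open>1 / t\<^sup>2\<close>, \<open>1 / t\<close>, \<open>1 / t\<close>; this anisotropy gives the exponent of the homogeneous dimension 4.\<close>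

lemma sobolev:
  assumes f: "f \<in> nil_smooth" and x: "x \<in> cube"
  shows "(cmod (f x))\<^sup>2 \<le> (1 + t\<^sup>2) * sob2 f + sob2 (field_C f) / t\<^sup>2"
proof -
  obtain a b c where x: "x = (a, b, c)" "a \<in> {0..<1}" "b \<in> {0..<1}" "c \<in> {0..<1}"
    using x by (auto simp: cube_def)
  have fC: "field_C f \<in> nil_smooth" using f by simp
  have "nsq f (a, b, c) \<le> ennreal (1 + t\<^sup>2) * (\<integral>\<^sup>+z. nsq f (a, b, z) \<partial>unitM)
      + ennreal (1 / t\<^sup>2) * (\<integral>\<^sup>+z. nsq (field_C f) (a, b, z) \<partial>unitM)"
    using t x f fC by (intro sobolev_1d_ennreal smooth_partial) simp_all
  also have "\<dots> \<le> ennreal (1 + t\<^sup>2) * ennreal (sob2 f) + ennreal (1 / t\<^sup>2) * ennreal (sob2 (field_C f))"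
    using x by (intro add_mono mult_left_mono sobolev_B f fC) auto
  also have "\<dots> = ennreal ((1 + t\<^sup>2) * sob2 f + sob2 (field_C f) / t\<^sup>2)"
    using t by (simp add: sob1_def sob2_def ennreal_mult'[symmetric] ennreal_plus[symmetric] del: ennreal_plus)
  finally show ?thesis
    using t by (subst (asm) ennreal_le_iff) (auto simp: x sob1_def sob2_def intro!: add_nonneg_nonneg mult_nonneg_nonneg divide_nonneg_nonneg)
qed

end

text \<open>Two points of the cube are joined by a path parallel to the axes: from (a, b, c) to (a,
  b, c'), to (a, b', c'), to (a', b', c'). The energy of each leg depends on only two coordinates,
  so integration over both points turns it into a full norm. The factor 3 comes from squaring a sum
  of three terms.\<close>

lemma poincare_pairs:
  assumes f: "f \<in> nil_smooth"
  shows "(l2 (\<lambda>x. f x - (LINT y|nilM. f y)))\<^sup>2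
    \<le> 3 * ((l2 (field_C f))\<^sup>2 + (l2 (dd f (0, 1, 0)))\<^sup>2 + (l2 (field_A f))\<^sup>2)"
proof -
  let ?C = "field_C f" and ?A = "field_A f" and ?b = "dd f (0, 1, 0)"
  have s: "smooth f" "smooth ?C" "smooth ?A" "smooth ?b" using f by simp_all
  have sq: "sqint f" "sqint ?C" "sqint ?A" "sqint ?b"
    by (intro sqint_continuous smooth_continuous s)+
  have ms: "nsq h \<in> borel_measurable (unitM \<Otimes>\<^sub>M unitM \<Otimes>\<^sub>M unitM)" if "smooth h" for h
    using continuous_nilM_measurable[OF smooth_continuous[OF that]] by (simp add: nilM_eq)
  note [measurable] = ms[OF s(2)] ms[OF s(3)] ms[OF s(4)]
  define m where "m = (LINT y|nilM. f y)"
  \<comment> \<open>Energies of the lines containing the three legs: c moves at (a, b), then b at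
    (a, c'), then a at (b', c').\<close>
  define T3 where "T3 a b = (\<integral>\<^sup>+z. nsq ?C (a, b, z) \<partial>unitM)" for a b
  define T2 where "T2 a c = (\<integral>\<^sup>+z. nsq ?b (a, z, c) \<partial>unitM)" for a c
  define T1 where "T1 b c = (\<integral>\<^sup>+z. nsq ?A (z, b, c) \<partial>unitM)" for b c
  have [measurable]: "case_prod T3 \<in> borel_measurable (unitM \<Otimes>\<^sub>M unitM)"
      "case_prod T2 \<in> borel_measurable (unitM \<Otimes>\<^sub>M unitM)"
      "case_prod T1 \<in> borel_measurable (unitM \<Otimes>\<^sub>M unitM)"
    unfolding T1_def T2_def T3_def by measurable
  have one: "ennreal ((cmod (g u - g v))\<^sup>2) \<le> (\<integral>\<^sup>+z. ennreal ((cmod (g' z))\<^sup>2) \<partial>unitM)"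
    if "\<And>x. (g has_vector_derivative g' x) (at x within {0..1})" "continuous_on {0..1} g'"
      "u \<in> {0..<1}" "v \<in> {0..<1}" for g g' :: "real \<Rightarrow> complex" and u v
    unfolding nn_unitM_norm_square[OF that(2)]
    using that by (intro ennreal_leI norm_square_diff_le) auto
  have tri: "(cmod (p - w))\<^sup>2 \<le> 3 * ((cmod (p - q))\<^sup>2 + (cmod (q - r))\<^sup>2 + (cmod (r - w))\<^sup>2)" for p q r w
  proof -
    have "cmod (p - w) \<le> cmod (p - q) + cmod (q - r) + cmod (r - w)"
      using norm_triangle_ineq[of "p - q" "q - r"] norm_triangle_ineq[of "p - r" "r - w"] by simp
    then have "(cmod (p - w))\<^sup>2 \<le> (cmod (p - q) + cmod (q - r) + cmod (r - w))\<^sup>2"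
      by (rule power_mono) simp
    moreover have "(x + y + z)\<^sup>2 \<le> 3 * (x\<^sup>2 + y\<^sup>2 + z\<^sup>2)" for x y z :: real
      using zero_le_power2[of "x - y"] zero_le_power2[of "y - z"] zero_le_power2[of "x - z"]
      by (simp add: power2_eq_square algebra_simps)
    ultimately show ?thesis using order_trans by blast
  qed
  have pair: "ennreal ((cmod (f (a, b, c) - f (a', b', c')))\<^sup>2) \<le> 3 * (T3 a b + T2 a c' + T1 b' c')"
    if "a \<in> {0..<1}" "b \<in> {0..<1}" "c \<in> {0..<1}" "a' \<in> {0..<1}" "b' \<in> {0..<1}" "c' \<in> {0..<1}" for a b c a' b' c'
  proof -
    have "ennreal ((cmod (f (a, b, c) - f (a', b', c')))\<^sup>2) \<le>
      ennreal (3 * ((cmod (f (a, b, c) - f (a, b, c')))\<^sup>2 + (cmod (f (a, b, c') - f (a, b', c')))\<^sup>2 + (cmod (f (a, b', c') - f (a', b', c')))\<^sup>2))"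
      by (intro ennreal_leI tri)
    also have "\<dots> = 3 * (ennreal ((cmod (f (a, b, c) - f (a, b, c')))\<^sup>2) + ennreal ((cmod (f (a, b, c') - f (a, b', c')))\<^sup>2) + ennreal ((cmod (f (a, b', c') - f (a', b', c')))\<^sup>2))"
      by (subst ennreal_mult) (auto simp: ennreal_plus)
    also have "\<dots> \<le> 3 * (T3 a b + T2 a c' + T1 b' c')"
      unfolding T1_def T2_def T3_def
      using that s smooth_section_continuous(2)[OF s(4)]
      by (intro mult_left_mono add_mono one smooth_partial) simp_all
    finally show ?thesis .
  qed
  have iT3: "(\<integral>\<^sup>+x. T3 (fst x) (fst (snd x)) \<partial>nilM) = ennreal ((l2 ?C)\<^sup>2)"
  proof -
    have "(\<lambda>x. T3 (fst x) (fst (snd x))) \<in> borel_measurable nilM" "nsq ?C \<in> borel_measurable nilM"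
      by (simp_all only: nilM_eq) measurable
    from this[THEN nn_integral_nilM] show ?thesis
      unfolding nn_integral_nsq[OF sq(2), symmetric] by (simp add: T3_def)
  qed
  have iT1: "(\<integral>\<^sup>+x. T1 (fst (snd x)) (snd (snd x)) \<partial>nilM) = ennreal ((l2 ?A)\<^sup>2)"
  proof -
    have "(\<lambda>x. T1 (fst (snd x)) (snd (snd x))) \<in> borel_measurable nilM" "nsq ?A \<in> borel_measurable nilM"
      by (simp_all only: nilM_eq) measurable
    from this(1)[THEN nn_integral_nilM] this(2)[THEN nn_integral_nilM_bca] show ?thesis
      unfolding nn_integral_nsq[OF sq(3), symmetric] by (simp add: T1_def)
  qed
  \<comment> \<open>The middle leg mixes a of the first point with c of the second, so its full norm
    appears only in the double integral.\<close>
  have iT2: "(\<integral>\<^sup>+x. (\<integral>\<^sup>+y. T2 (fst x) (snd (snd y)) \<partial>nilM) \<partial>nilM) = ennreal ((l2 ?b)\<^sup>2)"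
  proof -
    have sw: "(\<integral>\<^sup>+c. \<integral>\<^sup>+b. nsq ?b (a, b, c) \<partial>unitM \<partial>unitM) = (\<integral>\<^sup>+b. \<integral>\<^sup>+c. nsq ?b (a, b, c) \<partial>unitM \<partial>unitM)"
      if "a \<in> space unitM" for a
    proof -
      have "(\<lambda>(b, c). nsq ?b (a, b, c)) \<in> borel_measurable (unitM \<Otimes>\<^sub>M unitM)"
        using that by measurable
      from nn_unitM_swap[OF this] show ?thesis by simp
    qed
    have "(\<integral>\<^sup>+x. (\<integral>\<^sup>+y. T2 (fst x) (snd (snd y)) \<partial>nilM) \<partial>nilM) = (\<integral>\<^sup>+x. (\<integral>\<^sup>+c. T2 (fst x) c \<partial>unitM) \<partial>nilM)"
    proof (rule nn_integral_cong)
      fix x assume "x \<in> space nilM"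
      then have [measurable]: "fst x \<in> space unitM" by (auto simp: space_nilM cube_def)
      show "(\<integral>\<^sup>+y. T2 (fst x) (snd (snd y)) \<partial>nilM) = (\<integral>\<^sup>+c. T2 (fst x) c \<partial>unitM)"
        by (subst nn_integral_nilM) (simp_all add: nilM_eq)
    qed
    also have "\<dots> = (\<integral>\<^sup>+a. (\<integral>\<^sup>+c. T2 a c \<partial>unitM) \<partial>unitM)"
      by (subst nn_integral_nilM) (simp_all add: nilM_eq)
    also have "\<dots> = (\<integral>\<^sup>+x. nsq ?b x \<partial>nilM)"
    proof -
      have "nsq ?b \<in> borel_measurable nilM" by (simp only: nilM_eq) measurable
      note eq = nn_integral_nilM[OF this]
      show ?thesis unfolding eq T2_def by (rule nn_integral_cong) (rule sw)
    qed
    finally show ?thesis using nn_integral_nsq[OF sq(4)] by simp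
  qed
  \<comment> \<open>As \<open>nilM\<close> is a probability measure, f x - m is the average of f x -
    f y over y; Cauchy-Schwarz against 1 squares it.\<close>
  have mean: "nsq (\<lambda>x. f x - m) x \<le> (\<integral>\<^sup>+y. ennreal ((cmod (f x - f y))\<^sup>2) \<partial>nilM)" for x
  proof -
    have q: "sqint (\<lambda>y. f x - f y)" by (rule sqint_diff[OF sqint_continuous sq(1)]) simp
    have "f x - m = nil_inner (\<lambda>y. f x - f y) (\<lambda>y. 1)"
      using sqint_integrable[OF sq(1)] by (simp add: nil_inner_def m_def)
    then have "cmod (f x - m) \<le> l2 (\<lambda>y. f x - f y) * l2 (\<lambda>y. 1)"
      using nil_inner_le[OF q, of "\<lambda>y. 1"] by simp
    also have "l2 (\<lambda>y. 1) = 1" by (simp add: l2_def)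
    finally have "(cmod (f x - m))\<^sup>2 \<le> (l2 (\<lambda>y. f x - f y))\<^sup>2"
      by (intro power_mono) simp_all
    then show ?thesis using nn_integral_nsq[OF q] by (simp add: ennreal_leI)
  qed
  have "ennreal ((l2 (\<lambda>x. f x - m))\<^sup>2) = (\<integral>\<^sup>+x. nsq (\<lambda>x. f x - m) x \<partial>nilM)"
    by (intro nn_integral_nsq[symmetric] sqint_diff[OF sq(1) sqint_continuous]) simp
  also have "\<dots> \<le> (\<integral>\<^sup>+x. \<integral>\<^sup>+y. ennreal ((cmod (f x - f y))\<^sup>2) \<partial>nilM \<partial>nilM)"
    by (intro nn_integral_mono mean)
  also have "\<dots> \<le> (\<integral>\<^sup>+x. \<integral>\<^sup>+y. 3 * (T3 (fst x) (fst (snd x)) + T2 (fst x) (snd (snd y)) + T1 (fst (snd y)) (snd (snd y))) \<partial>nilM \<partial>nilM)"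
  proof (intro nn_integral_mono)
    fix x y assume "x \<in> space nilM" "y \<in> space nilM"
    then show "ennreal ((cmod (f x - f y))\<^sup>2) \<le> 3 * (T3 (fst x) (fst (snd x)) + T2 (fst x) (snd (snd y)) + T1 (fst (snd y)) (snd (snd y)))"
      using pair[of "fst x" "fst (snd x)" "snd (snd x)" "fst y" "fst (snd y)" "snd (snd y)"]
      by (auto simp: space_nilM cube_def)
  qed
  also have "\<dots> = (\<integral>\<^sup>+x. 3 * (T3 (fst x) (fst (snd x)) + (\<integral>\<^sup>+y. T2 (fst x) (snd (snd y)) \<partial>nilM) + ennreal ((l2 ?A)\<^sup>2)) \<partial>nilM)"
  proof (rule nn_integral_cong)
    fix x assume "x \<in> space nilM"
    then have [measurable]: "fst x \<in> space unitM" by (auto simp: space_nilM cube_def)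
    have [measurable]: "(\<lambda>y. T2 (fst x) (snd (snd y))) \<in> borel_measurable nilM"
      "(\<lambda>y. T1 (fst (snd y)) (snd (snd y))) \<in> borel_measurable nilM" by (simp_all add: nilM_eq)
    show "(\<integral>\<^sup>+y. 3 * (T3 (fst x) (fst (snd x)) + T2 (fst x) (snd (snd y)) + T1 (fst (snd y)) (snd (snd y))) \<partial>nilM)
      = 3 * (T3 (fst x) (fst (snd x)) + (\<integral>\<^sup>+y. T2 (fst x) (snd (snd y)) \<partial>nilM) + ennreal ((l2 ?A)\<^sup>2))"
      by (simp add: nn_integral_cmult nn_integral_add iT1 space_nilM emeasure_nilM)
  qed
  also have "\<dots> = 3 * (ennreal ((l2 ?C)\<^sup>2) + ennreal ((l2 ?b)\<^sup>2) + ennreal ((l2 ?A)\<^sup>2))"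
  proof -
    have [measurable]: "(\<lambda>x. T3 (fst x) (fst (snd x))) \<in> borel_measurable nilM"
      "(\<lambda>x. \<integral>\<^sup>+y. T2 (fst x) (snd (snd y)) \<partial>nilM) \<in> borel_measurable nilM"
      unfolding nilM_eq by measurable
    show ?thesis by (simp add: nn_integral_cmult nn_integral_add iT3 iT2 space_nilM emeasure_nilM)
  qed
  also have "\<dots> = ennreal (3 * ((l2 ?C)\<^sup>2 + (l2 ?b)\<^sup>2 + (l2 ?A)\<^sup>2))"
    by (subst ennreal_mult) (auto simp: ennreal_plus)
  finally show ?thesis unfolding m_def by (subst (asm) ennreal_le_iff) auto
qed

text \<open>On the cube 0 \<le> a < 1, so d/db = B - a C is controlled by B and C. Doubling the
  bound of \<open>poincare_pairs\<close> yields the weights 6, 12 and 18 for A, B and C; 36 covers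
  them all.\<close>

lemma poincare:
  assumes f: "f \<in> nil_smooth"
  shows "(l2 f)\<^sup>2 \<le> 2 * (cmod (LINT x|nilM. f x))\<^sup>2
    + 36 * ((l2 (field_A f))\<^sup>2 + (l2 (field_B f))\<^sup>2 + (l2 (field_C f))\<^sup>2)"
proof -
  have s: "smooth f" "sqint f" using f by simp_all
  have two: "(x + y)\<^sup>2 \<le> 2 * x\<^sup>2 + 2 * y\<^sup>2" for x y :: real
    using zero_le_power2[of "x - y"] by (simp add: power2_eq_square algebra_simps)
  have b: "(l2 (dd f (0, 1, 0)))\<^sup>2 \<le> 2 * (l2 (field_B f))\<^sup>2 + 2 * (l2 (field_C f))\<^sup>2"
  proof -
    have q: "sqint (\<lambda>x. of_real (fst x) * field_C f x)"
      using s by (intro sqint_continuous smooth_continuous) simp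
    have "dd f (0, 1, 0) = (\<lambda>x. field_B f x - of_real (fst x) * field_C f x)"
      using field_B_eq[OF s(1)] by auto
    then have "l2 (dd f (0, 1, 0)) \<le> l2 (field_B f) + l2 (\<lambda>x. of_real (fst x) * field_C f x)"
      using l2_triangle[of "field_B f" "\<lambda>x. (-1) * (of_real (fst x) * field_C f x)"] q f
        l2_cmult[of "-1" "\<lambda>x. of_real (fst x) * field_C f x"] sqint_cmult[OF q, of "-1"] by simp
    also have "l2 (\<lambda>x. of_real (fst x) * field_C f x) \<le> l2 (field_C f)"
      unfolding l2_def
    proof (intro real_sqrt_le_mono integral_mono)
      fix x assume "x \<in> space nilM"
      then show "(cmod (of_real (fst x) * field_C f x))\<^sup>2 \<le> (cmod (field_C f x))\<^sup>2"
        by (intro power_mono) (auto simp: norm_mult space_nilM cube_def intro!: mult_left_le_one_le)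
    qed (use q sqint_nil_smooth[OF nil_smooth_C[OF f]] in \<open>auto simp: sqint_def\<close>)
    finally have "(l2 (dd f (0, 1, 0)))\<^sup>2 \<le> (l2 (field_B f) + l2 (field_C f))\<^sup>2"
      by (intro power_mono) simp_all
    then show ?thesis using two order_trans by blast
  qed
  define m where "m = (LINT x|nilM. f x)"
  have "l2 f \<le> l2 (\<lambda>x. f x - m) + l2 (\<lambda>x. m)"
    using l2_triangle[of "\<lambda>x. f x - m" "\<lambda>x. m"] s sqint_continuous[of "\<lambda>x. m"] by (simp add: sqint_diff)
  moreover have "l2 (\<lambda>x. m) = cmod m" by (simp add: l2_def)
  ultimately have "(l2 f)\<^sup>2 \<le> (l2 (\<lambda>x. f x - m) + cmod m)\<^sup>2"
    by (intro power_mono) simp_all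
  also have "\<dots> \<le> 2 * (l2 (\<lambda>x. f x - m))\<^sup>2 + 2 * (cmod m)\<^sup>2" by (rule two)
  finally have 1: "(l2 f)\<^sup>2 \<le> 2 * (l2 (\<lambda>x. f x - m))\<^sup>2 + 2 * (cmod m)\<^sup>2" .
  have 2: "(l2 (\<lambda>x. f x - m))\<^sup>2 \<le> 3 * ((l2 (field_C f))\<^sup>2 + (l2 (dd f (0, 1, 0)))\<^sup>2 + (l2 (field_A f))\<^sup>2)"
    using poincare_pairs[OF f] by (simp add: m_def)
  have "0 \<le> (l2 (field_A f))\<^sup>2" "0 \<le> (l2 (field_B f))\<^sup>2" "0 \<le> (l2 (field_C f))\<^sup>2" by simp_all
  then show ?thesis using 1 2 b unfolding m_def[symmetric] by argo
qed

section \<open>Averaging along the centre\<close>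

text \<open>The mean of f over the central segment from c to c + h, scaled to a fixed interval so
  that differentiation under the integral meets no moving endpoint. Central translations commute
  with the lattice action and with the fields.\<close>

definition avg :: "real \<Rightarrow> (heis \<Rightarrow> complex) \<Rightarrow> heis \<Rightarrow> complex" where
  "avg h f x = integral {0..1} (\<lambda>s. f (x + (0, 0, h * s)))"

lemma avg_integrable: "smooth f \<Longrightarrow> (\<lambda>s. f (x + (0, 0, h * s))) integrable_on {0..1}"
  by (intro integrable_continuous_interval smooth_continuous_compose[of f] continuous_intros)

lemma avg_has_derivative:
  assumes f: "smooth f"
  shows "(avg h f has_derivative (\<lambda>v. avg h (dd f v) x)) (at x)"
proof -
  \<comment> \<open>The Leibniz rule wants the derivative as a continuous map into bounded linear
    operators, hence the packaging as \<open>Blinfun\<close>.\<close>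
  define D where "D y = Blinfun (\<lambda>v. dd f v y)" for y
  have D: "blinfun_apply (D y) = (\<lambda>v. dd f v y)" for y
    unfolding D_def using smooth_has_derivative[OF f]
    by (intro bounded_linear_Blinfun_apply has_derivative_bounded_linear)
  have Dc: "continuous_on UNIV D"
    using f by (intro continuous_on_blinfun_componentwise) (auto simp: D smooth_continuous)
  have Dc': "continuous_on S (\<lambda>y. D (g y))" if "continuous_on S g" for g :: "'b::topological_space \<Rightarrow> heis" and S
    using Dc that by (rule continuous_on_compose2) auto
  have "((\<lambda>x. integral (cbox 0 1) (\<lambda>s. f (x + (0, 0, h * s)))) has_derivative
     blinfun_apply (integral (cbox 0 1) (\<lambda>s. D (x + (0, 0, h * s))))) (at x within UNIV)"
  proof (rule leibniz_rule)
    fix y :: heis and s :: real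
    have "((\<lambda>y. f (y + (0, 0, h * s))) has_derivative (\<lambda>v. dd f v (y + (0, 0, h * s)))) (at y)"
      by (rule has_derivative_compose[where g=f, OF _ smooth_has_derivative[OF f]]) (auto intro!: derivative_eq_intros)
    then show "((\<lambda>y. f (y + (0, 0, h * s))) has_derivative blinfun_apply (D (y + (0, 0, h * s)))) (at y within UNIV)"
      by (simp add: D)
    show "continuous_on (UNIV \<times> cbox 0 1) (\<lambda>(x, s). D (x + (0, 0, h * s)))"
      unfolding split_beta by (intro Dc' continuous_intros)
  qed (use avg_integrable[OF f] in auto)
  moreover have "blinfun_apply (integral (cbox 0 1) (\<lambda>s. D (x + (0, 0, h * s)))) = (\<lambda>v. avg h (dd f v) x)"
  proof
    fix v
    have "(\<lambda>s. D (x + (0, 0, h * s))) integrable_on {0..1}"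
      by (intro integrable_continuous_interval Dc' continuous_intros)
    from integral_linear[OF this blinfun.bounded_linear_left[of v]]
    show "blinfun_apply (integral (cbox 0 1) (\<lambda>s. D (x + (0, 0, h * s)))) v = avg h (dd f v) x" by (simp add: avg_def comp_def D)
  qed
  ultimately have "((\<lambda>x. integral (cbox 0 1) (\<lambda>s. f (x + (0, 0, h * s)))) has_derivative
      (\<lambda>v. avg h (dd f v) x)) (at x)"
    by simp
  then show ?thesis by (simp add: avg_def[abs_def])
qed

lemma dd_avg: "smooth f \<Longrightarrow> dd (avg h f) v = avg h (dd f v)"
  using dd_eq[OF avg_has_derivative] by blast

lemma smooth_avg [simp]:
  assumes "smooth f" shows "smooth (avg h f)"
proof (rule smooth_coinduct[where P="\<lambda>g. \<exists>f. smooth f \<and> g = avg h f"])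
  fix g assume "\<exists>f. smooth f \<and> g = avg h f"
  then obtain f where f: "smooth f" "g = avg h f" by auto
  have "g differentiable (at x)" for x
    using avg_has_derivative[OF f(1)] f(2) unfolding differentiable_def by blast
  moreover have "\<exists>f. smooth f \<and> dd g v = avg h f" for v
    using f dd_avg[OF f(1)] smooth_dd by blast
  ultimately show "(\<forall>x. g differentiable (at x)) \<and> (\<forall>v. \<exists>f. smooth f \<and> dd g v = avg h f)" by blast
qed (use assms in auto)

lemma avg_linear:
  assumes "smooth f" "smooth g"
  shows avg_add: "avg h (\<lambda>x. f x + g x) x = avg h f x + avg h g x"
    and avg_diff: "avg h (\<lambda>x. f x - g x) x = avg h f x - avg h g x"
    and avg_cmult: "avg h (\<lambda>x. c * f x) x = c * avg h f x"
    and avg_fst: "avg h (\<lambda>x. of_real (fst x) * f x) x = of_real (fst x) * avg h f x"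
  using avg_integrable[OF assms(1)] avg_integrable[OF assms(2)]
  by (simp_all add: avg_def Henstock_Kurzweil_Integration.integral_add Henstock_Kurzweil_Integration.integral_diff)

lemma field_avg:
  assumes f: "smooth f"
  shows field_A_avg: "field_A (avg h f) = avg h (field_A f)"
    and field_B_avg: "field_B (avg h f) = avg h (field_B f)"
    and field_C_avg: "field_C (avg h f) = avg h (field_C f)"
proof -
  show "field_A (avg h f) = avg h (field_A f)" "field_C (avg h f) = avg h (field_C f)"
    using dd_avg[OF f] by (auto simp: field_A_def[abs_def] field_C_def[abs_def])
  then have C: "field_C (avg h f) = avg h (field_C f)" by simp
  show "field_B (avg h f) = avg h (field_B f)"
  proof
    fix x
    have "field_B f = (\<lambda>x. dd f (0,1,0) x + of_real (fst x) * field_C f x)"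
      using field_B_eq[OF f] by auto
    then have "avg h (field_B f) x = avg h (dd f (0,1,0)) x + of_real (fst x) * avg h (field_C f) x"
      using f by (simp add: avg_add avg_fst[OF smooth_C[OF f] smooth_C[OF f]])
    then show "field_B (avg h f) x = avg h (field_B f) x"
      using f by (simp add: field_B_eq fun_cong[OF dd_avg] C)
  qed
qed

lemma sublap_avg:
  assumes f: "smooth f" shows "sublap (avg h f) = avg h (sublap f)"
proof
  fix x
  have "sublap f = (\<lambda>x. (-1) * (field_A (field_A f) x + field_B (field_B f) x))"
    by (simp add: sublap_def[abs_def])
  then have "avg h (sublap f) x = (-1) * (avg h (field_A (field_A f)) x + avg h (field_B (field_B f)) x)"
    using f by (simp only: avg_cmult[OF smooth_add smooth_const] smooth_A smooth_B avg_add)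
  then show "sublap (avg h f) x = avg h (sublap f) x"
    using f by (simp add: sublap_def field_avg)
qed

lemma nil_smooth_avg [simp]:
  assumes f: "f \<in> nil_smooth" shows "avg h f \<in> nil_smooth"
proof -
  have "heis_mult \<gamma> x + (0, 0, s) = heis_mult \<gamma> (x + (0, 0, s))" for \<gamma> x s
    by (cases \<gamma>; cases x) simp
  then show ?thesis
    using f by (auto simp: nil_smooth_iff nil_invariant_def avg_def)
qed

text \<open>By the fundamental theorem of calculus C of an average is a difference quotient. It
  contains no derivative of f and is therefore bounded in the square norm, with constant 2 /
  h.\<close>

lemma field_C_avg_eq:
  assumes f: "smooth f" and h: "h \<noteq> 0"
  shows "field_C (avg h f) x = (f (x + (0, 0, h)) - f x) / of_real h"
proof -
  have "((\<lambda>s. field_C f (x + (0, 0, h * s))) has_integral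
      f (x + (0, 0, h * 1)) / of_real h - f (x + (0, 0, h * 0)) / of_real h) {0..1}"
  proof (rule fundamental_theorem_of_calculus)
    fix s :: real
    have "((\<lambda>s. f (x + s *\<^sub>R (0, 0, h))) has_vector_derivative dd f (h *\<^sub>R (0, 0, 1)) (x + s *\<^sub>R (0, 0, h))) (at s within {0..1})"
      using smooth_line_derivative[OF f, of x "(0, 0, h)"] by simp
    then have "((\<lambda>s. f (x + (0, 0, h * s))) has_vector_derivative of_real h * field_C f (x + (0, 0, h * s))) (at s within {0..1})"
      by (simp only: dd_scaleR_dir[OF f]) (simp add: field_C_def mult.commute scaleR_conv_of_real)
    from has_vector_derivative_divide[OF this, of "of_real h"]
    show "((\<lambda>s. f (x + (0, 0, h * s)) / of_real h) has_vector_derivative field_C f (x + (0, 0, h * s))) (at s within {0..1})"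
      using h by simp
  qed simp
  then show ?thesis
    using f by (simp add: field_C_avg avg_def integral_unique diff_divide_distrib zero_prod_def[symmetric])
qed

lemma l2_shift:
  assumes f: "f \<in> nil_smooth"
  shows "l2 (\<lambda>x. f (x + (0, 0, s))) = l2 f"
proof -
  have sm: "smooth f" using f by simp
  have c: "continuous_on UNIV (\<lambda>x. f (x + (0, 0, s)))"
    by (intro smooth_continuous_compose[OF sm] continuous_intros)
  have "ennreal ((l2 (\<lambda>x. f (x + (0, 0, s))))\<^sup>2) = ennreal ((l2 f)\<^sup>2)"
    unfolding nn_integral_nsq[OF sqint_continuous[OF c], symmetric] nn_integral_nsq[OF sqint_nil_smooth[OF f], symmetric]
    using continuous_nilM_measurable[OF c] continuous_nilM_measurable[OF smooth_continuous[OF sm]]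
    by (subst (1 2) nn_integral_nilM) (simp_all add: nn_shift[OF f])
  then show ?thesis by simp
qed

text \<open>Jensen's inequality in s, then an exchange of the integrals over c and s; the inner
  integral over c does not see the shift.\<close>

lemma l2_avg_le:
  assumes f: "f \<in> nil_smooth"
  shows "l2 (avg h f) \<le> l2 f"
proof -
  have sm: "smooth f" and sa: "smooth (avg h f)" using f by simp_all
  have "nsq (avg h f) (a, b, c) \<le> (\<integral>\<^sup>+s. nsq f (a, b, c + h * s) \<partial>unitM)" for a b c
  proof -
    have c: "continuous_on {0..1} (\<lambda>s. f (a, b, c + h * s))"
      by (intro smooth_continuous_compose[OF sm] continuous_intros)
    have "cmod (avg h f (a, b, c)) \<le> (LINT s|unitM. cmod (f (a, b, c + h * s)))"
      using integral_norm_bound[of unitM "\<lambda>s. f (a, b, c + h * s)"] by (simp add: avg_def unitM_integral_eq[OF c])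
    then have "(cmod (avg h f (a, b, c)))\<^sup>2 \<le> (LINT s|unitM. cmod (f (a, b, c + h * s)))\<^sup>2"
      by (intro power_mono) auto
    also have "\<dots> \<le> (LINT s|unitM. (cmod (f (a, b, c + h * s)))\<^sup>2)"
      by (intro unitM_Jensen continuous_intros c)
    finally show ?thesis using nn_unitM_norm_square[OF c] by (simp add: ennreal_leI)
  qed
  then have 1: "(\<integral>\<^sup>+c. nsq (avg h f) (a, b, c) \<partial>unitM) \<le> (\<integral>\<^sup>+c. \<integral>\<^sup>+s. nsq f (a, b, c + h * s) \<partial>unitM \<partial>unitM)" for a b
    by (intro nn_integral_mono)
  have 2: "(\<integral>\<^sup>+c. \<integral>\<^sup>+s. nsq f (a, b, c + h * s) \<partial>unitM \<partial>unitM) = (\<integral>\<^sup>+c. nsq f (a, b, c) \<partial>unitM)" for a b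
  proof -
    have m: "(\<lambda>(c, s). nsq f (a, b, c + h * s)) \<in> borel_measurable (unitM \<Otimes>\<^sub>M unitM)"
      unfolding split_beta'
      by (intro measurable_compose[OF measurable_unitM2 measurable_ennreal] continuous_intros smooth_continuous_compose[OF sm])
    show ?thesis using nn_unitM_swap[OF m] by (simp add: nn_shift[OF f])
  qed
  have 3: "(\<integral>\<^sup>+c. nsq (avg h f) (a, b, c) \<partial>unitM) \<le> (\<integral>\<^sup>+c. nsq f (a, b, c) \<partial>unitM)" for a b
    using 1[of a b] 2[of a b] by simp
  have "nsq g \<in> borel_measurable nilM" if "smooth g" for g
    using continuous_nilM_measurable[OF smooth_continuous[OF that]] by measurable
  from nn_integral_nilM[OF this[OF sm]] nn_integral_nilM[OF this[OF sa]]
  have "(\<integral>\<^sup>+x. nsq (avg h f) x \<partial>nilM) \<le> (\<integral>\<^sup>+x. nsq f x \<partial>nilM)"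
    by (simp only:) (rule nn_integral_mono, rule nn_integral_mono, rule 3)
  then have "ennreal ((l2 (avg h f))\<^sup>2) \<le> ennreal ((l2 f)\<^sup>2)"
    using f by (simp add: nn_integral_nsq)
  then show ?thesis by (intro power2_le_imp_le[of "l2 (avg h f)"]) simp_all
qed

lemma l2_C_avg_le:
  assumes f: "f \<in> nil_smooth" and h: "0 < h"
  shows "l2 (field_C (avg h f)) \<le> 2 / h * l2 f"
proof -
  have sm: "smooth f" using f by simp
  have c: "sqint (\<lambda>x. f (x + (0, 0, h)))"
    by (intro sqint_continuous smooth_continuous_compose[OF sm] continuous_intros)
  have "field_C (avg h f) = (\<lambda>x. of_real (1 / h) * (f (x + (0, 0, h)) - f x))"
    using field_C_avg_eq[OF sm, of h] h by auto
  then have "l2 (field_C (avg h f)) = 1 / h * l2 (\<lambda>x. f (x + (0, 0, h)) - f x)"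
    using h by (simp only: l2_cmult norm_of_real) simp
  also have "l2 (\<lambda>x. f (x + (0, 0, h)) - f x) \<le> l2 f + l2 f"
    using l2_triangle[OF c sqint_cmult[of f "-1"]] f l2_cmult[of "-1" f] by (simp add: l2_shift)
  finally show ?thesis using h by (simp add: divide_right_mono)
qed

text \<open>Uniform continuity on a compact set makes \<open>avg h f\<close> uniformly close to f on
  the cube, and the cube has measure 1.\<close>

lemma avg_tendsto:
  assumes f: "f \<in> nil_smooth" and e: "0 < e"
  obtains h where "0 < h" "l2 (\<lambda>x. avg h f x - f x) \<le> e"
proof -
  have sm: "smooth f" using f by simp
  \<comment> \<open>The last side has length 2 to leave room for the shift \<open>h * s\<close>,
    which is at most 1.\<close>
  let ?K = "cbox 0 1 \<times> cbox 0 1 \<times> cbox 0 2 :: heis set"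
  have "uniformly_continuous_on ?K f"
    by (intro compact_uniformly_continuous smooth_continuous sm compact_Times compact_cbox)
  then obtain d where d: "d > 0" "\<And>x y. x \<in> ?K \<Longrightarrow> y \<in> ?K \<Longrightarrow> dist y x < d \<Longrightarrow> dist (f y) (f x) < e"
    using e unfolding uniformly_continuous_on_def by metis
  define h where "h = min 1 (d / 2)"
  have h: "0 < h" "h \<le> 1" "h < d" using d(1) by (auto simp: h_def)
  have "cmod (avg h f x - f x) \<le> e" if x: "x \<in> cube" for x
  proof -
    have bd: "norm (f (x + (0, 0, h * s)) - f x) \<le> e" if s: "s \<in> {0..1}" for s
    proof -
      have "h * s \<le> h" using h s by (intro mult_left_le) auto
      then have hs: "h * s \<le> 1" "h * s < d" using h by linarith+
      have "0 \<le> h * s" using h s by simp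
      have "dist (f (x + (0, 0, h * s))) (f x) < e"
        using x hs \<open>0 \<le> h * s\<close> by (intro d(2)) (auto simp: cube_def dist_Pair_Pair dist_real_def)
      then show ?thesis by (simp add: dist_norm)
    qed
    have "avg h f x - f x = integral {0..1} (\<lambda>s. f (x + (0, 0, h * s)) - f x)"
      unfolding avg_def
      by (subst Henstock_Kurzweil_Integration.integral_diff[OF avg_integrable[OF sm]]) auto
    also have "cmod \<dots> \<le> e * (1 - 0)"
      using bd by (intro integral_bound continuous_intros smooth_continuous_compose[OF sm]) auto
    finally show ?thesis by simp
  qed
  then have "l2 (\<lambda>x. avg h f x - f x) \<le> e"
    using f e by (intro l2_le_bound) auto
  then show ?thesis using h that by blast
qed

section \<open>Approximate eigenfunctions\<close>

text \<open>The sequence is only required to be Cauchy and its limit is not named. Differential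
  operators can then be applied termwise without saying what they do to a limit that may not be
  differentiable.\<close>

definition approx_eigen :: "real \<Rightarrow> (nat \<Rightarrow> heis \<Rightarrow> complex) \<Rightarrow> bool" where
  "approx_eigen \<mu> \<phi> \<longleftrightarrow> (\<forall>n. \<phi> n \<in> nil_smooth) \<and>
     (\<forall>e>0. \<exists>N. \<forall>m\<ge>N. \<forall>n\<ge>N. l2 (\<lambda>x. \<phi> m x - \<phi> n x) < e) \<and>
     (\<lambda>n. l2 (\<lambda>x. sublap (\<phi> n) x - of_real (\<mu>\<^sup>2) * \<phi> n x)) \<longlonglongrightarrow> 0"

lemma approx_eigen_smooth: "approx_eigen \<mu> \<phi> \<Longrightarrow> \<phi> n \<in> nil_smooth"
  by (simp add: approx_eigen_def)

text \<open>Meant for \<open>avg h\<close> and for \<open>field_C\<close> after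
  \<open>avg h\<close>, both bounded in the square norm and commuting with \<open>sublap\<close>.
  The conclusion does not mention K, so a constant 2 / h does no harm.\<close>

lemma approx_eigen_map:
  assumes \<phi>: "approx_eigen \<mu> \<phi>"
    and S: "\<And>f. f \<in> nil_smooth \<Longrightarrow> T f \<in> nil_smooth"
    and diff: "\<And>f g. f \<in> nil_smooth \<Longrightarrow> g \<in> nil_smooth \<Longrightarrow> T (\<lambda>x. f x - g x) = (\<lambda>x. T f x - T g x)"
    and cmult: "\<And>f c. f \<in> nil_smooth \<Longrightarrow> T (\<lambda>x. c * f x) = (\<lambda>x. c * T f x)"
    and L: "\<And>f. f \<in> nil_smooth \<Longrightarrow> T (sublap f) = sublap (T f)"
    and bd: "\<And>f. f \<in> nil_smooth \<Longrightarrow> l2 (T f) \<le> K * l2 f"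
  shows "approx_eigen \<mu> (\<lambda>n. T (\<phi> n))"
proof -
  note s = approx_eigen_smooth[OF \<phi>]
  \<comment> \<open>A positive constant, since e is divided by it.\<close>
  define K' where "K' = max 1 K"
  have K': "0 < K'" "\<And>f. f \<in> nil_smooth \<Longrightarrow> l2 (T f) \<le> K' * l2 f"
    unfolding K'_def by (auto intro!: order_trans[OF bd] mult_right_mono)
  have "\<exists>N. \<forall>m\<ge>N. \<forall>n\<ge>N. l2 (\<lambda>x. T (\<phi> m) x - T (\<phi> n) x) < e" if "e > 0" for e
  proof -
    have "e / K' > 0" using that K'(1) by simp
    then obtain N where N: "\<And>m n. m \<ge> N \<Longrightarrow> n \<ge> N \<Longrightarrow> l2 (\<lambda>x. \<phi> m x - \<phi> n x) < e / K'"
      using \<phi> unfolding approx_eigen_def by blast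
    have "l2 (\<lambda>x. T (\<phi> m) x - T (\<phi> n) x) < e" if "m \<ge> N" "n \<ge> N" for m n
    proof -
      have "l2 (\<lambda>x. T (\<phi> m) x - T (\<phi> n) x) \<le> K' * l2 (\<lambda>x. \<phi> m x - \<phi> n x)"
        using K'(2)[of "\<lambda>x. \<phi> m x - \<phi> n x"] s by (simp add: diff)
      also have "\<dots> < e" using N[OF that] K'(1) by (simp add: pos_less_divide_eq mult.commute)
      finally show ?thesis .
    qed
    then show ?thesis by blast
  qed
  moreover have "(\<lambda>n. l2 (\<lambda>x. sublap (T (\<phi> n)) x - of_real (\<mu>\<^sup>2) * T (\<phi> n) x)) \<longlonglongrightarrow> 0"
  proof (rule tendsto_sandwich)
    show "\<forall>\<^sub>F n in sequentially. 0 \<le> l2 (\<lambda>x. sublap (T (\<phi> n)) x - of_real (\<mu>\<^sup>2) * T (\<phi> n) x)" by simp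
    have "l2 (\<lambda>x. sublap (T (\<phi> n)) x - of_real (\<mu>\<^sup>2) * T (\<phi> n) x)
        \<le> K' * l2 (\<lambda>x. sublap (\<phi> n) x - of_real (\<mu>\<^sup>2) * \<phi> n x)" for n
      using K'(2)[of "\<lambda>x. sublap (\<phi> n) x - of_real (\<mu>\<^sup>2) * \<phi> n x"] s[of n]
      by (simp add: diff cmult L del: of_real_power)
    then show "\<forall>\<^sub>F n in sequentially. l2 (\<lambda>x. sublap (T (\<phi> n)) x - of_real (\<mu>\<^sup>2) * T (\<phi> n) x)
        \<le> K' * l2 (\<lambda>x. sublap (\<phi> n) x - of_real (\<mu>\<^sup>2) * \<phi> n x)" by simp
    show "(\<lambda>n. K' * l2 (\<lambda>x. sublap (\<phi> n) x - of_real (\<mu>\<^sup>2) * \<phi> n x)) \<longlonglongrightarrow> 0"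
      using \<phi> tendsto_mult_right_zero unfolding approx_eigen_def by blast
  qed simp
  ultimately show ?thesis using s S by (simp add: approx_eigen_def)
qed

lemma approx_eigen_avg: "approx_eigen \<mu> \<phi> \<Longrightarrow> approx_eigen \<mu> (\<lambda>n. avg h (\<phi> n))"
  by (rule approx_eigen_map[where K=1])
     (auto simp: avg_diff[OF nil_smooth_smooth nil_smooth_smooth] avg_cmult[OF nil_smooth_smooth smooth_const] sublap_avg l2_avg_le)

lemma approx_eigen_C_avg:
  assumes "approx_eigen \<mu> \<phi>" "0 < h"
  shows "approx_eigen \<mu> (\<lambda>n. field_C (avg h (\<phi> n)))"
proof (rule approx_eigen_map[OF assms(1), where K="2 / h" and T="\<lambda>f. field_C (avg h f)"])
  fix f g :: "heis \<Rightarrow> complex" and c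
  assume f: "f \<in> nil_smooth"
  show "field_C (avg h (\<lambda>x. c * f x)) = (\<lambda>x. c * field_C (avg h f) x)"
    "field_C (avg h (sublap f)) = sublap (field_C (avg h f))"
    "l2 (field_C (avg h f)) \<le> 2 / h * l2 f" "field_C (avg h f) \<in> nil_smooth"
    using f assms l2_C_avg_le[of f h]
    by (auto simp: fun_eq_iff field_C_avg_eq sublap_C sublap_avg diff_divide_distrib algebra_simps)
  assume g: "g \<in> nil_smooth"
  show "field_C (avg h (\<lambda>x. f x - g x)) = (\<lambda>x. field_C (avg h f) x - field_C (avg h g) x)"
    using f g assms by (auto simp: fun_eq_iff field_C_avg_eq diff_divide_distrib)
qed

lemma approx_eigen_limit:
  assumes \<phi>: "approx_eigen \<mu> \<phi>"
  obtains N where "0 \<le> N" "(\<lambda>n. l2 (\<phi> n)) \<longlonglongrightarrow> N" "(\<lambda>n. l2 (sublap (\<phi> n))) \<longlonglongrightarrow> \<mu>\<^sup>2 * N"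
proof -
  note s = approx_eigen_smooth[OF \<phi>]
  have "Cauchy (\<lambda>n. l2 (\<phi> n))"
  proof (rule metric_CauchyI)
    fix e :: real assume "0 < e"
    then obtain N where "\<And>m n. m \<ge> N \<Longrightarrow> n \<ge> N \<Longrightarrow> l2 (\<lambda>x. \<phi> m x - \<phi> n x) < e"
      using \<phi> unfolding approx_eigen_def by blast
    then show "\<exists>M. \<forall>m\<ge>M. \<forall>n\<ge>M. dist (l2 (\<phi> m)) (l2 (\<phi> n)) < e"
      using l2_reverse_triangle[of "\<phi> _" "\<phi> _"] s
      by (intro exI[of _ N]) (auto simp: dist_real_def intro: le_less_trans[OF l2_reverse_triangle])
  qed
  then obtain N where N: "(\<lambda>n. l2 (\<phi> n)) \<longlonglongrightarrow> N"
    using Cauchy_convergent convergent_def by blast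
  have "(\<lambda>n. l2 (sublap (\<phi> n)) - \<mu>\<^sup>2 * l2 (\<phi> n)) \<longlonglongrightarrow> 0"
  proof (rule Lim_null_comparison)
    have "norm (l2 (sublap (\<phi> n)) - \<mu>\<^sup>2 * l2 (\<phi> n)) \<le> l2 (\<lambda>x. sublap (\<phi> n) x - of_real (\<mu>\<^sup>2) * \<phi> n x)" for n
    proof -
      have "l2 (\<lambda>x. of_real (\<mu>\<^sup>2) * \<phi> n x) = \<mu>\<^sup>2 * l2 (\<phi> n)"
        by (simp only: l2_cmult norm_of_real) simp
      then show ?thesis
        using l2_reverse_triangle[of "sublap (\<phi> n)" "\<lambda>x. of_real (\<mu>\<^sup>2) * \<phi> n x"] s[of n] sqint_cmult[OF sqint_nil_smooth[OF s[of n]], of "of_real (\<mu>\<^sup>2)"]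
        by simp
    qed
    then show "\<forall>\<^sub>F n in sequentially. norm (l2 (sublap (\<phi> n)) - \<mu>\<^sup>2 * l2 (\<phi> n)) \<le> l2 (\<lambda>x. sublap (\<phi> n) x - of_real (\<mu>\<^sup>2) * \<phi> n x)"
      by simp
    show "(\<lambda>n. l2 (\<lambda>x. sublap (\<phi> n) x - of_real (\<mu>\<^sup>2) * \<phi> n x)) \<longlonglongrightarrow> 0"
      using \<phi> by (simp add: approx_eigen_def)
  qed
  from tendsto_add[OF this tendsto_mult_left[OF N, of "\<mu>\<^sup>2"]]
  have "(\<lambda>n. l2 (sublap (\<phi> n))) \<longlonglongrightarrow> \<mu>\<^sup>2 * N" by simp
  moreover have "0 \<le> N" using N by (rule LIMSEQ_le_const) auto
  ultimately show ?thesis using N that by blast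
qed

section \<open>Estimates for approximate eigenfunctions in the limit\<close>

lemma l2_AB_le:
  assumes f: "f \<in> nil_smooth"
  shows "l2 (field_A f) \<le> sqrt (l2 (sublap f) * l2 f)" "l2 (field_B f) \<le> sqrt (l2 (sublap f) * l2 f)"
  using energy[OF f] by (auto intro!: real_le_rsqrt intro: order_trans[rotated])

text \<open>In the limit of \<open>energy_C\<close>, with first derivatives bounded by the energy of
  the sequence and of its C-derivative, N'^2 is at most 2 \<mu>^2 N N'. Cancelling N' leaves a
  constant that does not depend on how the C-derivative was made available.\<close>

lemma approx_eigen_C_bound:
  assumes \<phi>: "approx_eigen \<mu> \<phi>" and C: "approx_eigen \<mu> (\<lambda>n. field_C (\<phi> n))"
    and N: "(\<lambda>n. l2 (\<phi> n)) \<longlonglongrightarrow> N" and N': "(\<lambda>n. l2 (field_C (\<phi> n))) \<longlonglongrightarrow> N'"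
  shows "N' \<le> 2 * \<mu>\<^sup>2 * N"
proof -
  note s = approx_eigen_smooth[OF \<phi>]
  obtain "0 \<le> N" and L: "(\<lambda>n. l2 (sublap (\<phi> n))) \<longlonglongrightarrow> \<mu>\<^sup>2 * N"
    using approx_eigen_limit[OF \<phi>] N LIMSEQ_unique by metis
  obtain "0 \<le> N'" and L': "(\<lambda>n. l2 (sublap (field_C (\<phi> n)))) \<longlonglongrightarrow> \<mu>\<^sup>2 * N'"
    using approx_eigen_limit[OF C] N' LIMSEQ_unique by metis
  have "N'\<^sup>2 \<le> 2 * (sqrt (\<mu>\<^sup>2 * N * N) * sqrt (\<mu>\<^sup>2 * N' * N'))"
  proof (rule LIMSEQ_le)
    show "(\<lambda>n. (l2 (field_C (\<phi> n)))\<^sup>2) \<longlonglongrightarrow> N'\<^sup>2" by (intro tendsto_intros N')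
    show "(\<lambda>n. 2 * (sqrt (l2 (sublap (\<phi> n)) * l2 (\<phi> n)) * sqrt (l2 (sublap (field_C (\<phi> n))) * l2 (field_C (\<phi> n)))))
       \<longlonglongrightarrow> 2 * (sqrt (\<mu>\<^sup>2 * N * N) * sqrt (\<mu>\<^sup>2 * N' * N'))"
      by (intro tendsto_intros N N' L L')
    have "(l2 (field_C (\<phi> n)))\<^sup>2 \<le> 2 * (sqrt (l2 (sublap (\<phi> n)) * l2 (\<phi> n)) * sqrt (l2 (sublap (field_C (\<phi> n))) * l2 (field_C (\<phi> n))))" for n
    proof -
      have "(l2 (field_C (\<phi> n)))\<^sup>2 \<le> l2 (field_A (\<phi> n)) * l2 (field_B (field_C (\<phi> n))) + l2 (field_B (\<phi> n)) * l2 (field_A (field_C (\<phi> n)))"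
        by (rule energy_C[OF s])
      also have "\<dots> \<le> sqrt (l2 (sublap (\<phi> n)) * l2 (\<phi> n)) * sqrt (l2 (sublap (field_C (\<phi> n))) * l2 (field_C (\<phi> n)))
          + sqrt (l2 (sublap (\<phi> n)) * l2 (\<phi> n)) * sqrt (l2 (sublap (field_C (\<phi> n))) * l2 (field_C (\<phi> n)))"
        using s[of n] by (intro add_mono mult_mono l2_AB_le) auto
      finally show ?thesis by simp
    qed
    then show "\<exists>M. \<forall>n\<ge>M. (l2 (field_C (\<phi> n)))\<^sup>2 \<le> 2 * (sqrt (l2 (sublap (\<phi> n)) * l2 (\<phi> n)) * sqrt (l2 (sublap (field_C (\<phi> n))) * l2 (field_C (\<phi> n))))"
      by blast
  qed
  also have "\<dots> = (2 * \<mu>\<^sup>2 * N) * N'"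
  proof -
    have sq: "sqrt (\<mu>\<^sup>2 * x * x) = \<bar>\<mu>\<bar> * x" if "0 \<le> x" for x
      using that by (intro real_sqrt_unique) (simp_all add: power_mult_distrib power2_eq_square)
    show ?thesis
      unfolding sq[OF \<open>0 \<le> N\<close>] sq[OF \<open>0 \<le> N'\<close>] by (simp add: power2_eq_square)
  qed
  finally have "N' * N' \<le> (2 * \<mu>\<^sup>2 * N) * N'" by (simp add: power2_eq_square)
  then show ?thesis
    using \<open>0 \<le> N'\<close> \<open>0 \<le> N\<close> by (cases "N' = 0") (auto simp: mult_le_cancel_right)
qed

text \<open>\<open>sob2\<close> with x, l and c standing for the norms of f, \<open>sublap f\<close>
  and \<open>field_C f\<close>: the squares of ||A f|| and ||B f|| are replaced by l x, that of ||A
  B f|| by l^2 + 4 c^2.\<close>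

definition "sob_bound t x l c = (1 + t) * ((1 + t) * x\<^sup>2 + l * x / t) + ((1 + t) * (l * x) + (l\<^sup>2 + 4 * c\<^sup>2) / t) / (t::real)"

lemma sob2_le:
  assumes f: "f \<in> nil_smooth" and t: "0 < t"
  shows "sob2 t f \<le> sob_bound t (l2 f) (l2 (sublap f)) (l2 (field_C f))"
proof -
  have AB: "(l2 (field_A f))\<^sup>2 \<le> l2 (sublap f) * l2 f" "(l2 (field_B f))\<^sup>2 \<le> l2 (sublap f) * l2 f"
    using energy[OF f] by (auto intro: order_trans[rotated])
  show ?thesis
    unfolding sob2_def[OF t] sob1_def[OF t] sob_bound_def
    using t by (intro add_mono mult_left_mono divide_right_mono AB energy_AB[OF f]) auto
qed

lemma sob_bound_le:
  assumes "0 < \<mu>" "0 \<le> N" "0 \<le> c" "c \<le> 2 * \<mu>\<^sup>2 * N"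
  shows "sob_bound \<mu> N (\<mu>\<^sup>2 * N) c \<le> 20 * (1 + \<mu>)\<^sup>2 * N\<^sup>2"
proof -
  have "c\<^sup>2 \<le> (2 * \<mu>\<^sup>2 * N)\<^sup>2" using assms by (intro power_mono) auto
  \<comment> \<open>17 = 1 + 4 * 2^2, from c at most 2 \<mu>^2 N.\<close>
  then have c: "(\<mu>\<^sup>2 * N)\<^sup>2 + 4 * c\<^sup>2 \<le> 17 * \<mu>^4 * N\<^sup>2"
    by (simp add: power_mult_distrib mult.commute)
  have "sob_bound \<mu> N (\<mu>\<^sup>2 * N) c \<le> (1 + \<mu>) * ((1 + \<mu>) * N\<^sup>2 + \<mu>\<^sup>2 * N * N / \<mu>) + ((1 + \<mu>) * (\<mu>\<^sup>2 * N * N) + 17 * \<mu>^4 * N\<^sup>2 / \<mu>) / \<mu>"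
    unfolding sob_bound_def using assms
    by (intro add_mono mult_left_mono divide_right_mono c) auto
  also have "\<dots> = ((1 + \<mu>)\<^sup>2 + 2 * (\<mu> * (1 + \<mu>)) + 17 * \<mu>\<^sup>2) * N\<^sup>2"
    using assms by (simp add: field_simps power2_eq_square power4_eq_xxxx)
  \<comment> \<open>20 = 1 + 2 + 17: each of the three terms is compared with (1 + \<mu>)^2.\<close>
  also have "\<dots> \<le> (20 * (1 + \<mu>)\<^sup>2) * N\<^sup>2"
    using assms by (intro mult_right_mono) (auto simp: power2_eq_square algebra_simps)
  finally show ?thesis .
qed

text \<open>\<open>sobolev\<close> at scale t = \<mu>, followed by \<open>sob2_le\<close> for the
  sequence and for its C-derivative; the latter is what brings in the second C-derivative. Only the
  norms in the bound converge, so the estimate is kept as an explicit \<open>R n\<close> for each n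
  and the limit is taken in \<open>R\<close>.\<close>

lemma approx_eigen_sup:
  assumes \<mu>: "0 < \<mu>" and \<phi>: "approx_eigen \<mu> \<phi>" and C: "approx_eigen \<mu> (\<lambda>n. field_C (\<phi> n))"
    and CC: "approx_eigen \<mu> (\<lambda>n. field_C (field_C (\<phi> n)))"
    and N: "(\<lambda>n. l2 (\<phi> n)) \<longlonglongrightarrow> N"
  obtains R r where "R \<longlonglongrightarrow> r" "r \<le> 100 * (1 + \<mu>)^4 * N\<^sup>2" "\<And>n x. x \<in> cube \<Longrightarrow> (cmod (\<phi> n x))\<^sup>2 \<le> R n"
proof -
  note s = approx_eigen_smooth[OF \<phi>]
  obtain "0 \<le> N" and L: "(\<lambda>n. l2 (sublap (\<phi> n))) \<longlonglongrightarrow> \<mu>\<^sup>2 * N"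
    using approx_eigen_limit[OF \<phi>] N LIMSEQ_unique by metis
  obtain N1 where "0 \<le> N1" and N1: "(\<lambda>n. l2 (field_C (\<phi> n))) \<longlonglongrightarrow> N1" and L1: "(\<lambda>n. l2 (sublap (field_C (\<phi> n)))) \<longlonglongrightarrow> \<mu>\<^sup>2 * N1"
    using approx_eigen_limit[OF C] by metis
  obtain N2 where "0 \<le> N2" and N2: "(\<lambda>n. l2 (field_C (field_C (\<phi> n)))) \<longlonglongrightarrow> N2"
    using approx_eigen_limit[OF CC] by metis
  have b1: "N1 \<le> 2 * \<mu>\<^sup>2 * N" by (rule approx_eigen_C_bound[OF \<phi> C N N1])
  have b2: "N2 \<le> 2 * \<mu>\<^sup>2 * N1" by (rule approx_eigen_C_bound[OF C CC N1 N2])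
  define R where "R n = (1 + \<mu>\<^sup>2) * sob_bound \<mu> (l2 (\<phi> n)) (l2 (sublap (\<phi> n))) (l2 (field_C (\<phi> n)))
      + sob_bound \<mu> (l2 (field_C (\<phi> n))) (l2 (sublap (field_C (\<phi> n)))) (l2 (field_C (field_C (\<phi> n)))) / \<mu>\<^sup>2" for n
  define r where "r = (1 + \<mu>\<^sup>2) * sob_bound \<mu> N (\<mu>\<^sup>2 * N) N1 + sob_bound \<mu> N1 (\<mu>\<^sup>2 * N1) N2 / \<mu>\<^sup>2"
  show ?thesis
  proof (rule that[of R r])
    show "R \<longlonglongrightarrow> r"
      unfolding R_def[abs_def] r_def sob_bound_def using \<mu>
      by (intro tendsto_intros N N1 N2 L L1) auto
    have N1sq: "N1\<^sup>2 \<le> (2 * \<mu>\<^sup>2 * N)\<^sup>2" using b1 \<open>0 \<le> N1\<close> by (intro power_mono)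
    have "r \<le> (1 + \<mu>\<^sup>2) * (20 * (1 + \<mu>)\<^sup>2 * N\<^sup>2) + 20 * (1 + \<mu>)\<^sup>2 * N1\<^sup>2 / \<mu>\<^sup>2"
      unfolding r_def using \<mu> \<open>0 \<le> N\<close> \<open>0 \<le> N1\<close> \<open>0 \<le> N2\<close> b1 b2
      by (intro add_mono mult_left_mono divide_right_mono sob_bound_le) auto
    also have "\<dots> \<le> (1 + \<mu>\<^sup>2) * (20 * (1 + \<mu>)\<^sup>2 * N\<^sup>2) + 20 * (1 + \<mu>)\<^sup>2 * (2 * \<mu>\<^sup>2 * N)\<^sup>2 / \<mu>\<^sup>2"
      using N1sq by (intro add_mono divide_right_mono mult_left_mono) auto
    \<comment> \<open>The second derivative along C adds 20 * 2^2 \<mu>^4 / \<mu>^2 = 80 \<mu>^2;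
      this and the first 20 make up the constant 100.\<close>
    also have "\<dots> = (20 * (1 + \<mu>\<^sup>2) + 80 * \<mu>\<^sup>2) * ((1 + \<mu>)\<^sup>2 * N\<^sup>2)"
      using \<mu> by (simp add: divide_simps) (simp add: algebra_simps power2_eq_square power4_eq_xxxx)
    also have "\<dots> \<le> (100 * (1 + \<mu>)\<^sup>2) * ((1 + \<mu>)\<^sup>2 * N\<^sup>2)"
    proof (rule mult_right_mono)
      show "20 * (1 + \<mu>\<^sup>2) + 80 * \<mu>\<^sup>2 \<le> 100 * (1 + \<mu>)\<^sup>2"
        using \<mu> by (simp add: power2_sum)
    qed simp
    also have "\<dots> = 100 * (1 + \<mu>)^4 * N\<^sup>2"
      by (simp add: power4_eq_xxxx power2_eq_square algebra_simps)
    finally show "r \<le> 100 * (1 + \<mu>)^4 * N\<^sup>2" .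
    fix n x assume "x \<in> cube"
    then have "(cmod (\<phi> n x))\<^sup>2 \<le> (1 + \<mu>\<^sup>2) * sob2 \<mu> (\<phi> n) + sob2 \<mu> (field_C (\<phi> n)) / \<mu>\<^sup>2"
      by (rule sobolev[OF \<mu> s])
    also have "\<dots> \<le> R n"
      unfolding R_def using s[of n] \<mu>
      by (intro add_mono mult_left_mono divide_right_mono sob2_le) auto
    finally show "(cmod (\<phi> n x))\<^sup>2 \<le> R n" .
  qed
qed

text \<open>The integral of \<open>sublap\<close> vanishes, so for a nonzero eigenvalue the mean
  tends to 0. The Poincare inequality then bounds N^2 by 36 (\<mu>^2 + 4 \<mu>^4) N^2, a contraction
  for small \<mu>.\<close>

lemma approx_eigen_gap:
  assumes \<mu>: "0 < \<mu>" "\<mu> \<le> 1/8" and \<phi>: "approx_eigen \<mu> \<phi>" and C: "approx_eigen \<mu> (\<lambda>n. field_C (\<phi> n))"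
    and N: "(\<lambda>n. l2 (\<phi> n)) \<longlonglongrightarrow> N"
  shows "N = 0"
proof -
  note s = approx_eigen_smooth[OF \<phi>]
  obtain "0 \<le> N" and L: "(\<lambda>n. l2 (sublap (\<phi> n))) \<longlonglongrightarrow> \<mu>\<^sup>2 * N"
    using approx_eigen_limit[OF \<phi>] N LIMSEQ_unique by metis
  obtain N1 where "0 \<le> N1" and N1: "(\<lambda>n. l2 (field_C (\<phi> n))) \<longlonglongrightarrow> N1"
    using approx_eigen_limit[OF C] by metis
  have b1: "N1 \<le> 2 * \<mu>\<^sup>2 * N" by (rule approx_eigen_C_bound[OF \<phi> C N N1])
  let ?m = "\<lambda>n. cmod (LINT x|nilM. \<phi> n x)"
  let ?e = "\<lambda>n. l2 (\<lambda>x. sublap (\<phi> n) x - of_real (\<mu>\<^sup>2) * \<phi> n x)"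
  have m: "?m n \<le> ?e n / \<mu>\<^sup>2" for n
  proof -
    have i: "integrable nilM (\<phi> n)" "integrable nilM (sublap (\<phi> n))" "integrable nilM (field_A (field_A (\<phi> n)))" "integrable nilM (field_B (field_B (\<phi> n)))"
      using s[of n] by (auto intro!: sqint_integrable)
    have z: "(LINT x|nilM. sublap (\<phi> n) x) = 0"
      unfolding sublap_def using i s[of n] by (simp add: integral_A_zero integral_B_zero)
    have q: "sqint (\<lambda>x. sublap (\<phi> n) x - of_real (\<mu>\<^sup>2) * \<phi> n x)"
      using s[of n] by (intro sqint_diff sqint_cmult) auto
    have "nil_inner (\<lambda>x. sublap (\<phi> n) x - of_real (\<mu>\<^sup>2) * \<phi> n x) (\<lambda>x. 1) = - of_real (\<mu>\<^sup>2) * (LINT x|nilM. \<phi> n x)"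
      using i z by (simp add: nil_inner_def)
    then have "cmod (- of_real (\<mu>\<^sup>2) * (LINT x|nilM. \<phi> n x)) \<le> ?e n * l2 (\<lambda>x. 1)"
      using nil_inner_le[OF q, of "\<lambda>x. 1"] by (metis nil_smooth_const sqint_nil_smooth)
    then show ?thesis using \<mu> by (simp add: norm_mult norm_power l2_def field_simps)
  qed
  have "?m \<longlonglongrightarrow> 0"
  proof (rule tendsto_sandwich[OF _ _ tendsto_const])
    show "\<forall>\<^sub>F n in sequentially. ?m n \<le> ?e n / \<mu>\<^sup>2" using m by simp
    have "(\<lambda>n. ?e n / \<mu>\<^sup>2) \<longlonglongrightarrow> 0 / \<mu>\<^sup>2"
      using \<phi> \<mu> unfolding approx_eigen_def by (intro tendsto_intros) auto
    then show "(\<lambda>n. ?e n / \<mu>\<^sup>2) \<longlonglongrightarrow> 0" by simp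
  qed simp
  then have "(\<lambda>n. 2 * (?m n)\<^sup>2 + 36 * (l2 (sublap (\<phi> n)) * l2 (\<phi> n) + (l2 (field_C (\<phi> n)))\<^sup>2)) \<longlonglongrightarrow> 2 * 0\<^sup>2 + 36 * (\<mu>\<^sup>2 * N * N + N1\<^sup>2)"
    by (intro tendsto_intros N N1 L)
  moreover have "(\<lambda>n. (l2 (\<phi> n))\<^sup>2) \<longlonglongrightarrow> N\<^sup>2" by (intro tendsto_intros N)
  moreover have "(l2 (\<phi> n))\<^sup>2 \<le> 2 * (?m n)\<^sup>2 + 36 * (l2 (sublap (\<phi> n)) * l2 (\<phi> n) + (l2 (field_C (\<phi> n)))\<^sup>2)" for n
    using poincare[OF s[of n]] energy[OF s[of n]] by argo
  ultimately have "N\<^sup>2 \<le> 2 * 0\<^sup>2 + 36 * (\<mu>\<^sup>2 * N * N + N1\<^sup>2)"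
    by (intro LIMSEQ_le) auto
  moreover have "N1\<^sup>2 \<le> (2 * \<mu>\<^sup>2 * N)\<^sup>2" using b1 \<open>0 \<le> N1\<close> by (intro power_mono)
  ultimately have "N\<^sup>2 \<le> 36 * (\<mu>\<^sup>2 + 4 * (\<mu>\<^sup>2)\<^sup>2) * N\<^sup>2"
    by (simp add: power_mult_distrib power2_eq_square algebra_simps)
  \<comment> \<open>At the threshold 1/8 the factor is 153/256, safely below 1.\<close>
  also have "\<dots> \<le> 36 * ((1/8)\<^sup>2 + 4 * ((1/8)\<^sup>2)\<^sup>2) * N\<^sup>2"
    using \<mu> by (intro mult_right_mono mult_left_mono add_mono power_mono) auto
  also have "36 * ((1/8)\<^sup>2 + 4 * ((1/8)\<^sup>2)\<^sup>2) = (153/256 :: real)" by (simp add: power_divide)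
  finally have "N\<^sup>2 = 0" using zero_le_power2[of N] by linarith
  then show ?thesis by simp
qed

text \<open>By the gap only \<open>\<mu> > 1 / 8\<close> matters, where \<open>1 + \<mu> \<le> 9 \<mu>\<close>; then \<open>810 = 100\<^bsup>1/2\<^esup> \<cdot> 9\<^sup>2\<close>.\<close>

lemma approx_eigen_sup_scaled:
  assumes \<mu>: "0 < \<mu>" and \<phi>: "approx_eigen \<mu> \<phi>" and C: "approx_eigen \<mu> (\<lambda>n. field_C (\<phi> n))"
    and CC: "approx_eigen \<mu> (\<lambda>n. field_C (field_C (\<phi> n)))"
    and N: "(\<lambda>n. l2 (\<phi> n)) \<longlonglongrightarrow> N" and e: "0 < e"
  shows "\<forall>\<^sub>F n in sequentially. \<forall>x\<in>cube. cmod (\<phi> n x) \<le> 810 * \<mu>\<^sup>2 * N + e"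
proof -
  have "0 \<le> N" using N by (rule LIMSEQ_le_const) auto
  obtain R r where R: "R \<longlonglongrightarrow> r" "r \<le> 100 * (1 + \<mu>)^4 * N\<^sup>2" "\<And>n x. x \<in> cube \<Longrightarrow> (cmod (\<phi> n x))\<^sup>2 \<le> R n"
    using approx_eigen_sup[OF \<mu> \<phi> C CC N] by metis
  have r: "r \<le> (810 * \<mu>\<^sup>2 * N)\<^sup>2"
  proof (cases "\<mu> \<le> 1/8")
    case True
    then have "N = 0" using approx_eigen_gap[OF \<mu> _ \<phi> C N] by simp
    then show ?thesis using R(2) by simp
  next
    case False
    then have "(1 + \<mu>)^4 \<le> (9 * \<mu>)^4" using \<mu> by (intro power_mono) auto
    then have "100 * (1 + \<mu>)^4 * N\<^sup>2 \<le> 100 * (9 * \<mu>)^4 * N\<^sup>2" by (intro mult_right_mono mult_left_mono) auto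
    also have "\<dots> = (810 * \<mu>\<^sup>2 * N)\<^sup>2" by (simp add: power_mult_distrib)
    finally show ?thesis using R(2) by simp
  qed
  \<comment> \<open>\<open>R n\<close> only tends to r, so some slack is necessary; e^2 is the
    amount that becomes at most e after taking the root.\<close>
  have "\<forall>\<^sub>F n in sequentially. R n < (810 * \<mu>\<^sup>2 * N)\<^sup>2 + e\<^sup>2"
    using order_tendstoD(2)[OF R(1)] r e by (meson add_strict_increasing2 le_less_trans less_add_same_cancel1 zero_less_power)
  then show ?thesis
  proof eventually_elim
    case (elim n)
    show ?case
    proof
      fix x assume "x \<in> cube"
      have c: "0 \<le> 810 * \<mu>\<^sup>2 * N" using \<open>0 \<le> N\<close> by simp
      have "(cmod (\<phi> n x))\<^sup>2 \<le> (810 * \<mu>\<^sup>2 * N)\<^sup>2 + e\<^sup>2" using R(3)[OF \<open>x \<in> cube\<close>, of n] elim by simp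
      also have "\<dots> \<le> (810 * \<mu>\<^sup>2 * N + e)\<^sup>2" using mult_nonneg_nonneg[OF c, of e] e by (simp add: power2_sum)
      finally show "cmod (\<phi> n x) \<le> 810 * \<mu>\<^sup>2 * N + e"
        by (rule power2_le_imp_le) (use c e in simp)
    qed
  qed
qed

section \<open>The eigenspaces\<close>

lemma nn_integral_powr_2:
  "(\<integral>\<^sup>+x. ennreal (cmod (f x) powr 2) \<partial>nilM) = (\<integral>\<^sup>+x. nsq f x \<partial>nilM)"
  by (simp add: powr_numeral)

lemma nil_norm_2: "sqint f \<Longrightarrow> nil_norm 2 f = ennreal (l2 f)"
  unfolding nil_norm_def nn_integral_powr_2 nn_integral_nsq
  by (simp add: Let_def powr_half_sqrt)

lemma nil_Lp_2_iff: "f \<in> nil_Lp 2 \<longleftrightarrow> nil_invariant f \<and> f \<in> borel_measurable borel \<and> sqint f"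
proof -
  have "sqint f" if "f \<in> borel_measurable borel" "nil_norm 2 f < \<infinity>"
  proof -
    have [measurable]: "f \<in> borel_measurable nilM" using that(1) by (rule nilM_borel)
    have "(\<integral>\<^sup>+x. nsq f x \<partial>nilM) \<noteq> \<infinity>"
      using that(2) unfolding nil_norm_def nn_integral_powr_2 by (auto simp: Let_def split: if_splits)
    then have "integrable nilM (\<lambda>x. (cmod (f x))\<^sup>2)"
      by (intro integrableI_bounded) (auto simp: less_top)
    then show ?thesis by (simp add: sqint_def)
  qed
  then show ?thesis by (auto simp: nil_Lp_def nil_norm_2)
qed

lemma nil_smooth_Lp_2: "f \<in> nil_smooth \<Longrightarrow> f \<in> nil_Lp 2"
  by (simp add: nil_Lp_2_iff nil_smooth_iff sqint_continuous smooth_continuous borel_measurable_continuous_onI)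

lemma nil_norm_2_tendsto_0:
  assumes "\<And>n. sqint (u n)"
  shows "(\<lambda>n. nil_norm 2 (u n)) \<longlonglongrightarrow> 0 \<longleftrightarrow> (\<lambda>n. l2 (u n)) \<longlonglongrightarrow> 0"
  using tendsto_ennreal_iff[of "\<lambda>n. l2 (u n)" sequentially 0] assms by (simp add: nil_norm_2)

lemma eigenspace_iff:
  "f \<in> eigenspace \<mu> \<longleftrightarrow> f \<in> nil_Lp 2 \<and> (\<exists>\<phi>. (\<forall>n. \<phi> n \<in> nil_smooth) \<and>
     (\<lambda>n. l2 (\<lambda>x. \<phi> n x - f x)) \<longlonglongrightarrow> 0 \<and>
     (\<lambda>n. l2 (\<lambda>x. sublap (\<phi> n) x - of_real (\<mu>\<^sup>2) * f x)) \<longlonglongrightarrow> 0)"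
proof (cases "f \<in> nil_Lp 2")
  case True
  then have f: "nil_invariant f" "f \<in> borel_measurable borel" "sqint f" by (auto simp: nil_Lp_2_iff)
  have "(\<lambda>x. of_real (\<mu>\<^sup>2) * f x) \<in> nil_Lp 2"
    using f by (simp add: nil_Lp_2_iff sqint_cmult nil_invariant_def del: of_real_power)
  moreover have "sqint (\<lambda>x. \<phi> n x - f x)" "sqint (\<lambda>x. sublap (\<phi> n) x - of_real (\<mu>\<^sup>2) * f x)"
    if "\<forall>n. \<phi> n \<in> nil_smooth" for n :: nat and \<phi>
    using that f by (auto intro!: sqint_diff sqint_cmult)
  ultimately show ?thesis
    using True unfolding eigenspace_def sublap_ext_def
    by (auto simp: nil_norm_2_tendsto_0 simp del: of_real_power)
qed (simp add: eigenspace_def sublap_ext_def)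

lemma eigenspace_sqint: "f \<in> eigenspace \<mu> \<Longrightarrow> sqint f"
  by (simp add: eigenspace_iff nil_Lp_2_iff)

lemma eigenspace_measurable: "f \<in> eigenspace \<mu> \<Longrightarrow> f \<in> borel_measurable nilM"
  by (intro sqint_measurable eigenspace_sqint)

lemma eigenspace_zero: "(\<lambda>x. 0) \<in> eigenspace \<mu>"
proof -
  have sublap_zero: "sublap (\<lambda>x. 0) = (\<lambda>x. 0)" using sublap_cmult[of "\<lambda>x. 0" 0] by (intro ext) simp
  then show ?thesis
    unfolding eigenspace_iff
    by (intro conjI exI[of _ "\<lambda>n x. 0"]) (simp_all add: nil_smooth_Lp_2 l2_def sublap_zero)
qed

lemma eigenspace_add:
  assumes f: "f \<in> eigenspace \<mu>" and g: "g \<in> eigenspace \<mu>"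
  shows "(\<lambda>x. f x + g x) \<in> eigenspace \<mu>"
proof -
  note sq = eigenspace_sqint[OF f] eigenspace_sqint[OF g]
  obtain \<phi> where \<phi>: "\<And>n. \<phi> n \<in> nil_smooth" "(\<lambda>n. l2 (\<lambda>x. \<phi> n x - f x)) \<longlonglongrightarrow> 0"
     "(\<lambda>n. l2 (\<lambda>x. sublap (\<phi> n) x - of_real (\<mu>\<^sup>2) * f x)) \<longlonglongrightarrow> 0"
    using f by (auto simp: eigenspace_iff)
  obtain \<psi> where \<psi>: "\<And>n. \<psi> n \<in> nil_smooth" "(\<lambda>n. l2 (\<lambda>x. \<psi> n x - g x)) \<longlonglongrightarrow> 0"
     "(\<lambda>n. l2 (\<lambda>x. sublap (\<psi> n) x - of_real (\<mu>\<^sup>2) * g x)) \<longlonglongrightarrow> 0"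
    using g by (auto simp: eigenspace_iff)
  have "(\<lambda>x. f x + g x) \<in> nil_Lp 2"
    using f g by (auto simp: eigenspace_iff nil_Lp_2_iff nil_invariant_def)
  moreover have "(\<lambda>n. l2 (\<lambda>x. (\<phi> n x + \<psi> n x) - (f x + g x))) \<longlonglongrightarrow> 0"
  proof (rule tendsto_sandwich[OF _ _ tendsto_const])
    show "\<forall>\<^sub>F n in sequentially. l2 (\<lambda>x. (\<phi> n x + \<psi> n x) - (f x + g x)) \<le> l2 (\<lambda>x. \<phi> n x - f x) + l2 (\<lambda>x. \<psi> n x - g x)"
      using l2_triangle[OF sqint_diff[OF sqint_nil_smooth[OF \<phi>(1)] sq(1)] sqint_diff[OF sqint_nil_smooth[OF \<psi>(1)] sq(2)]]
      by (simp add: algebra_simps)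
    show "(\<lambda>n. l2 (\<lambda>x. \<phi> n x - f x) + l2 (\<lambda>x. \<psi> n x - g x)) \<longlonglongrightarrow> 0"
      using tendsto_add[OF \<phi>(2) \<psi>(2)] by simp
  qed simp
  moreover have "(\<lambda>n. l2 (\<lambda>x. sublap (\<lambda>x. \<phi> n x + \<psi> n x) x - of_real (\<mu>\<^sup>2) * (f x + g x))) \<longlonglongrightarrow> 0"
  proof (rule tendsto_sandwich[OF _ _ tendsto_const])
    have "l2 (\<lambda>x. sublap (\<lambda>x. \<phi> n x + \<psi> n x) x - of_real (\<mu>\<^sup>2) * (f x + g x))
       \<le> l2 (\<lambda>x. sublap (\<phi> n) x - of_real (\<mu>\<^sup>2) * f x) + l2 (\<lambda>x. sublap (\<psi> n) x - of_real (\<mu>\<^sup>2) * g x)" for n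
      using l2_triangle[OF sqint_diff[OF sqint_nil_smooth[OF nil_smooth_sublap[OF \<phi>(1)]] sqint_cmult[OF sq(1)]]
          sqint_diff[OF sqint_nil_smooth[OF nil_smooth_sublap[OF \<psi>(1)]] sqint_cmult[OF sq(2)]], of n "of_real (\<mu>\<^sup>2)" n "of_real (\<mu>\<^sup>2)"] \<phi>(1) \<psi>(1)
      by (simp add: sublap_add algebra_simps)
    then show "\<forall>\<^sub>F n in sequentially. l2 (\<lambda>x. sublap (\<lambda>x. \<phi> n x + \<psi> n x) x - of_real (\<mu>\<^sup>2) * (f x + g x))
       \<le> l2 (\<lambda>x. sublap (\<phi> n) x - of_real (\<mu>\<^sup>2) * f x) + l2 (\<lambda>x. sublap (\<psi> n) x - of_real (\<mu>\<^sup>2) * g x)" by simp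
    show "(\<lambda>n. l2 (\<lambda>x. sublap (\<phi> n) x - of_real (\<mu>\<^sup>2) * f x) + l2 (\<lambda>x. sublap (\<psi> n) x - of_real (\<mu>\<^sup>2) * g x)) \<longlonglongrightarrow> 0"
      using tendsto_add[OF \<phi>(3) \<psi>(3)] by simp
  qed simp
  ultimately show ?thesis
    using \<phi>(1) \<psi>(1) unfolding eigenspace_iff by (intro conjI exI[of _ "\<lambda>n x. \<phi> n x + \<psi> n x"]) auto
qed

lemma eigenspace_cmult:
  assumes f: "f \<in> eigenspace \<mu>"
  shows "(\<lambda>x. c * f x) \<in> eigenspace \<mu>"
proof -
  obtain \<phi> where \<phi>: "\<And>n. \<phi> n \<in> nil_smooth" "(\<lambda>n. l2 (\<lambda>x. \<phi> n x - f x)) \<longlonglongrightarrow> 0"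
     "(\<lambda>n. l2 (\<lambda>x. sublap (\<phi> n) x - of_real (\<mu>\<^sup>2) * f x)) \<longlonglongrightarrow> 0"
    using f by (auto simp: eigenspace_iff)
  have "(\<lambda>x. c * f x) \<in> nil_Lp 2"
    using f by (auto simp: eigenspace_iff nil_Lp_2_iff nil_invariant_def)
  moreover have "(\<lambda>n. l2 (\<lambda>x. c * \<phi> n x - c * f x)) \<longlonglongrightarrow> 0"
    using tendsto_mult_right_zero[OF \<phi>(2), of "cmod c"]
    unfolding l2_cmult[symmetric] by (simp add: right_diff_distrib)
  moreover have "(\<lambda>n. l2 (\<lambda>x. sublap (\<lambda>x. c * \<phi> n x) x - of_real (\<mu>\<^sup>2) * (c * f x))) \<longlonglongrightarrow> 0"
    using tendsto_mult_right_zero[OF \<phi>(3), of "cmod c"] \<phi>(1)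
    unfolding l2_cmult[symmetric] by (simp add: right_diff_distrib sublap_cmult mult.left_commute)
  moreover have "(\<lambda>x. c * \<phi> n x) \<in> nil_smooth" for n
    using \<phi>(1) by (intro nil_smooth_mult nil_smooth_const)
  ultimately show ?thesis
    unfolding eigenspace_iff by (intro conjI exI[of _ "\<lambda>n x. c * \<phi> n x"]) auto
qed

lemma eigenspace_diff:
  "f \<in> eigenspace \<mu> \<Longrightarrow> g \<in> eigenspace \<mu> \<Longrightarrow> (\<lambda>x. f x - g x) \<in> eigenspace \<mu>"
  using eigenspace_add[of f \<mu> "\<lambda>x. (-1) * g x"] eigenspace_cmult[of g \<mu> "-1"] by simp

lemma eigenspace_sum:
  "(\<And>e. e \<in> E \<Longrightarrow> u e \<in> eigenspace \<mu>) \<Longrightarrow> (\<lambda>x. \<Sum>e\<in>E. u e x) \<in> eigenspace \<mu>"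
  by (induction E rule: infinite_finite_induct) (simp_all add: eigenspace_zero eigenspace_add)

section \<open>From smooth approximants to bounds almost everywhere\<close>

lemma sqint_norm:
  assumes "sqint f" shows "sqint (\<lambda>x. complex_of_real (cmod (f x)))" "l2 (\<lambda>x. complex_of_real (cmod (f x))) = l2 f"
proof -
  have [measurable]: "f \<in> borel_measurable nilM" using assms by (rule sqint_measurable)
  have "(\<lambda>x. complex_of_real (cmod (f x))) \<in> borel_measurable nilM" by measurable
  then show "sqint (\<lambda>x. complex_of_real (cmod (f x)))"
    using assms unfolding sqint_def norm_of_real abs_norm_cancel by blast
  show "l2 (\<lambda>x. complex_of_real (cmod (f x))) = l2 f"
    unfolding l2_def norm_of_real abs_norm_cancel ..
qed

lemma l2_mono:
  assumes "sqint f" "g \<in> borel_measurable nilM" "\<And>x. x \<in> cube \<Longrightarrow> cmod (g x) \<le> cmod (f x)"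
  shows "sqint g" "l2 g \<le> l2 f"
proof -
  have le: "(cmod (g x))\<^sup>2 \<le> (cmod (f x))\<^sup>2" if "x \<in> space nilM" for x
    using assms(3)[of x] that by (intro power_mono) (simp_all add: space_nilM)
  have [measurable]: "g \<in> borel_measurable nilM" by fact
  have "integrable nilM (\<lambda>x. (cmod (g x))\<^sup>2)"
  proof (rule Bochner_Integration.integrable_bound)
    show "integrable nilM (\<lambda>x. (cmod (f x))\<^sup>2)" using assms(1) by (simp add: sqint_def)
    show "AE x in nilM. norm ((cmod (g x))\<^sup>2) \<le> norm ((cmod (f x))\<^sup>2)"
      using le by (intro AE_I2) simp
  qed measurable
  then show g: "sqint g" using assms(2) by (simp add: sqint_def)
  have "(l2 g)\<^sup>2 \<le> (l2 f)\<^sup>2"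
    unfolding l2_square using g assms(1) le by (intro integral_mono) (simp_all add: sqint_def)
  then show "l2 g \<le> l2 f" by (rule power2_le_imp_le) simp
qed

text \<open>The excess of |f| over c is pointwise at most |\<psi> - f| plus the slack in the bound
  for \<psi>, so its square norm is below every positive number. This replaces the choice of an
  almost everywhere convergent subsequence.\<close>

lemma AE_bound_of_approx:
  assumes f: "sqint f" and c: "0 \<le> c"
    and approx: "\<And>e. 0 < e \<Longrightarrow> \<exists>\<psi>. sqint \<psi> \<and> l2 (\<lambda>x. \<psi> x - f x) \<le> e \<and> (\<forall>x\<in>cube. cmod (\<psi> x) \<le> c + e)"
  shows "AE x in nilM. cmod (f x) \<le> c"
proof -
  define g where "g x = complex_of_real (max 0 (cmod (f x) - c))" for x
  have [measurable]: "f \<in> borel_measurable nilM" using f by (rule sqint_measurable)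
  have gm: "g \<in> borel_measurable nilM" unfolding g_def by measurable
  have g_norm: "cmod (g x) = max 0 (cmod (f x) - c)" for x
    unfolding g_def norm_of_real by simp
  have g: "sqint g"
    using c by (intro l2_mono(1)[OF f gm]) (simp add: g_norm)
  have "l2 g \<le> 0 + e" if e: "0 < e" for e
  proof -
    have "0 < e / 2" using e by simp
    from approx[OF this] obtain \<psi> where \<psi>: "sqint \<psi>" "l2 (\<lambda>x. \<psi> x - f x) \<le> e / 2" "\<forall>x\<in>cube. cmod (\<psi> x) \<le> c + e / 2"
      by blast
    define n where "n x = complex_of_real (cmod (\<psi> x - f x))" for x
    note n = sqint_norm[OF sqint_diff[OF \<psi>(1) f], folded n_def]
    have k: "sqint (\<lambda>x. complex_of_real (e / 2))" by (intro sqint_continuous continuous_on_const)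
    have "l2 g \<le> l2 (\<lambda>x. n x + complex_of_real (e / 2))"
    proof (rule l2_mono(2)[OF sqint_add[OF n(1) k] gm])
      fix x assume "x \<in> cube"
      then have "cmod (\<psi> x) \<le> c + e / 2" using \<psi>(3) by blast
      then have "max 0 (cmod (f x) - c) \<le> cmod (\<psi> x - f x) + e / 2"
        using norm_triangle_ineq2[of "f x" "\<psi> x"] e by (simp add: norm_minus_commute)
      then show "cmod (g x) \<le> cmod (n x + complex_of_real (e / 2))"
        unfolding g_norm n_def of_real_add[symmetric] norm_of_real by linarith
    qed
    also have "\<dots> \<le> l2 n + l2 (\<lambda>x. complex_of_real (e / 2))"
      by (rule l2_triangle[OF n(1) k])
    also have "l2 (\<lambda>x. complex_of_real (e / 2)) = e / 2"
      unfolding l2_def norm_of_real using e by simp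
    finally show ?thesis using n(2) \<psi>(2) by simp
  qed
  then have "l2 g \<le> 0" by (rule field_le_epsilon)
  then have "AE x in nilM. g x = 0" using l2_zero_iff[OF g] l2_nonneg[of g] by simp
  then show ?thesis
  proof eventually_elim
    case (elim x)
    then show ?case using g_norm[of x] by simp
  qed
qed

text \<open>The smooth approximants are averaged twice, after which two C-derivatives are
  approximate eigenfunctions as well. Averaging does not increase norms, so the resulting sup bound
  involves \<open>l2 f\<close> and not h, and h can be sent to 0 through
  \<open>AE_bound_of_approx\<close>.\<close>

lemma eigenspace_sup_bound:
  assumes \<mu>: "0 < \<mu>" and f: "f \<in> eigenspace \<mu>"
  shows "AE x in nilM. cmod (f x) \<le> 810 * \<mu>\<^sup>2 * l2 f"
proof -
  have sq: "sqint f" using f by (rule eigenspace_sqint)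
  obtain \<phi> where \<phi>: "\<And>n. \<phi> n \<in> nil_smooth" "(\<lambda>n. l2 (\<lambda>x. \<phi> n x - f x)) \<longlonglongrightarrow> 0"
     "(\<lambda>n. l2 (\<lambda>x. sublap (\<phi> n) x - of_real (\<mu>\<^sup>2) * f x)) \<longlonglongrightarrow> 0"
    using f by (auto simp: eigenspace_iff)
  note \<phi>s = sqint_nil_smooth[OF \<phi>(1)]
  have dist: "l2 (\<lambda>x. \<phi> m x - \<phi> n x) \<le> l2 (\<lambda>x. \<phi> m x - f x) + l2 (\<lambda>x. \<phi> n x - f x)" for m n
    using l2_triangle_diff[OF \<phi>s[of m] sq \<phi>s[of n]] by (simp add: l2_diff_commute[of f])
  have ev: "\<exists>N. \<forall>n\<ge>N. l2 (\<lambda>x. \<phi> n x - f x) < e" if "0 < e" for e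
    using order_tendstoD(2)[OF \<phi>(2) that] by (simp add: eventually_sequentially)
  have ae: "approx_eigen \<mu> \<phi>"
    unfolding approx_eigen_def
  proof (intro conjI allI impI)
    fix e :: real assume "0 < e"
    then obtain N where N: "\<And>n. n \<ge> N \<Longrightarrow> l2 (\<lambda>x. \<phi> n x - f x) < e / 2" using ev[of "e / 2"] by auto
    show "\<exists>N. \<forall>m\<ge>N. \<forall>n\<ge>N. l2 (\<lambda>x. \<phi> m x - \<phi> n x) < e"
    proof (intro exI allI impI)
      fix m n assume "m \<ge> N" "n \<ge> N"
      then show "l2 (\<lambda>x. \<phi> m x - \<phi> n x) < e" using dist[of m n] N[of m] N[of n] by linarith
    qed
  next
    show "(\<lambda>n. l2 (\<lambda>x. sublap (\<phi> n) x - of_real (\<mu>\<^sup>2) * \<phi> n x)) \<longlonglongrightarrow> 0"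
    proof (rule tendsto_sandwich[OF _ _ tendsto_const])
      have "l2 (\<lambda>x. sublap (\<phi> n) x - of_real (\<mu>\<^sup>2) * \<phi> n x)
        \<le> l2 (\<lambda>x. sublap (\<phi> n) x - of_real (\<mu>\<^sup>2) * f x) + \<mu>\<^sup>2 * l2 (\<lambda>x. \<phi> n x - f x)" for n
      proof -
        have "l2 (\<lambda>x. of_real (\<mu>\<^sup>2) * f x - of_real (\<mu>\<^sup>2) * \<phi> n x) = l2 (\<lambda>x. of_real (\<mu>\<^sup>2) * (f x - \<phi> n x))"
          by (simp add: right_diff_distrib)
        also have "\<dots> = \<mu>\<^sup>2 * l2 (\<lambda>x. \<phi> n x - f x)"
          unfolding l2_cmult norm_of_real by (simp add: l2_diff_commute)
        finally show ?thesis
          using l2_triangle_diff[OF sqint_nil_smooth[OF nil_smooth_sublap[OF \<phi>(1)[of n]]] sqint_cmult[OF sq] sqint_cmult[OF \<phi>s[of n]], of "of_real (\<mu>\<^sup>2)" "of_real (\<mu>\<^sup>2)"]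
          by simp
      qed
      then show "\<forall>\<^sub>F n in sequentially. l2 (\<lambda>x. sublap (\<phi> n) x - of_real (\<mu>\<^sup>2) * \<phi> n x)
        \<le> l2 (\<lambda>x. sublap (\<phi> n) x - of_real (\<mu>\<^sup>2) * f x) + \<mu>\<^sup>2 * l2 (\<lambda>x. \<phi> n x - f x)" by simp
      show "(\<lambda>n. l2 (\<lambda>x. sublap (\<phi> n) x - of_real (\<mu>\<^sup>2) * f x) + \<mu>\<^sup>2 * l2 (\<lambda>x. \<phi> n x - f x)) \<longlonglongrightarrow> 0"
        using tendsto_add[OF \<phi>(3) tendsto_mult_right_zero[OF \<phi>(2), of "\<mu>\<^sup>2"]] by simp
    qed simp
  qed (rule \<phi>(1))
  have lim: "(\<lambda>n. l2 (\<phi> n)) \<longlonglongrightarrow> l2 f"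
  proof -
    have "(\<lambda>n. l2 (\<phi> n) - l2 f) \<longlonglongrightarrow> 0"
    proof (rule Lim_null_comparison[OF always_eventually \<phi>(2)], rule allI)
      show "norm (l2 (\<phi> n) - l2 f) \<le> l2 (\<lambda>x. \<phi> n x - f x)" for n
        unfolding real_norm_def by (rule l2_reverse_triangle[OF \<phi>s sq])
    qed
    then show ?thesis by (rule LIM_zero_cancel)
  qed
  show ?thesis
  proof (rule AE_bound_of_approx[OF sq])
    fix e :: real assume e: "0 < e"
    \<comment> \<open>Five errors will be added: the distances of \<phi> n and of \<phi> l to f, the
      latter twice, and twice the effect of averaging \<phi> l.\<close>
    then have e5: "0 < e / 5" by simp
    then obtain l where l: "\<And>n. n \<ge> l \<Longrightarrow> l2 (\<lambda>x. \<phi> n x - f x) < e / 5" using ev by blast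
    \<comment> \<open>h is fitted to the single smooth function \<phi> l; for n beyond l the
      contraction property of \<open>avg\<close> transfers the closeness.\<close>
    obtain h where h: "0 < h" "l2 (\<lambda>x. avg h (\<phi> l) x - \<phi> l x) \<le> e / 5"
      by (rule avg_tendsto[OF \<phi>(1)[of l] e5])
    define \<psi> where "\<psi> n = avg h (avg h (\<phi> n))" for n
    have \<psi>s: "\<psi> n \<in> nil_smooth" for n using \<phi>(1) by (simp add: \<psi>_def)
    have a0: "approx_eigen \<mu> \<psi>"
      unfolding \<psi>_def by (intro approx_eigen_avg ae)
    have a1: "approx_eigen \<mu> (\<lambda>n. field_C (\<psi> n))"
      unfolding \<psi>_def by (intro approx_eigen_C_avg approx_eigen_avg ae h)
    \<comment> \<open>Each \<open>field_C\<close> is taken together with its own average, where it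
      is bounded; commuting the two afterwards gives the second derivative of the double
      average.\<close>
    have "approx_eigen \<mu> (\<lambda>n. field_C (avg h (field_C (avg h (\<phi> n)))))"
      by (intro approx_eigen_C_avg ae h)
    then have a2: "approx_eigen \<mu> (\<lambda>n. field_C (field_C (\<psi> n)))"
      unfolding \<psi>_def using \<phi>(1) by (simp add: field_C_avg)
    obtain N where N: "(\<lambda>n. l2 (\<psi> n)) \<longlonglongrightarrow> N" by (rule approx_eigen_limit[OF a0])
    have "N \<le> l2 f"
    proof (rule LIMSEQ_le[OF N lim])
      show "\<exists>M. \<forall>n\<ge>M. l2 (\<psi> n) \<le> l2 (\<phi> n)"
        using \<phi>(1) unfolding \<psi>_def by (intro exI allI impI order_trans[OF l2_avg_le l2_avg_le]) simp_all
    qed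
    then have Nf: "810 * \<mu>\<^sup>2 * N \<le> 810 * \<mu>\<^sup>2 * l2 f" by (intro mult_left_mono) auto
    have "\<forall>\<^sub>F n in sequentially. (\<forall>x\<in>cube. cmod (\<psi> n x) \<le> 810 * \<mu>\<^sup>2 * N + e) \<and> n \<ge> l"
      by (intro eventually_conj approx_eigen_sup_scaled[OF \<mu> a0 a1 a2 N e] eventually_ge_at_top)
    from eventually_happens[OF this] obtain n where n: "\<forall>x\<in>cube. cmod (\<psi> n x) \<le> 810 * \<mu>\<^sup>2 * N + e" "n \<ge> l"
      by auto
    have d: "l2 (\<lambda>x. avg h u x - avg h v x) \<le> l2 (\<lambda>x. u x - v x)" if "u \<in> nil_smooth" "v \<in> nil_smooth" for u v
    proof -
      have "avg h (\<lambda>x. u x - v x) = (\<lambda>x. avg h u x - avg h v x)"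
        using that by (intro ext avg_diff) simp_all
      then show ?thesis using l2_avg_le[of "\<lambda>x. u x - v x" h] that by simp
    qed
    note av = nil_smooth_avg[OF \<phi>(1)]
    have "l2 (\<lambda>x. \<psi> n x - f x) \<le> l2 (\<lambda>x. \<psi> n x - \<psi> l x) + l2 (\<lambda>x. \<psi> l x - f x)"
      by (rule l2_triangle_diff[OF sqint_nil_smooth[OF \<psi>s] sqint_nil_smooth[OF \<psi>s] sq])
    moreover have "l2 (\<lambda>x. \<psi> n x - \<psi> l x) \<le> l2 (\<lambda>x. avg h (\<phi> n) x - avg h (\<phi> l) x)"
      unfolding \<psi>_def by (rule d[OF av av])
    moreover have "l2 (\<lambda>x. avg h (\<phi> n) x - avg h (\<phi> l) x) \<le> l2 (\<lambda>x. \<phi> n x - \<phi> l x)"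
      by (rule d[OF \<phi>(1) \<phi>(1)])
    moreover have "l2 (\<lambda>x. \<psi> l x - f x) \<le> l2 (\<lambda>x. \<psi> l x - avg h (\<phi> l) x) + l2 (\<lambda>x. avg h (\<phi> l) x - f x)"
      by (rule l2_triangle_diff[OF sqint_nil_smooth[OF \<psi>s] sqint_nil_smooth[OF av] sq])
    moreover have "l2 (\<lambda>x. \<psi> l x - avg h (\<phi> l) x) \<le> l2 (\<lambda>x. avg h (\<phi> l) x - \<phi> l x)"
      unfolding \<psi>_def by (rule d[OF av \<phi>(1)])
    moreover have "l2 (\<lambda>x. avg h (\<phi> l) x - f x) \<le> l2 (\<lambda>x. avg h (\<phi> l) x - \<phi> l x) + l2 (\<lambda>x. \<phi> l x - f x)"
      by (rule l2_triangle_diff[OF sqint_nil_smooth[OF av] sqint_nil_smooth[OF \<phi>(1)] sq])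
    ultimately have "l2 (\<lambda>x. \<psi> n x - f x) \<le> e"
      using dist[of n l] l[OF n(2)] l[OF order_refl] h(2) by linarith
    moreover have "\<forall>x\<in>cube. cmod (\<psi> n x) \<le> 810 * \<mu>\<^sup>2 * l2 f + e"
    proof
      fix x assume "x \<in> cube"
      then have "cmod (\<psi> n x) \<le> 810 * \<mu>\<^sup>2 * N + e" using n(1) by blast
      also have "\<dots> \<le> 810 * \<mu>\<^sup>2 * l2 f + e" using Nf by (rule add_right_mono)
      finally show "cmod (\<psi> n x) \<le> 810 * \<mu>\<^sup>2 * l2 f + e" .
    qed
    ultimately show "\<exists>\<psi>. sqint \<psi> \<and> l2 (\<lambda>x. \<psi> x - f x) \<le> e \<and> (\<forall>x\<in>cube. cmod (\<psi> x) \<le> 810 * \<mu>\<^sup>2 * l2 f + e)"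
      by (intro exI[of _ "\<psi> n"] conjI sqint_nil_smooth[OF \<psi>s])
  qed simp
qed

section \<open>Orthonormal families and the dimension of eigenspaces\<close>

lemma nil_inner_sum_left:
  assumes "finite E" "\<And>e. e \<in> E \<Longrightarrow> sqint (u e)" "sqint h"
  shows "nil_inner (\<lambda>x. \<Sum>e\<in>E. c e * u e x) h = (\<Sum>e\<in>E. c e * nil_inner (u e) h)"
proof -
  have "nil_inner (\<lambda>x. \<Sum>e\<in>E. c e * u e x) h = (LINT x|nilM. (\<Sum>e\<in>E. c e * (u e x * cnj (h x))))"
    by (simp add: nil_inner_def sum_distrib_right mult.assoc)
  also have "\<dots> = (\<Sum>e\<in>E. LINT x|nilM. c e * (u e x * cnj (h x)))"
    using sqint_mult_cnj[OF assms(2) assms(3)] by (intro Bochner_Integration.integral_sum) simp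
  finally show ?thesis by (simp add: nil_inner_def)
qed

definition orthonormal :: "(heis \<Rightarrow> complex) set \<Rightarrow> bool" where
  "orthonormal E \<longleftrightarrow> finite E \<and> (\<forall>e\<in>E. sqint e) \<and> (\<forall>e\<in>E. \<forall>e'\<in>E. nil_inner e e' = (if e = e' then 1 else 0))"

lemma orthonormal_inner:
  assumes "orthonormal E" "e \<in> E"
  shows "nil_inner (\<lambda>x. \<Sum>e\<in>E. c e * e x) e = c e"
proof -
  have "nil_inner (\<lambda>x. \<Sum>e\<in>E. c e * e x) e = (\<Sum>e'\<in>E. c e' * nil_inner e' e)"
    using assms by (intro nil_inner_sum_left) (auto simp: orthonormal_def)
  also have "\<dots> = (\<Sum>e'\<in>E. if e' = e then c e' else 0)"
    using assms by (intro sum.cong) (auto simp: orthonormal_def)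
  also have "\<dots> = c e" using assms by (simp add: orthonormal_def)
  finally show ?thesis .
qed

lemma orthonormal_inner_right:
  assumes "orthonormal E" "e \<in> E"
  shows "nil_inner e (\<lambda>x. \<Sum>e\<in>E. c e * e x) = cnj (c e)"
  unfolding nil_inner_cnj[of "\<lambda>x. \<Sum>e\<in>E. c e * e x" e, symmetric] orthonormal_inner[OF assms] ..

lemma orthonormal_l2:
  assumes "orthonormal E"
  shows "(l2 (\<lambda>x. \<Sum>e\<in>E. c e * e x))\<^sup>2 = (\<Sum>e\<in>E. (cmod (c e))\<^sup>2)"
proof -
  let ?f = "\<lambda>x. \<Sum>e\<in>E. c e * e x"
  have sq: "sqint ?f"
  proof (rule sqint_sum)
    show "sqint (\<lambda>x. c e * e x)" if "e \<in> E" for e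
      using assms that by (simp add: orthonormal_def sqint_cmult)
  qed
  have "complex_of_real ((l2 ?f)\<^sup>2) = nil_inner ?f ?f" by (simp add: nil_inner_self)
  also have "\<dots> = (\<Sum>e\<in>E. c e * nil_inner e ?f)"
    using assms by (intro nil_inner_sum_left sq) (auto simp: orthonormal_def)
  also have "\<dots> = (\<Sum>e\<in>E. c e * cnj (c e))"
    by (intro sum.cong refl arg_cong2[where f=times] orthonormal_inner_right[OF assms])
  also have "\<dots> = complex_of_real (\<Sum>e\<in>E. (cmod (c e))\<^sup>2)"
    by (simp only: complex_norm_square[symmetric] of_real_sum)
  finally show ?thesis by (simp only: of_real_eq_iff)
qed

text \<open>For almost every \<open>x\<close> the bound holds for a countable dense set of coefficient vectors at
  once, hence for all of them; take the coefficients \<open>cnj (e x)\<close>.\<close>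

lemma card_orthonormal_le:
  assumes E: "orthonormal E" and K: "0 \<le> K"
    and bd: "\<And>c. AE x in nilM. cmod (\<Sum>e\<in>E. c e * e x) \<le> K * l2 (\<lambda>x. \<Sum>e\<in>E. c e * e x)"
  shows "real (card E) \<le> K\<^sup>2"
proof -
  have fin: "finite E" and sq: "\<And>e. e \<in> E \<Longrightarrow> sqint e" using E by (auto simp: orthonormal_def)
  obtain D :: "complex set" where D: "countable D" "\<And>X. open X \<Longrightarrow> X \<noteq> {} \<Longrightarrow> \<exists>d\<in>D. d \<in> X"
    by (rule countable_dense_setE) blast
  have l2_eq: "l2 (\<lambda>x. \<Sum>e\<in>E. c e * e x) = sqrt (\<Sum>e\<in>E. (cmod (c e))\<^sup>2)" for c
    using orthonormal_l2[OF E, of c] by (intro real_sqrt_unique[symmetric]) auto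
  have "countable (PiE E (\<lambda>_. D))" using fin D(1) by (intro countable_PiE)
  then have "AE x in nilM. \<forall>c\<in>PiE E (\<lambda>_. D). cmod (\<Sum>e\<in>E. c e * e x) \<le> K * sqrt (\<Sum>e\<in>E. (cmod (c e))\<^sup>2)"
    using bd unfolding l2_eq by (simp add: AE_ball_countable)
  then have AE: "AE x in nilM. (\<Sum>e\<in>E. (cmod (e x))\<^sup>2) \<le> K\<^sup>2"
  proof eventually_elim
    case (elim x)
    have all: "cmod (\<Sum>e\<in>E. c e * e x) \<le> K * sqrt (\<Sum>e\<in>E. (cmod (c e))\<^sup>2)" for c
    proof -
      define d where "d e n = (SOME z. z \<in> D \<and> z \<in> ball (c e) (1 / real (Suc n)))" for e n
      have "d e n \<in> D \<and> d e n \<in> ball (c e) (1 / real (Suc n))" for e n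
        unfolding d_def
      proof (rule someI_ex)
        have "ball (c e) (1 / real (Suc n)) \<noteq> {}" by simp
        from D(2)[OF open_ball this] show "\<exists>z. z \<in> D \<and> z \<in> ball (c e) (1 / real (Suc n))" by blast
      qed
      then have d: "\<And>e n. d e n \<in> D" "\<And>e n. dist (c e) (d e n) < 1 / real (Suc n)"
        by simp_all
      have lim: "(\<lambda>n. d e n) \<longlonglongrightarrow> c e" for e
      proof -
        have "(\<lambda>n. d e n - c e) \<longlonglongrightarrow> 0"
        proof (rule Lim_null_comparison[OF always_eventually LIMSEQ_inverse_real_of_nat], rule allI)
          show "norm (d e n - c e) \<le> inverse (real (Suc n))" for n
            using d(2)[of e n] by (simp add: dist_norm norm_minus_commute inverse_eq_divide)
        qed
        then show ?thesis by (rule LIM_zero_cancel)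
      qed
      have le: "cmod (\<Sum>e\<in>E. d e n * e x) \<le> K * sqrt (\<Sum>e\<in>E. (cmod (d e n))\<^sup>2)" for n
      proof -
        \<comment> \<open>\<open>PiE\<close> prescribes the value outside E, hence the restriction;
          the sums run over E and do not notice it.\<close>
        have "restrict (\<lambda>e. d e n) E \<in> PiE E (\<lambda>_. D)" using d(1) by auto
        from bspec[OF elim this] show ?thesis by simp
      qed
      show ?thesis
      proof (rule LIMSEQ_le)
        show "(\<lambda>n. cmod (\<Sum>e\<in>E. d e n * e x)) \<longlonglongrightarrow> cmod (\<Sum>e\<in>E. c e * e x)"
          by (intro tendsto_intros lim)
        show "(\<lambda>n. K * sqrt (\<Sum>e\<in>E. (cmod (d e n))\<^sup>2)) \<longlonglongrightarrow> K * sqrt (\<Sum>e\<in>E. (cmod (c e))\<^sup>2)"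
          by (intro tendsto_intros lim)
      qed (use le in blast)
    qed
    define s where "s = (\<Sum>e\<in>E. (cmod (e x))\<^sup>2)"
    have s: "0 \<le> s" by (simp add: s_def sum_nonneg)
    have "(\<Sum>e\<in>E. cnj (e x) * e x) = complex_of_real s"
      unfolding s_def of_real_sum by (intro sum.cong refl) (simp only: complex_norm_square mult.commute)
    then have "s \<le> K * sqrt s"
      using all[of "\<lambda>e. cnj (e x)"] s by (simp add: s_def[symmetric])
    then have "sqrt s * sqrt s \<le> K * sqrt s" using s by simp
    then have "sqrt s \<le> K"
      using K s mult_right_le_imp_le[of "sqrt s" "sqrt s" K] by (cases "s = 0") simp_all
    then have "(sqrt s)\<^sup>2 \<le> K\<^sup>2" using s by (intro power_mono) auto
    then show ?case using s by (simp add: s_def)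
  qed
  \<comment> \<open>A trace argument: integrating the pointwise bound turns a sum of unit norms into
    the number of elements.\<close>
  have "real (card E) = (\<Sum>e\<in>E. (l2 e)\<^sup>2)"
  proof -
    have "(l2 e)\<^sup>2 = 1" if "e \<in> E" for e
    proof -
      have "complex_of_real ((l2 e)\<^sup>2) = 1"
        using E that nil_inner_self[of e] by (auto simp: orthonormal_def)
      then show ?thesis by (simp only: of_real_eq_1_iff)
    qed
    then show ?thesis by simp
  qed
  also have "\<dots> = (LINT x|nilM. (\<Sum>e\<in>E. (cmod (e x))\<^sup>2))"
    using sq by (simp add: l2_square sqint_def Bochner_Integration.integral_sum)
  also have "\<dots> \<le> (LINT x|nilM. K\<^sup>2)"
    using AE sq by (intro integral_mono_AE) (auto simp: sqint_def)
  finally show ?thesis by simp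
qed

text \<open>An orthonormal family of greatest size spans up to null sets: a nonzero remainder after
  projection could be normalised and adjoined.\<close>

lemma ex_eigenbasis:
  assumes \<mu>: "0 < \<mu>"
  shows "\<exists>E. is_eigenbasis \<mu> E"
proof -
  define K where "K = 810 * \<mu>\<^sup>2"
  let ?P = "\<lambda>E. orthonormal E \<and> E \<subseteq> eigenspace \<mu>"
  have V: "(\<lambda>x. \<Sum>e\<in>E. c e * e x) \<in> eigenspace \<mu>" if "E \<subseteq> eigenspace \<mu>" for E c
    using that by (intro eigenspace_sum eigenspace_cmult) auto
  have "card E \<le> nat \<lceil>K\<^sup>2\<rceil>" if "?P E" for E
  proof -
    have "real (card E) \<le> K\<^sup>2"
      using that \<mu> by (intro card_orthonormal_le) (auto simp: K_def intro!: eigenspace_sup_bound V)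
    then show ?thesis by linarith
  qed
  moreover have "?P {}" by (simp add: orthonormal_def)
  \<comment> \<open>The successor turns the bound on the size into the strict one wanted by
    \<open>ex_has_greatest_nat\<close>.\<close>
  ultimately obtain E where E: "?P E" and max: "\<And>F. ?P F \<Longrightarrow> card F \<le> card E"
    using ex_has_greatest_nat[of ?P "{}" card "Suc (nat \<lceil>K\<^sup>2\<rceil>)"] by (metis le_imp_less_Suc)
  have fin: "finite E" and orth: "\<And>e e'. e \<in> E \<Longrightarrow> e' \<in> E \<Longrightarrow> nil_inner e e' = (if e = e' then 1 else 0)"
    using E by (auto simp: orthonormal_def)
  have "\<exists>c. AE x in nilM. f x = (\<Sum>e\<in>E. c e * e x)" if f: "f \<in> eigenspace \<mu>" for f
  proof -
    define c where "c e = nil_inner f e" for e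
    define g where "g x = f x - (\<Sum>e\<in>E. c e * e x)" for x
    have g: "g \<in> eigenspace \<mu>" unfolding g_def using f E by (intro eigenspace_diff V) auto
    have gE: "nil_inner g e = 0" if "e \<in> E" for e
    proof -
      have "nil_inner g e = nil_inner f e - nil_inner (\<lambda>x. \<Sum>e\<in>E. c e * e x) e"
        unfolding g_def using f E that by (intro nil_inner_diff_left eigenspace_sqint[of _ \<mu>] V) auto
      then show ?thesis using E that by (simp add: orthonormal_inner c_def)
    qed
    have "l2 g = 0"
    proof (rule ccontr)
      assume nz: "l2 g \<noteq> 0"
      define u where "u x = complex_of_real (1 / l2 g) * g x" for x
      have u: "u \<in> eigenspace \<mu>" unfolding u_def by (rule eigenspace_cmult[OF g])
      have uE: "nil_inner u e = 0" if "e \<in> E" for e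
        unfolding u_def nil_inner_cmult_left using gE[OF that] by simp
      then have Eu: "nil_inner e u = 0" if "e \<in> E" for e
        using uE[OF that] nil_inner_cnj[of u e] by simp
      have "l2 u = 1" unfolding u_def l2_cmult norm_of_real using nz by simp
      then have uu: "nil_inner u u = 1" by (simp add: nil_inner_self)
      have "u \<notin> E" using uu uE by auto
      moreover have "?P (insert u E)"
        using E u uu uE Eu \<open>u \<notin> E\<close> eigenspace_sqint[OF u] by (auto simp: orthonormal_def)
      ultimately show False using max[of "insert u E"] fin by simp
    qed
    then have "AE x in nilM. g x = 0" using l2_zero_iff[OF eigenspace_sqint[OF g]] by simp
    then have "AE x in nilM. f x = (\<Sum>e\<in>E. c e * e x)" by eventually_elim (simp add: g_def)
    then show ?thesis by blast
  qed
  then show ?thesis using E orth fin unfolding is_eigenbasis_def by blast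
qed

section \<open>The spectral projector\<close>

context
  fixes \<mu> :: real
  assumes \<mu>: "0 < \<mu>"
begin

abbreviation "eigenbasis \<equiv> SOME E. is_eigenbasis \<mu> E"

lemma eigenbasis: "is_eigenbasis \<mu> eigenbasis"
  by (rule someI_ex[OF ex_eigenbasis[OF \<mu>]])

lemma basis_orthonormal: "orthonormal eigenbasis"
  using eigenbasis eigenspace_sqint unfolding is_eigenbasis_def orthonormal_def by blast

lemma basis_subset: "e \<in> eigenbasis \<Longrightarrow> e \<in> eigenspace \<mu>"
  using eigenbasis unfolding is_eigenbasis_def by blast

lemma proj_eigenspace: "spec_proj_ext \<mu> f \<in> eigenspace \<mu>"
  unfolding spec_proj_ext_def by (intro eigenspace_sum eigenspace_cmult basis_subset)

text \<open>Eigenfunctions are essentially bounded, so pairing with them makes sense for every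
  integrable f.\<close>

lemma eigenspace_integrable_mult:
  assumes f: "integrable nilM f" and g: "g \<in> eigenspace \<mu>"
  shows "integrable nilM (\<lambda>x. f x * cnj (g x))"
proof (rule Bochner_Integration.integrable_bound)
  show "integrable nilM (\<lambda>x. (810 * \<mu>\<^sup>2 * l2 g) * cmod (f x))"
    using f by simp
  have [measurable]: "f \<in> borel_measurable nilM" "g \<in> borel_measurable nilM"
    using f eigenspace_measurable[OF g] by auto
  show "(\<lambda>x. f x * cnj (g x)) \<in> borel_measurable nilM" by measurable
  show "AE x in nilM. norm (f x * cnj (g x)) \<le> norm ((810 * \<mu>\<^sup>2 * l2 g) * cmod (f x))"
    using eigenspace_sup_bound[OF \<mu> g]
  proof eventually_elim
    case (elim x)
    have "cmod (f x) * cmod (g x) \<le> cmod (f x) * (810 * \<mu>\<^sup>2 * l2 g)"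
      using elim by (intro mult_left_mono) auto
    then show ?case by (simp add: norm_mult abs_mult mult.commute)
  qed
qed

text \<open>The first argument need only be integrable, so this covers both \<open>L\<^sup>2\<close> and \<open>L\<^bsup>4/3\<^esup>\<close>.\<close>

lemma inner_proj:
  assumes f: "integrable nilM f" and g: "g \<in> eigenspace \<mu>"
  shows "nil_inner f g = nil_inner (spec_proj_ext \<mu> f) g"
proof -
  let ?E = eigenbasis
  obtain c where c: "AE x in nilM. g x = (\<Sum>e\<in>?E. c e * e x)"
    using eigenbasis g unfolding is_eigenbasis_def by blast
  \<comment> \<open>The expansion of g holds up to a null set only; \<open>?g\<close> is the
    representative to which the rules for finite sums apply.\<close>
  let ?g = "\<lambda>x. \<Sum>e\<in>?E. c e * e x"
  have gV: "?g \<in> eigenspace \<mu>" by (intro eigenspace_sum eigenspace_cmult basis_subset)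
  have gm: "g \<in> borel_measurable nilM" "?g \<in> borel_measurable nilM" "f \<in> borel_measurable nilM"
    using eigenspace_measurable[OF g] eigenspace_measurable[OF gV] f by auto
  have sq: "sqint ?g" by (rule eigenspace_sqint[OF gV])
  have "nil_inner f g = nil_inner f ?g"
    using c by (intro nil_inner_cong_AE gm) auto
  also have "\<dots> = (LINT x|nilM. (\<Sum>e\<in>?E. cnj (c e) * (f x * cnj (e x))))"
    by (simp add: nil_inner_def sum_distrib_left mult.left_commute)
  also have "\<dots> = (\<Sum>e\<in>?E. LINT x|nilM. cnj (c e) * (f x * cnj (e x)))"
    by (intro Bochner_Integration.integral_sum integrable_mult_right eigenspace_integrable_mult f basis_subset)
  also have "\<dots> = (\<Sum>e\<in>?E. nil_inner f e * cnj (c e))"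
    by (simp add: nil_inner_def mult.commute)
  also have "\<dots> = (\<Sum>e\<in>?E. nil_inner f e * nil_inner e ?g)"
    by (intro sum.cong refl arg_cong2[where f=times] orthonormal_inner_right[OF basis_orthonormal, symmetric])
  also have "\<dots> = nil_inner (spec_proj_ext \<mu> f) ?g"
    unfolding spec_proj_ext_def using basis_orthonormal
    by (intro nil_inner_sum_left[symmetric] sq) (auto simp: orthonormal_def)
  also have "\<dots> = nil_inner (spec_proj_ext \<mu> f) g"
    using c by (intro nil_inner_cong_AE gm eigenspace_measurable[OF proj_eigenspace]) auto
  finally show ?thesis .
qed

text \<open>The difference lies in the eigenspace and is orthogonal to it by
  \<open>inner_proj\<close>, hence orthogonal to itself.\<close>

lemma proj_of_eigenspace:
  assumes g: "g \<in> eigenspace \<mu>"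
  shows "AE x in nilM. spec_proj_ext \<mu> g x = g x"
proof -
  let ?h = "\<lambda>x. spec_proj_ext \<mu> g x - g x"
  have h: "?h \<in> eigenspace \<mu>" by (intro eigenspace_diff proj_eigenspace g)
  note sq = eigenspace_sqint[OF h] eigenspace_sqint[OF g] eigenspace_sqint[OF proj_eigenspace]
  have "complex_of_real ((l2 ?h)\<^sup>2) = nil_inner (spec_proj_ext \<mu> g) ?h - nil_inner g ?h"
    unfolding nil_inner_self[symmetric] by (intro nil_inner_diff_left sq)
  also have "\<dots> = 0" using inner_proj[OF sqint_integrable[OF sq(2)] h] by simp
  finally have "(l2 ?h)\<^sup>2 = 0" by (simp only: of_real_eq_0_iff)
  then have "AE x in nilM. ?h x = 0" using l2_zero_iff[OF sq(1)] by simp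
  then show ?thesis by simp
qed

text \<open>\<open>spec_proj_ext\<close> is a witness for the choice in \<open>spec_proj\<close>, so
  the chosen function has the defining property; it then has the same basis coefficients as
  f.\<close>

lemma spec_proj_AE:
  assumes f: "f \<in> nil_Lp 2"
  shows "spec_proj \<mu> f \<in> eigenspace \<mu>" "AE x in nilM. spec_proj \<mu> f x = spec_proj_ext \<mu> f x"
proof -
  have sq: "sqint f" using f by (simp add: nil_Lp_2_iff)
  let ?Q = "\<lambda>g. g \<in> eigenspace \<mu> \<and> (\<forall>h\<in>eigenspace \<mu>. nil_inner (\<lambda>x. f x - g x) h = 0)"
  have "?Q (spec_proj_ext \<mu> f)"
    using inner_proj[OF sqint_integrable[OF sq]] sq
    by (simp add: proj_eigenspace nil_inner_diff_left eigenspace_sqint[OF proj_eigenspace] eigenspace_sqint)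
  then have Q: "?Q (spec_proj \<mu> f)" unfolding spec_proj_def by (rule someI[of ?Q])
  then show V: "spec_proj \<mu> f \<in> eigenspace \<mu>" by blast
  have "nil_inner f e = nil_inner (spec_proj \<mu> f) e" if "e \<in> eigenbasis" for e
    using Q basis_subset[OF that] nil_inner_diff_left[OF sq eigenspace_sqint[OF V] eigenspace_sqint[OF basis_subset[OF that]]]
    by simp
  \<comment> \<open>\<open>spec_proj_ext\<close> sees its argument only through inner products with
    the basis, so this is an equality of functions and not just one almost everywhere.\<close>
  then have "spec_proj_ext \<mu> (spec_proj \<mu> f) = spec_proj_ext \<mu> f"
    unfolding spec_proj_ext_def by simp
  then show "AE x in nilM. spec_proj \<mu> f x = spec_proj_ext \<mu> f x"
    using proj_of_eigenspace[OF V] by (auto elim: eventually_mono)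
qed

end

section \<open>Duality of the operator norms\<close>

text \<open>A real-valued counterpart of \<open>nil_norm\<close>. Where the power is not integrable
  the integral defaults to 0, so that \<open>lp\<close> is 0 where \<open>nil_norm\<close> is
  infinite for measurable functions; \<open>nil_norm_eq_lp\<close> therefore assumes
  integrability.\<close>

definition lp :: "real \<Rightarrow> (heis \<Rightarrow> complex) \<Rightarrow> real" where
  "lp p f = (LINT x|nilM. cmod (f x) powr p) powr (1 / p)"

lemma lp_nonneg [simp]: "0 \<le> lp p f"
  by (simp add: lp_def)

lemma lp_powr: "0 < p \<Longrightarrow> lp p f powr p = (LINT x|nilM. cmod (f x) powr p)"
  by (simp add: lp_def powr_powr)

lemma nil_norm_eq_lp:
  assumes "integrable nilM (\<lambda>x. cmod (f x) powr p)"
  shows "nil_norm p f = ennreal (lp p f)"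
proof -
  have "(\<integral>\<^sup>+x. ennreal (cmod (f x) powr p) \<partial>nilM) = ennreal (LINT x|nilM. cmod (f x) powr p)"
    using assms by (intro nn_integral_eq_integral) auto
  then show ?thesis by (simp add: nil_norm_def lp_def Let_def)
qed

lemma nil_Lp_integrable:
  assumes "f \<in> nil_Lp p"
  shows "f \<in> borel_measurable nilM" "integrable nilM (\<lambda>x. cmod (f x) powr p)"
proof -
  show m [measurable]: "f \<in> borel_measurable nilM"
    using assms by (auto simp: nil_Lp_def intro: nilM_borel)
  have "(\<integral>\<^sup>+x. ennreal (cmod (f x) powr p) \<partial>nilM) \<noteq> \<infinity>"
    using assms by (auto simp: nil_Lp_def nil_norm_def Let_def split: if_splits)
  then show "integrable nilM (\<lambda>x. cmod (f x) powr p)"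
    by (intro integrableI_bounded) (auto simp: less_top)
qed

lemma nil_norm_cong_AE:
  assumes "AE x in nilM. f x = g x"
  shows "nil_norm p f = nil_norm p g"
proof -
  have "(\<integral>\<^sup>+x. ennreal (cmod (f x) powr p) \<partial>nilM) = (\<integral>\<^sup>+x. ennreal (cmod (g x) powr p) \<partial>nilM)"
    using assms by (intro nn_integral_cong_AE) auto
  then show ?thesis by (simp add: nil_norm_def)
qed

text \<open>Young's inequality for the functions divided by their norms, integrated. A vanishing
  norm is treated apart, since the division would break down.\<close>

lemma Hoelder:
  assumes pq: "1 < p" "1 < q" "1 / p + 1 / q = 1"
    and f: "f \<in> borel_measurable nilM" "integrable nilM (\<lambda>x. cmod (f x) powr p)"
    and g: "g \<in> borel_measurable nilM" "integrable nilM (\<lambda>x. cmod (g x) powr q)"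
  shows "cmod (nil_inner f g) \<le> lp p f * lp q g"
proof -
  have zero: "AE x in nilM. h x = 0"
    if "lp r h = 0" "0 < r" "integrable nilM (\<lambda>x. cmod (h x) powr r)" for h r
  proof -
    have "(LINT x|nilM. cmod (h x) powr r) = 0" using lp_powr[of r h] that by simp
    then have "AE x in nilM. cmod (h x) powr r = 0"
      using that(3) by (simp add: integral_nonneg_eq_0_iff_AE)
    then show ?thesis by eventually_elim simp
  qed
  show ?thesis
  proof (cases "lp p f = 0 \<or> lp q g = 0")
    case True
    then have "AE x in nilM. f x * cnj (g x) = 0"
    proof
      assume "lp p f = 0"
      then have "AE x in nilM. f x = 0" using zero pq f by auto
      then show ?thesis by eventually_elim simp
    next
      assume "lp q g = 0"
      then have "AE x in nilM. g x = 0" using zero pq g by auto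
      then show ?thesis by eventually_elim simp
    qed
    then have "nil_inner f g = 0"
      unfolding nil_inner_def by (intro integral_eq_zero_AE)
    then show ?thesis by simp
  next
    case False
    define F where "F = lp p f"
    define G where "G = lp q g"
    have F: "0 < F" and G: "0 < G" using False by (simp_all add: F_def G_def less_le)
    have young: "cmod (f x * cnj (g x)) \<le> F * G * (cmod (f x) powr p / (F powr p * p) + cmod (g x) powr q / (G powr q * q))" for x
    proof -
      have "(cmod (f x) / F) * (cmod (g x) / G) \<le> (cmod (f x) / F) powr p / p + (cmod (g x) / G) powr q / q"
        using F G by (intro Youngs_inequality pq) auto
      also have "\<dots> = cmod (f x) powr p / (F powr p * p) + cmod (g x) powr q / (G powr q * q)"
        using F G by (simp add: powr_divide)
      finally have "F * G * ((cmod (f x) / F) * (cmod (g x) / G)) \<le> F * G * (cmod (f x) powr p / (F powr p * p) + cmod (g x) powr q / (G powr q * q))"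
        using F G by (intro mult_left_mono) auto
      then show ?thesis using F G by (simp add: norm_mult)
    qed
    have int: "integrable nilM (\<lambda>x. F * G * (cmod (f x) powr p / (F powr p * p) + cmod (g x) powr q / (G powr q * q)))"
      using f(2) g(2) by simp
    have [measurable]: "f \<in> borel_measurable nilM" "g \<in> borel_measurable nilM" by fact+
    have m: "(\<lambda>x. f x * cnj (g x)) \<in> borel_measurable nilM" by measurable
    have ifg: "integrable nilM (\<lambda>x. f x * cnj (g x))"
      by (rule Bochner_Integration.integrable_bound[OF int m])
         (use young in \<open>auto intro!: AE_I2 intro: order_trans[OF _ abs_ge_self]\<close>)
    have "cmod (nil_inner f g) \<le> (LINT x|nilM. cmod (f x * cnj (g x)))"
      unfolding nil_inner_def by (rule integral_norm_bound)
    also have "\<dots> \<le> (LINT x|nilM. F * G * (cmod (f x) powr p / (F powr p * p) + cmod (g x) powr q / (G powr q * q)))"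
      by (intro integral_mono integrable_norm ifg int young)
    also have "\<dots> = F * G * (F powr p / (F powr p * p) + G powr q / (G powr q * q))"
      using f(2) g(2) pq by (simp add: F_def G_def lp_powr)
    also have "\<dots> = F * G * (1 / p + 1 / q)"
      using F G by simp
    finally show ?thesis by (simp add: pq(3) F_def G_def)
  qed
qed

text \<open>The measure is finite and y \<le> 1 + y^p for nonnegative y.\<close>

lemma integrable_of_powr:
  assumes f: "f \<in> borel_measurable nilM" "integrable nilM (\<lambda>x. cmod (f x) powr p)" and p: "1 \<le> p"
  shows "integrable nilM f"
proof (rule Bochner_Integration.integrable_bound)
  show "integrable nilM (\<lambda>x. 1 + cmod (f x) powr p)" using f(2) by simp
  have "cmod (f x) \<le> 1 + cmod (f x) powr p" for x
  proof (cases "cmod (f x) \<le> 1")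
    case False
    then have "cmod (f x) powr 1 \<le> cmod (f x) powr p" using p by (intro powr_mono) auto
    then show ?thesis using False by simp
  qed (simp add: add_increasing2)
  then show "AE x in nilM. norm (f x) \<le> norm (1 + cmod (f x) powr p)"
    by (auto intro: order_trans[OF _ abs_ge_self])
qed (rule f(1))

text \<open>Interpolation between the square norm and the sup bound: |g|^4 is at most K^2 |g|^2
  almost everywhere.\<close>

lemma eigenspace_L4:
  assumes \<mu>: "0 < \<mu>" and g: "g \<in> eigenspace \<mu>"
  shows "integrable nilM (\<lambda>x. cmod (g x) powr 4)" "lp 4 g \<le> 29 * \<mu> * l2 g"
proof -
  define K where "K = 810 * \<mu>\<^sup>2 * l2 g"
  have [measurable]: "g \<in> borel_measurable nilM" by (rule eigenspace_measurable[OF g])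
  have sq: "integrable nilM (\<lambda>x. (cmod (g x))\<^sup>2)" using eigenspace_sqint[OF g] by (simp add: sqint_def)
  have AE: "AE x in nilM. cmod (g x) powr 4 \<le> K\<^sup>2 * (cmod (g x))\<^sup>2"
    using eigenspace_sup_bound[OF \<mu> g]
  proof eventually_elim
    case (elim x)
    have "(cmod (g x))\<^sup>2 * (cmod (g x))\<^sup>2 \<le> K\<^sup>2 * (cmod (g x))\<^sup>2"
      using elim by (intro mult_right_mono power_mono) (auto simp: K_def)
    then show ?case by (simp add: powr_numeral power4_eq_xxxx power2_eq_square mult.assoc)
  qed
  show int: "integrable nilM (\<lambda>x. cmod (g x) powr 4)"
  proof (rule Bochner_Integration.integrable_bound)
    show "integrable nilM (\<lambda>x. K\<^sup>2 * (cmod (g x))\<^sup>2)" using sq by simp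
    show "AE x in nilM. norm (cmod (g x) powr 4) \<le> norm (K\<^sup>2 * (cmod (g x))\<^sup>2)"
      using AE by eventually_elim simp
  qed measurable
  have "(lp 4 g)^4 = (LINT x|nilM. cmod (g x) powr 4)"
    using lp_powr[of 4 g] by (simp add: powr_numeral)
  also have "\<dots> \<le> (LINT x|nilM. K\<^sup>2 * (cmod (g x))\<^sup>2)"
    using int sq AE by (intro integral_mono_AE) auto
  also have "\<dots> = K\<^sup>2 * (l2 g)\<^sup>2" by (simp add: l2_square)
  also have "\<dots> = 810\<^sup>2 * (\<mu> * l2 g)^4"
    by (simp add: K_def power_mult_distrib power4_eq_xxxx power2_eq_square mult_ac)
  \<comment> \<open>29 is the least integer whose fourth power reaches 810^2.\<close>
  also have "\<dots> \<le> 29^4 * (\<mu> * l2 g)^4"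
    by (intro mult_right_mono) simp_all
  also have "\<dots> = (29 * \<mu> * l2 g)^4" by (simp add: power_mult_distrib)
  finally show "lp 4 g \<le> 29 * \<mu> * l2 g"
    using \<mu> by (subst (asm) power_mono_iff) simp_all
qed

context
  fixes \<mu> :: real
  assumes \<mu>: "0 < \<mu>"
begin

lemma l2_proj_square:
  assumes f: "integrable nilM f"
  shows "(l2 (spec_proj_ext \<mu> f))\<^sup>2 = cmod (nil_inner f (spec_proj_ext \<mu> f))"
  using inner_proj[OF \<mu> f proj_eigenspace[OF \<mu>, of f]] by (simp add: nil_inner_self norm_power)

text \<open>For the projection P, ||P f||^2 = <f, P f>, and Hoelder with exponents 4/3 and 4
  applies. Both the bound and one half of the duality start from here.\<close>

lemma proj_L43_le:
  assumes f: "f \<in> nil_Lp (4/3)" "nil_norm (4/3) f \<le> 1"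
  shows "(l2 (spec_proj_ext \<mu> f))\<^sup>2 \<le> lp 4 (spec_proj_ext \<mu> f)"
proof -
  note i = nil_Lp_integrable[OF f(1)]
  have f1: "lp (4/3) f \<le> 1"
    using f(2) by (simp add: nil_norm_eq_lp[OF i(2)])
  have "(l2 (spec_proj_ext \<mu> f))\<^sup>2 \<le> lp (4/3) f * lp 4 (spec_proj_ext \<mu> f)"
    unfolding l2_proj_square[OF integrable_of_powr[OF i, simplified]]
    by (rule Hoelder) (use i eigenspace_L4[OF \<mu> proj_eigenspace[OF \<mu>]] eigenspace_measurable[OF proj_eigenspace[OF \<mu>]] in auto)
  also have "\<dots> \<le> 1 * lp 4 (spec_proj_ext \<mu> f)" by (intro mult_right_mono f1) simp
  finally show ?thesis by simp
qed

lemma opnorm_ext_le: "nil_opnorm (4/3) 2 (spec_proj_ext \<mu>) \<le> ennreal (29 * \<mu>)"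
  unfolding nil_opnorm_def
proof (rule SUP_least)
  fix f assume "f \<in> {f \<in> nil_Lp (4/3). nil_norm (4/3) f \<le> 1}"
  then have "(l2 (spec_proj_ext \<mu> f))\<^sup>2 \<le> lp 4 (spec_proj_ext \<mu> f)" by (intro proj_L43_le) auto
  also have "\<dots> \<le> 29 * \<mu> * l2 (spec_proj_ext \<mu> f)" by (rule eigenspace_L4[OF \<mu> proj_eigenspace[OF \<mu>]])
  finally have "l2 (spec_proj_ext \<mu> f) * l2 (spec_proj_ext \<mu> f) \<le> 29 * \<mu> * l2 (spec_proj_ext \<mu> f)" by (simp add: power2_eq_square)
  then have "l2 (spec_proj_ext \<mu> f) \<le> 29 * \<mu>"
    using mult_right_le_imp_le[of "l2 (spec_proj_ext \<mu> f)" "l2 (spec_proj_ext \<mu> f)" "29 * \<mu>"] \<mu> l2_nonneg[of "spec_proj_ext \<mu> f"]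
    by (cases "l2 (spec_proj_ext \<mu> f) = 0") simp_all
  then show "nil_norm 2 (spec_proj_ext \<mu> f) \<le> ennreal (29 * \<mu>)"
    by (simp add: nil_norm_2 eigenspace_sqint[OF proj_eigenspace[OF \<mu>]] ennreal_leI)
qed

text \<open>The test function is the normalised projection u of f. The projector fixes it up to null
  sets, and \<open>proj_L43_le\<close> divided by the square norm says that this norm is at most
  ||u||_4.\<close>

lemma opnorm_ext_le_opnorm: "nil_opnorm (4/3) 2 (spec_proj_ext \<mu>) \<le> nil_opnorm 2 4 (spec_proj \<mu>)"
  unfolding nil_opnorm_def[of "4/3"]
proof (rule SUP_least)
  fix f assume "f \<in> {f \<in> nil_Lp (4/3). nil_norm (4/3) f \<le> 1}"
  then have le: "(l2 (spec_proj_ext \<mu> f))\<^sup>2 \<le> lp 4 (spec_proj_ext \<mu> f)" by (intro proj_L43_le) auto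
  have V: "spec_proj_ext \<mu> f \<in> eigenspace \<mu>" by (rule proj_eigenspace[OF \<mu>])
  show "nil_norm 2 (spec_proj_ext \<mu> f) \<le> nil_opnorm 2 4 (spec_proj \<mu>)"
  proof (cases "l2 (spec_proj_ext \<mu> f) = 0")
    case True
    then show ?thesis by (simp add: nil_norm_2 eigenspace_sqint[OF V])
  next
    case False
    then have pos: "0 < l2 (spec_proj_ext \<mu> f)" using l2_nonneg[of "spec_proj_ext \<mu> f"] by linarith
    define u where "u x = complex_of_real (1 / l2 (spec_proj_ext \<mu> f)) * spec_proj_ext \<mu> f x" for x
    have u: "u \<in> eigenspace \<mu>" unfolding u_def by (rule eigenspace_cmult[OF V])
    have "l2 u = 1" unfolding u_def l2_cmult norm_of_real using pos by simp
    then have ball: "u \<in> nil_Lp 2" "nil_norm 2 u \<le> 1"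
      using u by (simp_all add: eigenspace_iff nil_norm_2[OF eigenspace_sqint[OF u]])
    have "AE x in nilM. spec_proj \<mu> u x = u x"
      using spec_proj_AE(2)[OF \<mu> ball(1)] proj_of_eigenspace[OF \<mu> u] by eventually_elim simp
    then have n4: "nil_norm 4 (spec_proj \<mu> u) = ennreal (lp 4 u)"
      using nil_norm_cong_AE nil_norm_eq_lp[OF eigenspace_L4(1)[OF \<mu> u]] by simp
    have "lp 4 u = lp 4 (spec_proj_ext \<mu> f) / l2 (spec_proj_ext \<mu> f)"
    proof -
      have "cmod (u x) powr 4 = cmod (spec_proj_ext \<mu> f x) powr 4 / l2 (spec_proj_ext \<mu> f) powr 4" for x
        unfolding u_def norm_mult norm_of_real using pos by (simp add: powr_divide)
      moreover have "(l2 (spec_proj_ext \<mu> f) ^ 4) powr (1 / 4) = l2 (spec_proj_ext \<mu> f)"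
        using pos powr_powr[of "l2 (spec_proj_ext \<mu> f)" 4 "1 / 4"] by (simp add: powr_numeral)
      ultimately show ?thesis
        using pos by (simp add: lp_def powr_divide powr_numeral)
    qed
    then have "l2 (spec_proj_ext \<mu> f) \<le> lp 4 u"
      using le pos by (simp add: pos_le_divide_eq power2_eq_square)
    then have "nil_norm 2 (spec_proj_ext \<mu> f) \<le> nil_norm 4 (spec_proj \<mu> u)"
      unfolding n4 by (simp add: nil_norm_2 eigenspace_sqint[OF V] ennreal_leI)
    also have "\<dots> \<le> nil_opnorm 2 4 (spec_proj \<mu>)"
      unfolding nil_opnorm_def using ball by (intro SUP_upper) simp
    finally show ?thesis .
  qed
qed

lemma l2_proj_le:
  assumes f: "sqint f" shows "l2 (spec_proj_ext \<mu> f) \<le> l2 f"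
proof -
  have "l2 (spec_proj_ext \<mu> f) * l2 (spec_proj_ext \<mu> f) \<le> l2 f * l2 (spec_proj_ext \<mu> f)"
    using l2_proj_square[OF sqint_integrable[OF f]] nil_inner_le[OF f eigenspace_sqint[OF proj_eigenspace[OF \<mu>, of f]]]
    by (simp add: power2_eq_square)
  then show ?thesis
    using mult_right_le_imp_le[of "l2 (spec_proj_ext \<mu> f)" "l2 (spec_proj_ext \<mu> f)" "l2 f"] l2_nonneg[of "spec_proj_ext \<mu> f"]
    by (cases "l2 (spec_proj_ext \<mu> f) = 0") simp_all
qed

text \<open>The extremal function for the projection \<open>g\<close> of \<open>f\<close> in \<open>L\<^bsup>4/3\<^esup>\<close> is \<open>g \<bar>g\<bar>\<^sup>2\<close>, normalised.\<close>

lemma opnorm_le_opnorm_ext: "nil_opnorm 2 4 (spec_proj \<mu>) \<le> nil_opnorm (4/3) 2 (spec_proj_ext \<mu>)"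
  unfolding nil_opnorm_def[of 2]
proof (rule SUP_least)
  fix f assume "f \<in> {f \<in> nil_Lp 2. nil_norm 2 f \<le> 1}"
  then have f: "f \<in> nil_Lp 2" "nil_norm 2 f \<le> 1" by auto
  have sq: "sqint f" using f by (simp add: nil_Lp_2_iff)
  have f1: "l2 f \<le> 1" using f(2) by (simp add: nil_norm_2[OF sq])
  define g where "g = spec_proj_ext \<mu> f"
  have V: "g \<in> eigenspace \<mu>" unfolding g_def by (rule proj_eigenspace[OF \<mu>])
  have g1: "l2 g \<le> 1" using l2_proj_le[OF sq] f1 by (simp add: g_def)
  note g4 = eigenspace_L4(1)[OF \<mu> V]
  have n4: "nil_norm 4 (spec_proj \<mu> f) = ennreal (lp 4 g)"
    using nil_norm_cong_AE[OF spec_proj_AE(2)[OF \<mu> f(1)]] nil_norm_eq_lp[OF g4] by (simp add: g_def)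
  show "nil_norm 4 (spec_proj \<mu> f) \<le> nil_opnorm (4/3) 2 (spec_proj_ext \<mu>)"
  proof (cases "lp 4 g = 0")
    case True
    then show ?thesis unfolding n4 by simp
  next
    case False
    define G where "G = lp 4 g"
    have G: "0 < G" using False by (simp add: G_def less_le)
    have G4: "(LINT x|nilM. cmod (g x) powr 4) = G^4"
      using lp_powr[of 4 g] by (simp add: G_def powr_numeral)
    \<comment> \<open>With G the fourth norm of g, |h|^(4/3) = |g|^4 / G^4 has integral 1, and
      pairing h with g returns G^4 / G^3 = G.\<close>
    define h where "h x = g x * complex_of_real ((cmod (g x))\<^sup>2 / G^3)" for x
    have gL: "nil_invariant g" "g \<in> borel_measurable borel"
      using V by (simp_all add: eigenspace_iff nil_Lp_2_iff)
    have norm_h: "cmod (h x) = (cmod (g x))^3 / G^3" for x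
      unfolding h_def norm_mult norm_of_real using G by (simp add: power3_eq_cube power2_eq_square)
    have h43: "cmod (h x) powr (4/3) = cmod (g x) powr 4 / G^4" for x
    proof -
      have "(y ^ 3) powr (4/3) = y powr 4" if "0 \<le> y" for y :: real
      proof (cases "y = 0")
        case False
        then show ?thesis using that powr_powr[of y 3 "4/3"] by (simp add: powr_numeral)
      qed simp
      then have "((cmod (g x) / G) ^ 3) powr (4/3) = (cmod (g x) / G) powr 4" using G by simp
      then show ?thesis using G by (simp add: norm_h power_divide powr_divide powr_numeral)
    qed
    have hi: "integrable nilM (\<lambda>x. cmod (h x) powr (4/3))" unfolding h43 using g4 by simp
    have "lp (4/3) h = 1" unfolding lp_def h43 using G G4 by simp
    then have nh: "nil_norm (4/3) h = 1" by (simp add: nil_norm_eq_lp[OF hi])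
    have hb: "h \<in> borel_measurable borel"
    proof -
      have [measurable]: "g \<in> borel_measurable borel" by (rule gL)
      show ?thesis unfolding h_def by measurable
    qed
    have hL: "h \<in> nil_Lp (4/3)"
      using gL(1) hb nh by (simp add: nil_Lp_def nil_invariant_def h_def)
    have "nil_inner h g = complex_of_real G"
    proof -
      have "h x * cnj (g x) = complex_of_real (cmod (g x) powr 4 / G^3)" for x
      proof -
        have "h x * cnj (g x) = (g x * cnj (g x)) * complex_of_real ((cmod (g x))\<^sup>2 / G^3)"
          by (simp add: h_def)
        also have "\<dots> = complex_of_real ((cmod (g x))\<^sup>2 * ((cmod (g x))\<^sup>2 / G^3))"
          by (simp only: complex_norm_square[symmetric] of_real_mult)
        finally show ?thesis by (simp add: powr_numeral power2_eq_square power4_eq_xxxx)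
      qed
      then have "nil_inner h g = complex_of_real (LINT x|nilM. cmod (g x) powr 4 / G^3)"
        by (simp only: nil_inner_def integral_complex_of_real)
      also have "(LINT x|nilM. cmod (g x) powr 4 / G^3) = G"
        using G G4 by (simp add: field_simps power_numeral_reduce)
      finally show ?thesis .
    qed
    \<comment> \<open>Self-adjointness: since g lies in the eigenspace, h may be replaced by its
      projection, whose square norm the dual operator norm controls.\<close>
    moreover have "nil_inner h g = nil_inner (spec_proj_ext \<mu> h) g"
      by (intro inner_proj[OF \<mu> integrable_of_powr[OF nilM_borel[OF hb] hi] V]) simp
    ultimately have "G = cmod (nil_inner (spec_proj_ext \<mu> h) g)" using G by simp
    also have "\<dots> \<le> l2 (spec_proj_ext \<mu> h) * l2 g"
      by (intro nil_inner_le eigenspace_sqint[OF V] eigenspace_sqint[OF proj_eigenspace[OF \<mu>]])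
    also have "\<dots> \<le> l2 (spec_proj_ext \<mu> h) * 1" by (intro mult_left_mono g1) simp
    finally have "nil_norm 4 (spec_proj \<mu> f) \<le> nil_norm 2 (spec_proj_ext \<mu> h)"
      unfolding n4 by (simp add: nil_norm_2 eigenspace_sqint[OF proj_eigenspace[OF \<mu>]] ennreal_leI G_def)
    also have "\<dots> \<le> nil_opnorm (4/3) 2 (spec_proj_ext \<mu>)"
      unfolding nil_opnorm_def using hL nh by (intro SUP_upper) simp
    finally show ?thesis .
  qed
qed

end

theorem proposition1p3:
  "\<exists>C::real. C > 0 \<and>
     (\<forall>\<mu>::real. \<mu> > 0 \<longrightarrow>
        nil_opnorm 2 4 (spec_proj \<mu>) = nil_opnorm (4/3) 2 (spec_proj_ext \<mu>) \<and>
        nil_opnorm (4/3) 2 (spec_proj_ext \<mu>) \<le> ennreal (C * \<mu>))"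
  using opnorm_ext_le opnorm_le_opnorm_ext opnorm_ext_le_opnorm
  by (intro exI[of _ 29]) (auto intro: antisym)

end
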